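(* Let $N\in\mathbb N$, $p>1$, $\alpha>0$, $\beta>0$. Let $\mathcal A:\mathrm{KRu}(Z)\to\mathbb R^N$ be linear and continuous, and let $F:\mathbb R^N\to(-\infty,+\infty]$ be proper, convex, coercive and lower semicontinuous. Then there exists a minimizer $\mu_{\min}\in\mathcal M_p(Z)$ of $$\inf_{\mu\in\mathrm{KRu}(Z)}F(\mathcal A\mu)+G_{\alpha,\beta}(\mu)$$ that can be written as $$\mu_{\min}=\sum_{i=1}^N c_i(\delta_{z_i}-\delta_{w_i})+\mu_{\min}(Z)\,\delta_e,\qquad c_i\in\mathbb R,\ z_i,w_i\in Z.$$
   Context: $(Z,d)$ is a complete, separable, locally compact, geodesic metric space with a distinguished base point $e\in Z$. $\mathcal M(Z)$ is the space of bounded (finite signed) Borel measures on $Z$, $|\mu|$ is the total variation measure of $\mu$, $\delta_z$ is the Dirac measure at $z$, and for $p>0$, $\mathcal M_p(Z)=\{\mu\in\mathcal M(Z):\int_Z d(z,e)^p\,\mathrm d|\mu|(z)<\infty\}$. For $f:Z\to\mathbb R$ put $L(f)=\sup_{z\neq z'}|f(z)-f(z')|/d(z,z')$. On $\mathcal M_1(Z)$ define the norm $$\|\mu\|_{\mathrm{KRu}}=|\mu(Z)|+\sup\left\{\int_Z f\,\mathrm d\mu:\ f(e)=0,\ L(f)\le 1\right\},$$ and let $\mathrm{KRu}(Z)$ be the completion of $\mathcal M_1(Z)$ in this norm. The regularizer $G_{\alpha,\beta}:\mathrm{KRu}(Z)\to[0,\infty]$ is $$G_{\alpha,\beta}(\mu)=\alpha\|\mu\|_{\mathrm{KRu}}+\beta\int_Z(1+d(z,e)^p)\,\mathrm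 d|\mu|(z)\ \text{ if }\mu\in\mathcal M_p(Z),\qquad G_{\alpha,\beta}(\mu)=+\infty\ \text{ otherwise.}$$ Coercive means $F(h)\to+\infty$ as $\|h\|\to\infty$. *)

theory Defs
  imports "HOL-Analysis.Analysis"
begin

section \<open>Finite signed Borel measures\<close>

text \<open>Finite signed Borel measures are the countably additive real-valued functions on the Borel
  sets; they are made total functions on \<^typ>\<open>'a set\<close> by the value \<open>0\<close> off the Borel sets.\<close>

typedef (overloaded) ('a::topological_space) signed_measure =
  "{\<mu> :: 'a set \<Rightarrow> real.
      (\<forall>A. A \<notin> sets borel \<longrightarrow> \<mu> A = 0) \<and>
      (\<forall>A :: nat \<Rightarrow> 'a set. range A \<subseteq> sets borel \<longrightarrow> disjoint_family A \<longrightarrow>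
         (\<lambda>n. \<mu> (A n)) sums \<mu> (\<Union>n. A n))}"
  morphisms smeas Abs_signed_measure
  by (rule exI[of _ "\<lambda>_. 0"]) auto

setup_lifting type_definition_signed_measure

instantiation signed_measure :: (topological_space) real_vector
begin

lift_definition zero_signed_measure :: "'a signed_measure" is "\<lambda>_. 0" by auto

lift_definition plus_signed_measure ::
  "'a signed_measure \<Rightarrow> 'a signed_measure \<Rightarrow> 'a signed_measure" is "\<lambda>\<mu> \<nu> A. \<mu> A + \<nu> A"
  by (auto intro!: sums_add)

lift_definition minus_signed_measure ::
  "'a signed_measure \<Rightarrow> 'a signed_measure \<Rightarrow> 'a signed_measure" is "\<lambda>\<mu> \<nu> A. \<mu> A - \<nu> A"
  by (auto intro!: sums_diff)

lift_definition uminus_signed_measure ::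
  "'a signed_measure \<Rightarrow> 'a signed_measure" is "\<lambda>\<mu> A. - \<mu> A"
  by (auto intro!: sums_minus)

lift_definition scaleR_signed_measure ::
  "real \<Rightarrow> 'a signed_measure \<Rightarrow> 'a signed_measure" is "\<lambda>c \<mu> A. c * \<mu> A"
  by (auto intro!: sums_mult)

instance
  by standard (transfer, force simp: algebra_simps)+

end

lift_definition dirac :: "'a::topological_space \<Rightarrow> 'a signed_measure" is
  "\<lambda>z A. if A \<in> sets borel \<and> z \<in> A then 1 else 0"
proof (intro CollectI conjI allI impI)
  fix z :: 'a and A :: "nat \<Rightarrow> 'a set"
  assume A: "range A \<subseteq> sets borel" "disjoint_family A"
  show "(\<lambda>n. if A n \<in> sets borel \<and> z \<in> A n then 1 else 0 :: real) sums
     (if (\<Union>n. A n) \<in> sets borel \<and> z \<in> (\<Union>n. A n) then 1 else 0)"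
  proof (cases "\<exists>k. z \<in> A k")
    case True
    then obtain k where k: "z \<in> A k" by auto
    have eq: "z \<in> A n \<longleftrightarrow> n = k" for n
      using A(2) k by (auto simp: disjoint_family_on_def)
    have bor: "A n \<in> sets borel" for n using A(1) by auto
    have "(\<lambda>n. if A n \<in> sets borel \<and> z \<in> A n then 1 else 0::real) = (\<lambda>n. if n = k then 1 else 0)"
      by (simp add: eq bor)
    moreover have "(\<lambda>n. if n = k then 1 else 0::real) sums 1"
      using sums_single[of k "\<lambda>_. 1::real"] by simp
    moreover have "(if (\<Union>n. A n) \<in> sets borel \<and> z \<in> (\<Union>n. A n) then 1 else 0::real) = 1"
      using A(1) k by auto
    ultimately show ?thesis by simp
  next
    case False then show ?thesis by auto
  qed
qed auto

text \<open>\<open>\<bar>\<mu>\<bar>(A)\<close> is the supremum over the finite Borel partitions of \<open>A\<close>. That this is a finite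
  measure is shown in \<open>emeasure_total_variation\<close> and \<open>finite_total_variation\<close>.\<close>

definition variation :: "'a::topological_space signed_measure \<Rightarrow> 'a set \<Rightarrow> ennreal" where
  "variation \<mu> A =
     (SUP P\<in>{P. finite P \<and> P \<subseteq> sets borel \<and> disjoint P \<and> \<Union>P = A}.
        \<Sum>B\<in>P. ennreal \<bar>smeas \<mu> B\<bar>)"

definition total_variation :: "'a::topological_space signed_measure \<Rightarrow> 'a measure" where
  "total_variation \<mu> = measure_of UNIV (sets borel) (variation \<mu>)"

lemma smeas_add [simp]: "smeas (\<mu> + \<nu>) A = smeas \<mu> A + smeas \<nu> A"
  and smeas_diff [simp]: "smeas (\<mu> - \<nu>) A = smeas \<mu> A - smeas \<nu> A"
  and smeas_minus [simp]: "smeas (- \<mu>) A = - smeas \<mu> A"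
  and smeas_scaleR [simp]: "smeas (c *\<^sub>R \<mu>) A = c * smeas \<mu> A"
  and smeas_zero [simp]: "smeas 0 A = 0"
  and smeas_dirac: "smeas (dirac z) A = (if A \<in> sets borel \<and> z \<in> A then 1 else 0)"
  by (transfer; simp)+

lemma smeas_notin: "A \<notin> sets borel \<Longrightarrow> smeas \<mu> A = 0"
  by transfer simp

lemma smeas_sums:
  "range A \<subseteq> sets borel \<Longrightarrow> disjoint_family A \<Longrightarrow> (\<lambda>n. smeas \<mu> (A n)) sums smeas \<mu> (\<Union>n. A n)"
  by transfer simp

lemma smeas_empty [simp]: "smeas \<mu> {} = 0"
proof -
  have "(\<lambda>n::nat. smeas \<mu> {}) sums smeas \<mu> {}"
    using smeas_sums[of "\<lambda>n. {}" \<mu>] by (auto simp: disjoint_family_on_def)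
  then have "summable (\<lambda>n::nat. smeas \<mu> {})" by (rule sums_summable)
  then show ?thesis by (simp add: summable_const_iff)
qed

lemma smeas_Un:
  assumes "A \<in> sets borel" "B \<in> sets borel" "A \<inter> B = {}"
  shows "smeas \<mu> (A \<union> B) = smeas \<mu> A + smeas \<mu> B"
proof -
  have "(\<lambda>n. smeas \<mu> (binaryset A B n)) sums smeas \<mu> (\<Union>n. binaryset A B n)"
    using assms by (intro smeas_sums) (auto simp: range_binaryset_eq disjoint_family_on_def binaryset_def)
  moreover have "(\<lambda>n. smeas \<mu> (binaryset A B n)) sums (smeas \<mu> A + smeas \<mu> B)"
    by (rule binaryset_sums) simp
  ultimately show ?thesis
    by (metis UN_binaryset_eq sums_unique2)
qed

lemma smeas_Union:
  assumes "finite P" "P \<subseteq> sets borel" "disjoint P"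
  shows "smeas \<mu> (\<Union>P) = (\<Sum>B\<in>P. smeas \<mu> B)"
  using assms
proof (induction P rule: finite_induct)
  case (insert B P)
  have "B \<inter> \<Union>P = {}"
    using insert by (auto simp: disjoint_def)
  moreover have "\<Union>P \<in> sets borel"
    using insert by (intro sets.finite_Union) auto
  ultimately have "smeas \<mu> (\<Union>(insert B P)) = smeas \<mu> B + smeas \<mu> (\<Union>P)"
    using insert.prems by (simp add: smeas_Un)
  also have "smeas \<mu> (\<Union>P) = (\<Sum>B\<in>P. smeas \<mu> B)"
    using insert by (intro insert.IH) (auto simp: disjoint_def)
  finally show ?case using insert by simp
qed simp

lemma variation_ge:
  assumes "finite P" "P \<subseteq> sets borel" "disjoint P" "\<Union>P = A"
  shows "(\<Sum>B\<in>P. ennreal \<bar>smeas \<mu> B\<bar>) \<le> variation \<mu> A"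
  unfolding variation_def using assms by (intro SUP_upper) auto

lemma variation_empty [simp]: "variation \<mu> {} = 0"
proof -
  have "(\<Sum>B\<in>P. ennreal \<bar>smeas \<mu> B\<bar>) \<le> 0" if "\<Union>P = {}" for P
  proof -
    have "(\<Sum>B\<in>P. ennreal \<bar>smeas \<mu> B\<bar>) = 0"
      using that by (intro sum.neutral) auto
    then show ?thesis by simp
  qed
  then show ?thesis
    unfolding variation_def by (intro antisym SUP_least) auto
qed

lemma variation_Un_ge:
  assumes "A \<inter> B = {}" "A \<in> sets borel" "B \<in> sets borel"
  shows "variation \<mu> A + variation \<mu> B \<le> variation \<mu> (A \<union> B)"
proof -
  let ?S = "\<lambda>A. {P. finite P \<and> P \<subseteq> sets borel \<and> disjoint P \<and> \<Union>P = A}"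
  let ?f = "\<lambda>P. \<Sum>B\<in>P. ennreal \<bar>smeas \<mu> B\<bar>"
  have ne: "?S A \<noteq> {}" if "A \<in> sets borel" for A
    using that by (auto intro!: exI[of _ "{A}"])
  have *: "?f P + ?f Q \<le> variation \<mu> (A \<union> B)" if P: "P \<in> ?S A" and Q: "Q \<in> ?S B" for P Q
  proof -
    have int: "smeas \<mu> R = 0" if "R \<in> P" "R \<in> Q" for R
  proof -
    have "R = {}"
      using that P Q assms(1) by blast
    then show ?thesis by simp
  qed
    have "?f P + ?f Q = ?f (P \<union> Q)"
      using P Q int by (subst sum.union_inter_neutral) (auto dest: int)
    also have "\<dots> \<le> variation \<mu> (A \<union> B)"
    proof (rule variation_ge)
      have PQ: "R \<inter> T = {}" if "R \<in> P" "T \<in> Q" for R T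
        using that P Q assms(1) by blast
      then show "disjoint (P \<union> Q)"
        using P Q by (intro disjoint_union) auto
    qed (use P Q in auto)
    finally show ?thesis .
  qed
  have "variation \<mu> A + variation \<mu> B = (SUP P\<in>?S A. ?f P + variation \<mu> B)"
    unfolding variation_def[of \<mu> A] using ne[OF assms(2)] by (simp add: ennreal_SUP_add_left)
  also have "\<dots> \<le> variation \<mu> (A \<union> B)"
  proof (rule SUP_least)
    fix P assume P: "P \<in> ?S A"
    have "?f P + variation \<mu> B = (SUP Q\<in>?S B. ?f P + ?f Q)"
      unfolding variation_def[of \<mu> B] using ne[OF assms(3)] by (simp add: ennreal_SUP_add_right)
    also have "\<dots> \<le> variation \<mu> (A \<union> B)"
      using * P by (intro SUP_least) auto
    finally show "?f P + variation \<mu> B \<le> variation \<mu> (A \<union> B)" .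
  qed
  finally show ?thesis .
qed

lemma variation_mono:
  assumes "A \<subseteq> B" "A \<in> sets borel" "B \<in> sets borel"
  shows "variation \<mu> A \<le> variation \<mu> B"
proof -
  have "variation \<mu> A \<le> variation \<mu> A + variation \<mu> (B - A)" by simp
  also have "\<dots> \<le> variation \<mu> (A \<union> (B - A))"
    using assms by (intro variation_Un_ge) auto
  finally show ?thesis using assms(1) by (simp add: Un_absorb1)
qed

lemma variation_suminf_le:
  assumes A: "range A \<subseteq> sets borel" "disjoint_family A"
  shows "variation \<mu> (\<Union>n. A n) \<le> (\<Sum>n. variation \<mu> (A n))"
  unfolding variation_def[of \<mu> "\<Union>n. A n"]
proof (rule SUP_least)
  fix P assume P: "P \<in> {P. finite P \<and> P \<subseteq> sets borel \<and> disjoint P \<and> \<Union>P = (\<Union>n. A n)}"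
  have le: "ennreal \<bar>smeas \<mu> B\<bar> \<le> (\<Sum>n. ennreal \<bar>smeas \<mu> (B \<inter> A n)\<bar>)" if B: "B \<in> P" for B
  proof (cases "(\<Sum>n. ennreal \<bar>smeas \<mu> (B \<inter> A n)\<bar>) = \<infinity>")
    case False
    then have s: "summable (\<lambda>n. \<bar>smeas \<mu> (B \<inter> A n)\<bar>)"
      by (intro summable_suminf_not_top) auto
    have "(\<Union>n. B \<inter> A n) = B" using P B by auto
    moreover have "(\<lambda>n. smeas \<mu> (B \<inter> A n)) sums smeas \<mu> (\<Union>n. B \<inter> A n)"
      using P B A by (intro smeas_sums) (auto simp: disjoint_family_on_def)
    ultimately have "smeas \<mu> B = (\<Sum>n. smeas \<mu> (B \<inter> A n))"
      by (simp add: sums_iff)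
    then have "\<bar>smeas \<mu> B\<bar> \<le> (\<Sum>n. \<bar>smeas \<mu> (B \<inter> A n)\<bar>)"
      using summable_rabs[OF s] by simp
    then show ?thesis
      using s by (subst suminf_ennreal2) (auto intro!: ennreal_leI)
  qed simp
  have le2: "(\<Sum>B\<in>P. ennreal \<bar>smeas \<mu> (B \<inter> A n)\<bar>) \<le> variation \<mu> (A n)" for n
  proof -
    have dj: "R \<inter> T = {}" if "R \<in> P" "T \<in> P" "R \<noteq> T" for R T
      using that P by (auto simp: disjoint_def)
    have "(\<Sum>B\<in>P. ennreal \<bar>smeas \<mu> (B \<inter> A n)\<bar>) = (\<Sum>B\<in>(\<lambda>B. B \<inter> A n) ` P. ennreal \<bar>smeas \<mu> B\<bar>)"
    proof (subst sum.reindex_nontrivial)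
      fix R T assume *: "R \<in> P" "T \<in> P" "R \<noteq> T" "R \<inter> A n = T \<inter> A n"
      then have "R \<inter> A n = {}" using dj by blast
      then show "ennreal \<bar>smeas \<mu> (R \<inter> A n)\<bar> = 0" by simp
    qed (use P in auto)
    also have "\<dots> \<le> variation \<mu> (A n)"
      proof (rule variation_ge)
      show "disjoint ((\<lambda>B. B \<inter> A n) ` P)"
        unfolding disjoint_def
      proof (intro ballI impI)
        fix a b assume "a \<in> (\<lambda>B. B \<inter> A n) ` P" "b \<in> (\<lambda>B. B \<inter> A n) ` P" "a \<noteq> b"
        then obtain R T where "R \<in> P" "T \<in> P" "R \<noteq> T" "a = R \<inter> A n" "b = T \<inter> A n" by blast
        then show "a \<inter> b = {}" using dj by blast
      qed
      have "\<Union>((\<lambda>B. B \<inter> A n) ` P) = \<Union>P \<inter> A n" by blast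
      then show "\<Union>((\<lambda>B. B \<inter> A n) ` P) = A n" using P by auto
      show "(\<lambda>B. B \<inter> A n) ` P \<subseteq> sets borel" using P A(1) by auto
    qed (use P in auto)
    finally show ?thesis .
  qed
  have "(\<Sum>B\<in>P. ennreal \<bar>smeas \<mu> B\<bar>) \<le> (\<Sum>B\<in>P. \<Sum>n. ennreal \<bar>smeas \<mu> (B \<inter> A n)\<bar>)"
    by (intro sum_mono le)
  also have "\<dots> = (\<Sum>n. \<Sum>B\<in>P. ennreal \<bar>smeas \<mu> (B \<inter> A n)\<bar>)"
    by (rule suminf_sum[symmetric]) simp
  also have "\<dots> \<le> (\<Sum>n. variation \<mu> (A n))"
    by (intro suminf_le le2) auto
  finally show "(\<Sum>B\<in>P. ennreal \<bar>smeas \<mu> B\<bar>) \<le> (\<Sum>n. variation \<mu> (A n))" .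
qed

lemma variation_Un:
  assumes "A \<inter> B = {}" "A \<in> sets borel" "B \<in> sets borel"
  shows "variation \<mu> (A \<union> B) = variation \<mu> A + variation \<mu> B"
proof (rule antisym)
  have "variation \<mu> (\<Union>n. binaryset A B n) \<le> (\<Sum>n. variation \<mu> (binaryset A B n))"
    using assms by (intro variation_suminf_le)
      (auto simp: range_binaryset_eq disjoint_family_on_def binaryset_def)
  also have "(\<Sum>n. variation \<mu> (binaryset A B n)) = variation \<mu> A + variation \<mu> B"
    by (intro sums_unique[symmetric] binaryset_sums) simp
  finally show "variation \<mu> (A \<union> B) \<le> variation \<mu> A + variation \<mu> B"
    by (simp add: UN_binaryset_eq)
qed (use assms variation_Un_ge in auto)

lemma variation_suminf:
  assumes A: "range A \<subseteq> sets borel" "disjoint_family A"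
  shows "(\<Sum>n. variation \<mu> (A n)) = variation \<mu> (\<Union>n. A n)"
proof (rule antisym)
  have *: "(\<Sum>n<N. variation \<mu> (A n)) = variation \<mu> (\<Union>n<N. A n)" for N
  proof (induction N)
    case (Suc N)
    have "(\<Union>n<N. A n) \<inter> A N = {}"
    proof -
      have "A n \<inter> A N = {}" if "n < N" for n
        using A(2) that by (auto simp: disjoint_family_on_def)
      then show ?thesis by blast
    qed
    moreover have "(\<Union>n<N. A n) \<in> sets borel" "A N \<in> sets borel" using A(1) by auto
    ultimately have "variation \<mu> ((\<Union>n<N. A n) \<union> A N) = variation \<mu> (\<Union>n<N. A n) + variation \<mu> (A N)"
      by (rule variation_Un)
    then show ?case using Suc by (simp add: lessThan_Suc Un_commute)
  qed simp
  show "(\<Sum>n. variation \<mu> (A n)) \<le> variation \<mu> (\<Union>n. A n)"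
  proof (rule suminf_le_const)
    fix N
    show "(\<Sum>n<N. variation \<mu> (A n)) \<le> variation \<mu> (\<Union>n. A n)"
      unfolding * using A(1) by (intro variation_mono) auto
  qed simp
qed (rule variation_suminf_le[OF A])

lemma space_total_variation [simp]: "space (total_variation \<mu>) = UNIV"
  by (simp add: total_variation_def space_measure_of)

lemma sets_total_variation [simp, measurable_cong]:
  "sets (total_variation (\<mu> :: 'a::topological_space signed_measure)) = sets (borel :: 'a measure)"
proof -
  have "sets (measure_of (space (borel :: 'a measure)) (sets (borel :: 'a measure)) (variation \<mu>)) = sets (borel :: 'a measure)"
    by (rule sets.sets_measure_of_eq)
  then show ?thesis by (simp add: total_variation_def)
qed

lemma emeasure_total_variation:
  fixes \<mu> :: "'a::topological_space signed_measure"
  assumes "A \<in> sets borel"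
  shows "emeasure (total_variation \<mu>) A = variation \<mu> A"
proof (rule emeasure_measure_of[OF total_variation_def])
  show "positive (sets (total_variation \<mu>)) (variation \<mu>)"
    by (simp add: positive_def)
  show "countably_additive (sets (total_variation \<mu>)) (variation \<mu>)"
    by (rule countably_additiveI) (simp add: variation_suminf)
qed (use assms in auto)

lemma variation_split:
  assumes E: "E \<in> sets borel" "variation \<mu> E = \<infinity>"
  shows "\<exists>A. A \<in> sets borel \<and> A \<subseteq> E \<and> variation \<mu> A = \<infinity> \<and> \<bar>smeas \<mu> (E - A)\<bar> > 1"
proof -
  let ?m = "smeas \<mu>"
  have "ennreal (2 * (1 + \<bar>?m E\<bar>)) < variation \<mu> E"
    using E(2) by simp
  then obtain P where P: "finite P" "P \<subseteq> sets borel" "disjoint P" "\<Union>P = E"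
    and gt: "ennreal (2 * (1 + \<bar>?m E\<bar>)) < (\<Sum>B\<in>P. ennreal \<bar>?m B\<bar>)"
    unfolding variation_def less_SUP_iff by auto
  have "(\<Sum>B\<in>P. ennreal \<bar>?m B\<bar>) = ennreal (\<Sum>B\<in>P. \<bar>?m B\<bar>)"
    by (rule sum_ennreal) simp
  with gt have gt: "2 * (1 + \<bar>?m E\<bar>) < (\<Sum>B\<in>P. \<bar>?m B\<bar>)"
    by (metis abs_ge_zero ennreal_less_iff add_nonneg_nonneg mult_nonneg_nonneg zero_le_numeral zero_le_one)
  define P1 P2 where "P1 = {B\<in>P. ?m B \<ge> 0}" and "P2 = {B\<in>P. ?m B < 0}"
  have PP: "P = P1 \<union> P2" "P1 \<inter> P2 = {}" "finite P1" "finite P2"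
    using P(1) by (auto simp: P1_def P2_def)
  have dj: "disjoint P1" "disjoint P2"
    using P(3) by (auto simp: P1_def P2_def disjoint_def)
  have U1: "?m (\<Union>P1) = (\<Sum>B\<in>P1. ?m B)" and U2: "?m (\<Union>P2) = (\<Sum>B\<in>P2. ?m B)"
    using P PP dj by (auto intro!: smeas_Union)
  have bor: "\<Union>P1 \<in> sets borel" "\<Union>P2 \<in> sets borel"
    using P PP by (auto intro!: sets.finite_Union)
  have int: "\<Union>P1 \<inter> \<Union>P2 = {}"
  proof -
    have "R \<inter> T = {}" if "R \<in> P1" "T \<in> P2" for R T
      using that P(3) PP by (intro disjointD[of P]) auto
    then show ?thesis by blast
  qed
  have EE: "E = \<Union>P1 \<union> \<Union>P2" using P(4) PP by auto
  have "(\<Sum>B\<in>P. \<bar>?m B\<bar>) = (\<Sum>B\<in>P1. \<bar>?m B\<bar>) + (\<Sum>B\<in>P2. \<bar>?m B\<bar>)"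
    using PP by (simp add: sum.union_disjoint)
  also have "\<dots> = (\<Sum>B\<in>P1. ?m B) + (\<Sum>B\<in>P2. - ?m B)"
    by (intro arg_cong2[where f = "(+)"] sum.cong) (auto simp: P1_def P2_def)
  also have "\<dots> = ?m (\<Union>P1) - ?m (\<Union>P2)"
    by (simp add: U1 U2 sum_negf)
  finally have 1: "?m (\<Union>P1) - ?m (\<Union>P2) > 2 * (1 + \<bar>?m E\<bar>)" using gt by simp
  have 2: "?m E = ?m (\<Union>P1) + ?m (\<Union>P2)"
    unfolding EE by (rule smeas_Un[OF bor int])
  have aux: "1 < u \<and> v < - 1" if "2 * (1 + \<bar>s\<bar>) < u - v" "s = u + v" for s u v :: real
    using that by (auto simp: abs_if split: if_splits)
  have big: "\<bar>?m (\<Union>P1)\<bar> > 1" "\<bar>?m (\<Union>P2)\<bar> > 1"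
    using aux[OF 1 2] by auto
  have "variation \<mu> (\<Union>P1) + variation \<mu> (\<Union>P2) = \<infinity>"
    using E(2) variation_Un[OF int bor] EE by metis
  then consider "variation \<mu> (\<Union>P1) = \<infinity>" | "variation \<mu> (\<Union>P2) = \<infinity>" by fastforce
  then show ?thesis
  proof cases
    case 1
    have "E - \<Union>P1 = \<Union>P2" using EE int by blast
    then show ?thesis using 1 big bor EE by (intro exI[of _ "\<Union>P1"]) auto
  next
    case 2
    have "E - \<Union>P2 = \<Union>P1" using EE int by blast
    then show ?thesis using 2 big bor EE by (intro exI[of _ "\<Union>P2"]) auto
  qed
qed

lemma variation_finite: "variation \<mu> UNIV \<noteq> \<infinity>"
proof
  assume inf: "variation \<mu> UNIV = \<infinity>"
  have "\<exists>E. \<forall>n. (E n \<in> sets borel \<and> variation \<mu> (E n) = \<infinity>) \<and>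
          (E (Suc n) \<subseteq> E n \<and> \<bar>smeas \<mu> (E n - E (Suc n))\<bar> > 1)"
  proof (rule dependent_nat_choice)
    show "\<exists>x. x \<in> sets borel \<and> variation \<mu> x = \<infinity>" using inf by auto
  qed (use variation_split in blast)
  then obtain E where E: "\<And>n. E n \<in> sets borel" "\<And>n. E (Suc n) \<subseteq> E n"
      "\<And>n. \<bar>smeas \<mu> (E n - E (Suc n))\<bar> > 1"
    by blast
  have dec: "E m \<subseteq> E n" if "n \<le> m" for n m
    using lift_Suc_antimono_le[of E, OF E(2) that] .
  have "disjoint_family (\<lambda>n. E n - E (Suc n))"
  proof -
    have "(E m - E (Suc m)) \<inter> (E n - E (Suc n)) = {}" if "m < n" for m n
      using dec[of "Suc m" n] that by auto
    then show ?thesis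
      unfolding disjoint_family_on_def by (metis Int_commute linorder_neqE_nat)
  qed
  then have "(\<lambda>n. smeas \<mu> (E n - E (Suc n))) sums smeas \<mu> (\<Union>n. E n - E (Suc n))"
    using E(1) by (intro smeas_sums) auto
  then have "(\<lambda>n. smeas \<mu> (E n - E (Suc n))) \<longlonglongrightarrow> 0"
    by (intro summable_LIMSEQ_zero sums_summable)
  then have "\<forall>\<^sub>F n in sequentially. \<bar>smeas \<mu> (E n - E (Suc n))\<bar> < 1"
    by (drule_tac tendsto_rabs) (auto dest!: order_tendstoD(2)[where a = 1])
  then show False
    using E(3) by (auto simp: eventually_sequentially) (meson le_refl less_asym)
qed

lemma finite_total_variation [simp]: "finite_measure (total_variation \<mu>)"
  by standard (use variation_finite[of \<mu>] in \<open>simp add: emeasure_total_variation\<close>)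

lemma abs_smeas_le: "\<bar>smeas \<mu> A\<bar> \<le> measure (total_variation \<mu>) A"
proof (cases "A \<in> sets borel")
  case True
  interpret finite_measure "total_variation \<mu>" by simp
  have "ennreal \<bar>smeas \<mu> A\<bar> \<le> variation \<mu> A"
    using variation_ge[of "{A}" A \<mu>] True by simp
  then show ?thesis
    using True by (simp add: emeasure_total_variation[symmetric] emeasure_eq_measure)
qed (simp add: smeas_notin)

text \<open>The Jordan decomposition \<open>\<mu> = \<mu>\<^sup>+ - \<mu>\<^sup>-\<close> with \<open>\<mu>\<^sup>+ = (\<bar>\<mu>\<bar> + \<mu>) / 2\<close> and
  \<open>\<mu>\<^sup>- = (\<bar>\<mu>\<bar> - \<mu>) / 2\<close>.\<close>

definition pos_part :: "'a::topological_space signed_measure \<Rightarrow> 'a measure" where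
  "pos_part \<mu> = measure_of UNIV (sets borel)
     (\<lambda>A. ennreal ((measure (total_variation \<mu>) A + smeas \<mu> A) / 2))"

definition neg_part :: "'a::topological_space signed_measure \<Rightarrow> 'a measure" where
  "neg_part \<mu> = measure_of UNIV (sets borel)
     (\<lambda>A. ennreal ((measure (total_variation \<mu>) A - smeas \<mu> A) / 2))"

lemma space_pos_part [simp]: "space (pos_part \<mu>) = UNIV"
  and space_neg_part [simp]: "space (neg_part \<mu>) = UNIV"
  by (simp_all add: pos_part_def neg_part_def space_measure_of)

lemma sets_pos_part [simp, measurable_cong]:
  "sets (pos_part (\<mu> :: 'a::topological_space signed_measure)) = sets (borel :: 'a measure)"
  and sets_neg_part [simp, measurable_cong]:
  "sets (neg_part \<mu>) = sets (borel :: 'a measure)"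
  using sets.sets_measure_of_eq[of "borel :: 'a measure"]
  by (simp_all add: pos_part_def neg_part_def)

lemma emeasure_pos_part:
  assumes "A \<in> sets borel"
  shows "emeasure (pos_part \<mu>) A = ennreal ((measure (total_variation \<mu>) A + smeas \<mu> A) / 2)"
proof (rule emeasure_measure_of[OF pos_part_def])
  interpret finite_measure "total_variation \<mu>" by simp
  show "countably_additive (sets (pos_part \<mu>))
     (\<lambda>A. ennreal ((measure (total_variation \<mu>) A + smeas \<mu> A) / 2))"
  proof (rule countably_additiveI, goal_cases)
    case (1 A)
    have "(\<lambda>n. (measure (total_variation \<mu>) (A n) + smeas \<mu> (A n)) / 2) sums
       ((measure (total_variation \<mu>) (\<Union>n. A n) + smeas \<mu> (\<Union>n. A n)) / 2)"
      using 1 by (intro sums_divide sums_add finite_measure_UNION smeas_sums) auto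
    moreover have "0 \<le> (measure (total_variation \<mu>) (A n) + smeas \<mu> (A n)) / 2" for n
      using abs_smeas_le[of \<mu> "A n"] by simp
    ultimately show ?case by (intro suminf_ennreal_eq) auto
  qed
qed (use assms in \<open>auto simp: positive_def\<close>)

lemma emeasure_neg_part:
  assumes "A \<in> sets borel"
  shows "emeasure (neg_part \<mu>) A = ennreal ((measure (total_variation \<mu>) A - smeas \<mu> A) / 2)"
proof (rule emeasure_measure_of[OF neg_part_def])
  interpret finite_measure "total_variation \<mu>" by simp
  show "countably_additive (sets (neg_part \<mu>))
     (\<lambda>A. ennreal ((measure (total_variation \<mu>) A - smeas \<mu> A) / 2))"
  proof (rule countably_additiveI, goal_cases)
    case (1 A)
    have "(\<lambda>n. (measure (total_variation \<mu>) (A n) - smeas \<mu> (A n)) / 2) sums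
       ((measure (total_variation \<mu>) (\<Union>n. A n) - smeas \<mu> (\<Union>n. A n)) / 2)"
      using 1 by (intro sums_divide sums_diff finite_measure_UNION smeas_sums) auto
    moreover have "0 \<le> (measure (total_variation \<mu>) (A n) - smeas \<mu> (A n)) / 2" for n
      using abs_smeas_le[of \<mu> "A n"] by simp
    ultimately show ?case by (intro suminf_ennreal_eq) auto
  qed
qed (use assms in \<open>auto simp: positive_def\<close>)

lemma finite_pos_part [simp]: "finite_measure (pos_part \<mu>)"
  and finite_neg_part [simp]: "finite_measure (neg_part \<mu>)"
  by (standard, simp add: emeasure_pos_part emeasure_neg_part)+

lemma emeasure_pos_neg:
  assumes "A \<in> sets borel"
  shows "emeasure (pos_part \<mu>) A + emeasure (neg_part \<mu>) A = emeasure (total_variation \<mu>) A"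
proof -
  interpret finite_measure "total_variation \<mu>" by simp
  show ?thesis
    using assms abs_smeas_le[of \<mu> A]
    by (simp add: emeasure_pos_part emeasure_neg_part emeasure_eq_measure
        flip: ennreal_plus) (simp add: field_simps)
qed

lemma measure_pos_diff_neg:
  "measure (pos_part \<mu>) A - measure (neg_part \<mu>) A = smeas \<mu> A"
proof (cases "A \<in> sets borel")
  case True
  then show ?thesis
    using abs_smeas_le[of \<mu> A]
    by (simp add: measure_def emeasure_pos_part emeasure_neg_part)  (simp add: field_simps)
next
  case False
  then show ?thesis
    by (simp add: smeas_notin measure_notin_sets)
qed

definition sintegral :: "'a::topological_space signed_measure \<Rightarrow> ('a \<Rightarrow> real) \<Rightarrow> real" where
  "sintegral \<mu> f = (\<integral>z. f z \<partial>pos_part \<mu>) - (\<integral>z. f z \<partial>neg_part \<mu>)"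

section \<open>Moments and the Kantorovich-Rubinstein norm\<close>

lemma nn_integral_combination_le:
  fixes M :: "'i \<Rightarrow> 'a::topological_space measure" and N :: "'j \<Rightarrow> 'a measure"
    and a :: "'i \<Rightarrow> real" and b :: "'j \<Rightarrow> real"
  assumes fin: "finite I" "finite J"
    and M: "\<And>i. sets (M i) = sets borel" and N: "\<And>j. sets (N j) = sets borel"
    and le: "\<And>A. A \<in> sets borel \<Longrightarrow>
      (\<Sum>i\<in>I. ennreal (a i) * emeasure (M i) A) \<le> (\<Sum>j\<in>J. ennreal (b j) * emeasure (N j) A)"
    and f: "f \<in> borel_measurable borel"
  shows "(\<Sum>i\<in>I. ennreal (a i) * (\<integral>\<^sup>+z. f z \<partial>M i)) \<le> (\<Sum>j\<in>J. ennreal (b j) * (\<integral>\<^sup>+z. f z \<partial>N j))"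
proof -
  have mM: "g \<in> borel_measurable (M i)" and mN: "g \<in> borel_measurable (N j)"
    if "g \<in> borel_measurable borel" for g :: "'a \<Rightarrow> ennreal" and i j
    using that measurable_cong_sets[OF M refl] measurable_cong_sets[OF N refl] by blast+
  have sM: "space (M i) = UNIV" and sN: "space (N j) = UNIV" for i j
    using sets_eq_imp_space_eq[OF M] sets_eq_imp_space_eq[OF N] by simp_all
  show ?thesis
    using f
  proof (induction f rule: borel_measurable_induct)
    case (cong f g)
    then have "f = g" by auto
    then show ?case using cong by simp
  next
    case (set A)
    then show ?case using le[of A] M N by (simp add: nn_integral_indicator)
  next
    case (mult u c)
    have "(\<Sum>i\<in>I. ennreal (a i) * (\<integral>\<^sup>+z. c * u z \<partial>M i)) = c * (\<Sum>i\<in>I. ennreal (a i) * (\<integral>\<^sup>+z. u z \<partial>M i))"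
      using mM[OF mult(2)] by (simp add: nn_integral_cmult sum_distrib_left mult_ac)
    also have "\<dots> \<le> c * (\<Sum>j\<in>J. ennreal (b j) * (\<integral>\<^sup>+z. u z \<partial>N j))"
      using mult by (intro mult_left_mono) auto
    also have "\<dots> = (\<Sum>j\<in>J. ennreal (b j) * (\<integral>\<^sup>+z. c * u z \<partial>N j))"
      using mN[OF mult(2)] by (simp add: nn_integral_cmult sum_distrib_left mult_ac)
    finally show ?case .
  next
    case (add u v)
    have u: "u \<in> borel_measurable borel" and v: "v \<in> borel_measurable borel" by fact+
    note m = mM[OF u] mM[OF v] mN[OF u] mN[OF v]
    have IH: "(\<Sum>i\<in>I. ennreal (a i) * (\<integral>\<^sup>+z. u z \<partial>M i)) \<le> (\<Sum>j\<in>J. ennreal (b j) * (\<integral>\<^sup>+z. u z \<partial>N j))"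
      "(\<Sum>i\<in>I. ennreal (a i) * (\<integral>\<^sup>+z. v z \<partial>M i)) \<le> (\<Sum>j\<in>J. ennreal (b j) * (\<integral>\<^sup>+z. v z \<partial>N j))"
      by fact+
    have "(\<Sum>i\<in>I. ennreal (a i) * (\<integral>\<^sup>+z. v z + u z \<partial>M i))
        = (\<Sum>i\<in>I. ennreal (a i) * (\<integral>\<^sup>+z. v z \<partial>M i)) + (\<Sum>i\<in>I. ennreal (a i) * (\<integral>\<^sup>+z. u z \<partial>M i))"
      using m by (simp add: nn_integral_add sum.distrib distrib_left)
    also have "\<dots> \<le> (\<Sum>j\<in>J. ennreal (b j) * (\<integral>\<^sup>+z. v z \<partial>N j)) + (\<Sum>j\<in>J. ennreal (b j) * (\<integral>\<^sup>+z. u z \<partial>N j))"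
      using IH by (intro add_mono)
    also have "\<dots> = (\<Sum>j\<in>J. ennreal (b j) * (\<integral>\<^sup>+z. v z + u z \<partial>N j))"
      using m by (simp add: nn_integral_add sum.distrib distrib_left)
    finally show ?case .
  next
    case (seq U)
    have U: "U n \<in> borel_measurable borel" for n by fact
    have inc: "incseq U" by fact
    have lim: "(\<lambda>n. U n z) \<longlonglongrightarrow> (SUP n. U n) z" for z
      using LIMSEQ_SUP[of "\<lambda>n. U n z"] inc by (simp add: incseq_def le_fun_def image_comp)
    show ?case
    proof (rule LIMSEQ_le)
      show "(\<lambda>n. \<Sum>i\<in>I. ennreal (a i) * (\<integral>\<^sup>+z. U n z \<partial>M i)) \<longlonglongrightarrow> (\<Sum>i\<in>I. ennreal (a i) * (\<integral>\<^sup>+z. (SUP n. U n) z \<partial>M i))"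
        by (intro tendsto_sum ennreal_tendsto_cmult nn_integral_LIMSEQ lim inc mM U) simp
      show "(\<lambda>n. \<Sum>j\<in>J. ennreal (b j) * (\<integral>\<^sup>+z. U n z \<partial>N j)) \<longlonglongrightarrow> (\<Sum>j\<in>J. ennreal (b j) * (\<integral>\<^sup>+z. (SUP n. U n) z \<partial>N j))"
        by (intro tendsto_sum ennreal_tendsto_cmult nn_integral_LIMSEQ lim inc mN U) simp
      show "\<exists>N0. \<forall>n\<ge>N0. (\<Sum>i\<in>I. ennreal (a i) * (\<integral>\<^sup>+z. U n z \<partial>M i)) \<le> (\<Sum>j\<in>J. ennreal (b j) * (\<integral>\<^sup>+z. U n z \<partial>N j))"
        using seq.IH by blast
    qed
  qed
qed

lemma nn_integral_total_variation:
  assumes "f \<in> borel_measurable borel"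
  shows "(\<integral>\<^sup>+z. f z \<partial>total_variation \<mu>) = (\<integral>\<^sup>+z. f z \<partial>pos_part \<mu>) + (\<integral>\<^sup>+z. f z \<partial>neg_part \<mu>)"
proof -
  let ?M = "\<lambda>b. if b then pos_part \<mu> else neg_part \<mu>"
  have "(\<Sum>i\<in>{()}. ennreal 1 * (\<integral>\<^sup>+z. f z \<partial>total_variation \<mu>))
      \<le> (\<Sum>b\<in>UNIV. ennreal 1 * (\<integral>\<^sup>+z. f z \<partial>?M b))"
    using assms by (intro nn_integral_combination_le)
      (auto simp: UNIV_bool emeasure_pos_neg[symmetric] add.commute)
  moreover have "(\<Sum>b\<in>UNIV. ennreal 1 * (\<integral>\<^sup>+z. f z \<partial>?M b)) \<le> (\<Sum>i\<in>{()}. ennreal 1 * (\<integral>\<^sup>+z. f z \<partial>total_variation \<mu>))"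
    using assms by (intro nn_integral_combination_le)
      (auto simp: UNIV_bool emeasure_pos_neg[symmetric] add.commute)
  ultimately show ?thesis by (simp add: UNIV_bool add.commute)
qed

lemma integral_combination_eq_0:
  fixes M :: "'i \<Rightarrow> 'a::topological_space measure" and c :: "'i \<Rightarrow> real"
  assumes fin: "finite I"
    and M: "\<And>i. sets (M i) = sets borel" and fm: "\<And>i. finite_measure (M i)"
    and eq: "\<And>A. A \<in> sets borel \<Longrightarrow> (\<Sum>i\<in>I. c i * measure (M i) A) = 0"
    and f: "\<And>i. i \<in> I \<Longrightarrow> integrable (M i) f" "f \<in> borel_measurable borel"
  shows "(\<Sum>i\<in>I. c i * (\<integral>z. f z \<partial>M i)) = 0"
proof -
  define p n where "p i = max 0 (c i)" and "n i = max 0 (- c i)" for i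
  have pn: "c i = p i - n i" "p i \<ge> 0" "n i \<ge> 0" for i by (auto simp: p_def n_def)
  have meas: "(\<Sum>i\<in>I. ennreal (p i) * emeasure (M i) A) = (\<Sum>i\<in>I. ennreal (n i) * emeasure (M i) A)"
    if A: "A \<in> sets borel" for A
  proof -
    have em: "emeasure (M i) A = ennreal (measure (M i) A)" for i
      using fm[of i] by (rule finite_measure.emeasure_eq_measure)
    have "(\<Sum>i\<in>I. p i * measure (M i) A) = (\<Sum>i\<in>I. n i * measure (M i) A)"
      using eq[OF A] by (simp add: pn(1) left_diff_distrib sum_subtractf)
    then show ?thesis
      using pn by (simp add: em sum_ennreal flip: ennreal_mult)
  qed
  have nn: "(\<Sum>i\<in>I. p i * enn2real (\<integral>\<^sup>+z. ennreal (g z) \<partial>M i)) = (\<Sum>i\<in>I. n i * enn2real (\<integral>\<^sup>+z. ennreal (g z) \<partial>M i))"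
    if g: "\<And>i. i \<in> I \<Longrightarrow> integrable (M i) g" "g \<in> borel_measurable borel" for g
  proof -
    have fin': "(\<integral>\<^sup>+z. ennreal (g z) \<partial>M i) = ennreal (enn2real (\<integral>\<^sup>+z. ennreal (g z) \<partial>M i))" if "i \<in> I" for i
    proof -
      have "(\<integral>\<^sup>+z. ennreal (g z) \<partial>M i) \<le> (\<integral>\<^sup>+z. ennreal (norm (g z)) \<partial>M i)"
        by (intro nn_integral_mono ennreal_leI) auto
      also have "\<dots> < \<infinity>" using g(1)[OF that] by (simp add: integrable_iff_bounded)
      finally show ?thesis by simp
    qed
    have "(\<Sum>i\<in>I. ennreal (p i) * (\<integral>\<^sup>+z. ennreal (g z) \<partial>M i)) = (\<Sum>i\<in>I. ennreal (n i) * (\<integral>\<^sup>+z. ennreal (g z) \<partial>M i))"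
      using g(2) by (intro antisym nn_integral_combination_le fin M) (simp_all add: meas)
    moreover have "(\<Sum>i\<in>I. ennreal (q i) * (\<integral>\<^sup>+z. ennreal (g z) \<partial>M i))
        = ennreal (\<Sum>i\<in>I. q i * enn2real (\<integral>\<^sup>+z. ennreal (g z) \<partial>M i))" if "\<And>i. q i \<ge> 0" for q
    proof -
      have "(\<Sum>i\<in>I. ennreal (q i) * (\<integral>\<^sup>+z. ennreal (g z) \<partial>M i))
         = (\<Sum>i\<in>I. ennreal (q i * enn2real (\<integral>\<^sup>+z. ennreal (g z) \<partial>M i)))"
        using fin' that by (intro sum.cong refl) (metis enn2real_nonneg ennreal_mult)
      then show ?thesis using that by (simp add: sum_ennreal)
    qed
    ultimately show ?thesis
      using pn by (simp add: sum_nonneg)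
  qed
  have "(\<Sum>i\<in>I. c i * (\<integral>z. f z \<partial>M i))
     = (\<Sum>i\<in>I. (p i - n i) * (enn2real (\<integral>\<^sup>+z. ennreal (f z) \<partial>M i) - enn2real (\<integral>\<^sup>+z. ennreal (- f z) \<partial>M i)))"
    using f(1) pn(1) by (intro sum.cong refl) (simp add: real_lebesgue_integral_def)
  also have "\<dots> = 0"
    using nn[of f] nn[of "\<lambda>z. - f z"] f
    by (simp add: algebra_simps sum.distrib sum_subtractf)
  finally show ?thesis .
qed

lemma integrable_parts:
  fixes f :: "'a::topological_space \<Rightarrow> real"
  assumes "integrable (total_variation \<mu>) f"
  shows "integrable (pos_part \<mu>) f" "integrable (neg_part \<mu>) f"
proof -
  have m: "f \<in> borel_measurable borel"
    using borel_measurable_integrable[OF assms] measurable_cong_sets[OF sets_total_variation refl] by blast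
  have "(\<integral>\<^sup>+z. ennreal (norm (f z)) \<partial>total_variation \<mu>) < \<infinity>"
    using assms by (simp add: integrable_iff_bounded)
  then have "(\<integral>\<^sup>+z. ennreal (norm (f z)) \<partial>pos_part \<mu>) + (\<integral>\<^sup>+z. ennreal (norm (f z)) \<partial>neg_part \<mu>) < \<infinity>"
    using m by (subst (asm) nn_integral_total_variation) auto
  moreover have "f \<in> borel_measurable (pos_part \<mu>)" "f \<in> borel_measurable (neg_part \<mu>)"
    using m measurable_cong_sets[OF sets_pos_part refl] measurable_cong_sets[OF sets_neg_part refl] by blast+
  ultimately show "integrable (pos_part \<mu>) f" "integrable (neg_part \<mu>) f"
    by (auto simp: integrable_iff_bounded)
qed

lemma variation_add_le: "variation (\<mu> + \<nu>) A \<le> variation \<mu> A + variation \<nu> A"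
  unfolding variation_def[of "\<mu> + \<nu>"]
proof (rule SUP_least)
  fix P assume P: "P \<in> {P. finite P \<and> P \<subseteq> sets borel \<and> disjoint P \<and> \<Union>P = A}"
  have "(\<Sum>B\<in>P. ennreal \<bar>smeas (\<mu> + \<nu>) B\<bar>) \<le> (\<Sum>B\<in>P. ennreal \<bar>smeas \<mu> B\<bar> + ennreal \<bar>smeas \<nu> B\<bar>)"
    by (intro sum_mono) (auto simp flip: ennreal_plus intro!: ennreal_leI)
  also have "\<dots> = (\<Sum>B\<in>P. ennreal \<bar>smeas \<mu> B\<bar>) + (\<Sum>B\<in>P. ennreal \<bar>smeas \<nu> B\<bar>)"
    by (rule sum.distrib)
  also have "\<dots> \<le> variation \<mu> A + variation \<nu> A"
    using P by (intro add_mono variation_ge) auto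
  finally show "(\<Sum>B\<in>P. ennreal \<bar>smeas (\<mu> + \<nu>) B\<bar>) \<le> variation \<mu> A + variation \<nu> A" .
qed

lemma variation_scaleR_le: "variation (c *\<^sub>R \<mu>) A \<le> ennreal \<bar>c\<bar> * variation \<mu> A"
  unfolding variation_def[of "c *\<^sub>R \<mu>"]
proof (rule SUP_least)
  fix P assume P: "P \<in> {P. finite P \<and> P \<subseteq> sets borel \<and> disjoint P \<and> \<Union>P = A}"
  have "(\<Sum>B\<in>P. ennreal \<bar>smeas (c *\<^sub>R \<mu>) B\<bar>) = ennreal \<bar>c\<bar> * (\<Sum>B\<in>P. ennreal \<bar>smeas \<mu> B\<bar>)"
    by (simp add: abs_mult ennreal_mult sum_distrib_left del: sum_ennreal)
  also have "\<dots> \<le> ennreal \<bar>c\<bar> * variation \<mu> A"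
    using P by (intro mult_left_mono variation_ge) auto
  finally show "(\<Sum>B\<in>P. ennreal \<bar>smeas (c *\<^sub>R \<mu>) B\<bar>) \<le> ennreal \<bar>c\<bar> * variation \<mu> A" .
qed

lemma nn_integral_total_variation_add_le:
  assumes "f \<in> borel_measurable borel"
  shows "(\<integral>\<^sup>+z. f z \<partial>total_variation (\<mu> + \<nu>))
    \<le> (\<integral>\<^sup>+z. f z \<partial>total_variation \<mu>) + (\<integral>\<^sup>+z. f z \<partial>total_variation \<nu>)"
proof -
  let ?M = "\<lambda>b. if b then total_variation \<mu> else total_variation \<nu>"
  have "(\<Sum>i\<in>{()}. ennreal 1 * (\<integral>\<^sup>+z. f z \<partial>total_variation (\<mu> + \<nu>)))
      \<le> (\<Sum>b\<in>UNIV. ennreal 1 * (\<integral>\<^sup>+z. f z \<partial>?M b))"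
    using assms by (intro nn_integral_combination_le)
      (auto simp: UNIV_bool emeasure_total_variation variation_add_le add.commute)
  then show ?thesis by (simp add: UNIV_bool add.commute)
qed

lemma nn_integral_total_variation_scaleR_le:
  assumes "f \<in> borel_measurable borel"
  shows "(\<integral>\<^sup>+z. f z \<partial>total_variation (c *\<^sub>R \<mu>)) \<le> ennreal \<bar>c\<bar> * (\<integral>\<^sup>+z. f z \<partial>total_variation \<mu>)"
proof -
  have "(\<Sum>i\<in>{()}. ennreal 1 * (\<integral>\<^sup>+z. f z \<partial>total_variation (c *\<^sub>R \<mu>)))
      \<le> (\<Sum>b\<in>{()}. ennreal \<bar>c\<bar> * (\<integral>\<^sup>+z. f z \<partial>total_variation \<mu>))"
    using assms by (intro nn_integral_combination_le)
      (auto simp: emeasure_total_variation variation_scaleR_le)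
  then show ?thesis by simp
qed

lemma integrable_total_variation_iff:
  fixes f :: "'a::topological_space \<Rightarrow> real"
  assumes "f \<in> borel_measurable borel"
  shows "integrable (total_variation \<mu>) f \<longleftrightarrow> (\<integral>\<^sup>+z. ennreal (norm (f z)) \<partial>total_variation \<mu>) < \<infinity>"
  using assms measurable_cong_sets[OF sets_total_variation refl] by (auto simp: integrable_iff_bounded)

lemma borel_measurable_integrable_tv:
  "integrable (total_variation \<mu>) f \<Longrightarrow> (f :: _ \<Rightarrow> real) \<in> borel_measurable borel"
  using borel_measurable_integrable measurable_cong_sets[OF sets_total_variation refl] by blast

lemma integrable_total_variation_add:
  fixes f :: "'a::topological_space \<Rightarrow> real"
  assumes "integrable (total_variation \<mu>) f" "integrable (total_variation \<nu>) f"
  shows "integrable (total_variation (\<mu> + \<nu>)) f"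
proof -
  have m: "f \<in> borel_measurable borel" using assms(1) by (rule borel_measurable_integrable_tv)
  have "(\<integral>\<^sup>+z. ennreal (norm (f z)) \<partial>total_variation (\<mu> + \<nu>))
     \<le> (\<integral>\<^sup>+z. ennreal (norm (f z)) \<partial>total_variation \<mu>) + (\<integral>\<^sup>+z. ennreal (norm (f z)) \<partial>total_variation \<nu>)"
    using m by (intro nn_integral_total_variation_add_le) simp
  also have "\<dots> < \<infinity>" using assms m by (simp add: integrable_total_variation_iff)
  finally show ?thesis using m by (simp add: integrable_total_variation_iff)
qed

lemma integrable_total_variation_scaleR:
  fixes f :: "'a::topological_space \<Rightarrow> real"
  assumes "integrable (total_variation \<mu>) f"
  shows "integrable (total_variation (c *\<^sub>R \<mu>)) f"
proof -
  have m: "f \<in> borel_measurable borel" using assms(1) by (rule borel_measurable_integrable_tv)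
  have "(\<integral>\<^sup>+z. ennreal (norm (f z)) \<partial>total_variation (c *\<^sub>R \<mu>))
     \<le> ennreal \<bar>c\<bar> * (\<integral>\<^sup>+z. ennreal (norm (f z)) \<partial>total_variation \<mu>)"
    using m by (intro nn_integral_total_variation_scaleR_le) simp
  also have "\<dots> < \<infinity>" using assms m by (simp add: integrable_total_variation_iff ennreal_mult_less_top)
  finally show ?thesis using m by (simp add: integrable_total_variation_iff)
qed

lemma sintegral_add_measure:
  fixes f :: "'a::topological_space \<Rightarrow> real"
  assumes "integrable (total_variation \<mu>) f" "integrable (total_variation \<nu>) f"
  shows "sintegral (\<mu> + \<nu>) f = sintegral \<mu> f + sintegral \<nu> f"
proof -
  define I :: "(nat \<times> bool) set" where "I = {0,1,2} \<times> UNIV"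
  define S where "S k = (if k = 0 then \<mu> + \<nu> else if k = 1 then \<mu> else \<nu>)" for k :: nat
  define M where "M i = (if snd i then pos_part (S (fst i)) else neg_part (S (fst i)))" for i :: "nat \<times> bool"
  define c :: "nat \<times> bool \<Rightarrow> real"
    where "c i = (if fst i = 0 then 1 else -1) * (if snd i then 1 else -1)" for i
  have expand: "(\<Sum>i\<in>I. g i) = (\<Sum>k\<in>{0,1,2}. g (k, True) + g (k, False))" for g :: "nat \<times> bool \<Rightarrow> real"
    unfolding I_def by (subst sum.cartesian_product') (simp add: UNIV_bool add.commute)
  have int: "integrable (total_variation (S k)) f" for k
    using assms integrable_total_variation_add[OF assms] by (simp add: S_def)
  have "(\<Sum>i\<in>I. c i * (\<integral>z. f z \<partial>M i)) = 0"
  proof (rule integral_combination_eq_0)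
    fix A :: "'a set" assume "A \<in> sets borel"
    have "measure (pos_part (S k)) A = smeas (S k) A + measure (neg_part (S k)) A" for k
      using measure_pos_diff_neg[of "S k" A] by simp
    then show "(\<Sum>i\<in>I. c i * measure (M i) A) = 0"
      by (simp add: expand c_def M_def S_def)
  qed (use integrable_parts[OF int] borel_measurable_integrable_tv[OF assms(1)] in \<open>auto simp: I_def M_def\<close>)
  then show ?thesis by (simp add: expand c_def M_def S_def sintegral_def)
qed

lemma sintegral_scaleR_measure:
  fixes f :: "'a::topological_space \<Rightarrow> real"
  assumes "integrable (total_variation \<mu>) f"
  shows "sintegral (a *\<^sub>R \<mu>) f = a * sintegral \<mu> f"
proof -
  define I :: "(nat \<times> bool) set" where "I = {0,1} \<times> UNIV"
  define S where "S k = (if k = 0 then a *\<^sub>R \<mu> else \<mu>)" for k :: nat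
  define M where "M i = (if snd i then pos_part (S (fst i)) else neg_part (S (fst i)))" for i :: "nat \<times> bool"
  define c :: "nat \<times> bool \<Rightarrow> real"
    where "c i = (if fst i = 0 then 1 else - a) * (if snd i then 1 else -1)" for i
  have expand: "(\<Sum>i\<in>I. g i) = (\<Sum>k\<in>{0,1}. g (k, True) + g (k, False))" for g :: "nat \<times> bool \<Rightarrow> real"
    unfolding I_def by (subst sum.cartesian_product') (simp add: UNIV_bool add.commute)
  have int: "integrable (total_variation (S k)) f" for k
    using assms integrable_total_variation_scaleR[OF assms] by (simp add: S_def)
  have "(\<Sum>i\<in>I. c i * (\<integral>z. f z \<partial>M i)) = 0"
  proof (rule integral_combination_eq_0)
    fix A :: "'a set" assume "A \<in> sets borel"
    have "measure (pos_part (S k)) A = smeas (S k) A + measure (neg_part (S k)) A" for k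
      using measure_pos_diff_neg[of "S k" A] by simp
    then show "(\<Sum>i\<in>I. c i * measure (M i) A) = 0"
      by (simp add: expand c_def M_def S_def algebra_simps)
  qed (use integrable_parts[OF int] borel_measurable_integrable_tv[OF assms(1)] in \<open>auto simp: I_def M_def\<close>)
  then show ?thesis by (simp add: expand c_def M_def S_def sintegral_def algebra_simps)
qed

text \<open>The distinguished base point \<open>e\<close> is a parameter of the type class, so that the norm below, which
  depends on \<open>e\<close>, can be the norm of a type.\<close>

class pointed_metric_space = metric_space +
  fixes base_point :: 'a

text \<open>The supremum is taken in \<^typ>\<open>ennreal\<close>: it is \<open>\<infinity>\<close> if \<open>f\<close> is not Lipschitz and \<open>0\<close> on a
  one-point space.\<close>

definition lip_const :: "('a::metric_space \<Rightarrow> real) \<Rightarrow> ennreal" where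
  "lip_const f = (SUP (z, z')\<in>{(z, z'). z \<noteq> z'}. ennreal (\<bar>f z - f z'\<bar> / dist z z'))"

lemma lip_const_le_iff:
  assumes "K \<ge> 0"
  shows "lip_const f \<le> ennreal K \<longleftrightarrow> K-lipschitz_on UNIV f"
proof -
  have "lip_const f \<le> ennreal K \<longleftrightarrow> (\<forall>z z'. z \<noteq> z' \<longrightarrow> \<bar>f z - f z'\<bar> / dist z z' \<le> K)"
    using assms by (auto simp: lip_const_def SUP_le_iff)
  also have "\<dots> \<longleftrightarrow> (\<forall>z z'. dist (f z) (f z') \<le> K * dist z z')"
  proof (intro all_cong1)
    fix z z' :: 'a
    show "(z \<noteq> z' \<longrightarrow> \<bar>f z - f z'\<bar> / dist z z' \<le> K) \<longleftrightarrow> dist (f z) (f z') \<le> K * dist z z'"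
      by (cases "z = z'") (simp_all add: dist_real_def divide_le_eq)
  qed
  finally show ?thesis using assms by (auto simp: lipschitz_on_def)
qed

definition moment_measures :: "real \<Rightarrow> 'a::pointed_metric_space signed_measure set" where
  "moment_measures p =
     {\<mu>. (\<integral>\<^sup>+z. ennreal (dist z base_point powr p) \<partial>total_variation \<mu>) < \<infinity>}"

text \<open>The supremum over the reals is of a bounded set for \<open>\<mu>\<close> in \<^term>\<open>moment_measures 1\<close>
  (\<open>bdd_above_sintegral\<close>).\<close>

definition KRu_norm :: "'a::pointed_metric_space signed_measure \<Rightarrow> real" where
  "KRu_norm \<mu> = \<bar>smeas \<mu> UNIV\<bar> + (SUP f\<in>{f. f base_point = 0 \<and> lip_const f \<le> 1}. sintegral \<mu> f)"

lemma dist_measurable [measurable]: "(\<lambda>z::'a::metric_space. dist z e) \<in> borel_measurable borel"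
  by (intro borel_measurable_continuous_onI continuous_intros)

lemma moment_measures_one_iff:
  "\<mu> \<in> moment_measures 1 \<longleftrightarrow> integrable (total_variation \<mu>) (\<lambda>z. dist z base_point)"
  by (simp add: moment_measures_def integrable_total_variation_iff)

lemma moment_measures_one_integrable:
  fixes f :: "'a::pointed_metric_space \<Rightarrow> real"
  assumes "\<mu> \<in> moment_measures 1" "K-lipschitz_on UNIV f"
  shows "integrable (total_variation \<mu>) f"
proof -
  interpret finite_measure "total_variation \<mu>" by simp
  have m: "f \<in> borel_measurable borel"
    using lipschitz_on_continuous_on[OF assms(2)] by (rule borel_measurable_continuous_onI)
  have b: "norm (f z) \<le> norm (\<bar>f base_point\<bar> + K * dist z base_point)" for z
  proof -
    have "\<bar>f z - f base_point\<bar> \<le> K * dist z base_point"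
      using lipschitz_onD[OF assms(2), of z base_point] by (simp add: dist_real_def)
    then show ?thesis by auto
  qed
  have "integrable (total_variation \<mu>) (\<lambda>z. \<bar>f base_point\<bar> + K * dist z base_point)"
    using assms(1) by (simp add: moment_measures_one_iff)
  then show ?thesis
    by (rule Bochner_Integration.integrable_bound)
       (use m b measurable_cong_sets[OF sets_total_variation refl] in auto)
qed

abbreviation unit_lip :: "('a::pointed_metric_space \<Rightarrow> real) set" where
  "unit_lip \<equiv> {f. f base_point = 0 \<and> lip_const f \<le> 1}"

lemma unit_lip_iff: "f \<in> unit_lip \<longleftrightarrow> f base_point = 0 \<and> 1-lipschitz_on UNIV f"
  using lip_const_le_iff[of 1 f] by simp

lemma unit_lip_zero: "(\<lambda>_. 0) \<in> unit_lip"
  unfolding unit_lip_iff by (simp add: lipschitz_on_def)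

lemma unit_lip_ne: "unit_lip \<noteq> {}"
proof -
  have "A \<noteq> {}" if "x \<in> A" for x :: "'a \<Rightarrow> real" and A using that by blast
  from this[OF unit_lip_zero] show ?thesis .
qed

lemma unit_lip_integrable:
  assumes "\<mu> \<in> moment_measures 1" "f \<in> unit_lip" shows "integrable (total_variation \<mu>) f"
proof -
  have "1-lipschitz_on UNIV f" using assms(2) unfolding unit_lip_iff by (rule conjunct2)
  then show ?thesis by (rule moment_measures_one_integrable[OF assms(1)])
qed

lemma bdd_above_sintegral:
  assumes "\<mu> \<in> moment_measures 1"
  shows "bdd_above (sintegral \<mu> ` unit_lip)"
proof (rule bdd_aboveI2)
  fix f :: "'a \<Rightarrow> real" assume f: "f \<in> unit_lip"
  have i: "integrable (pos_part \<mu>) f" "integrable (neg_part \<mu>) f"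
     "integrable (pos_part \<mu>) (\<lambda>z. dist z base_point)" "integrable (neg_part \<mu>) (\<lambda>z. dist z base_point)"
    using integrable_parts[OF unit_lip_integrable[OF assms f]]
      integrable_parts[OF assms[unfolded moment_measures_one_iff]] by simp_all
  have "\<bar>f z\<bar> \<le> dist z base_point" for z
  proof -
    have "1-lipschitz_on UNIV f" "f base_point = 0" using f unfolding unit_lip_iff by simp_all
    then show ?thesis using lipschitz_onD[of 1 UNIV f z base_point] by (simp add: dist_real_def)
  qed
  then have b: "f z \<le> dist z base_point" "- f z \<le> dist z base_point" for z
    by (meson abs_le_D1 abs_le_D2)+
  have "(\<integral>z. f z \<partial>pos_part \<mu>) \<le> (\<integral>z. dist z base_point \<partial>pos_part \<mu>)"
    using i b by (intro integral_mono) auto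
  moreover have "(\<integral>z. - f z \<partial>neg_part \<mu>) \<le> (\<integral>z. dist z base_point \<partial>neg_part \<mu>)"
    using i b by (intro integral_mono) auto
  ultimately show "sintegral \<mu> f \<le> (\<integral>z. dist z base_point \<partial>pos_part \<mu>) + (\<integral>z. dist z base_point \<partial>neg_part \<mu>)"
    by (simp add: sintegral_def)
qed

lemma moment_measures_add:
  "\<mu> \<in> moment_measures 1 \<Longrightarrow> \<nu> \<in> moment_measures 1 \<Longrightarrow> \<mu> + \<nu> \<in> moment_measures 1"
  by (simp add: moment_measures_one_iff integrable_total_variation_add)

lemma moment_measures_scaleR: "\<mu> \<in> moment_measures 1 \<Longrightarrow> c *\<^sub>R \<mu> \<in> moment_measures 1"
  by (simp add: moment_measures_one_iff integrable_total_variation_scaleR)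

lemma moment_measures_zero: "0 \<in> moment_measures 1"
proof -
  have "variation 0 A = 0" for A :: "'a set"
    using variation_scaleR_le[of 0 0 A] by simp
  then have "emeasure (total_variation (0 :: 'a signed_measure)) A = emeasure (null_measure borel) A" for A
    by (cases "A \<in> sets borel") (auto simp: emeasure_total_variation emeasure_notin_sets)
  then have "total_variation (0 :: 'a signed_measure) = null_measure borel"
    by (intro measure_eqI) auto
  then show ?thesis by (simp add: moment_measures_def)
qed

lemma KRu_norm_add_le:
  assumes "\<mu> \<in> moment_measures 1" "\<nu> \<in> moment_measures 1"
  shows "KRu_norm (\<mu> + \<nu>) \<le> KRu_norm \<mu> + KRu_norm \<nu>"
proof -
  have "(SUP f\<in>unit_lip. sintegral (\<mu> + \<nu>) f) \<le> (SUP f\<in>unit_lip. sintegral \<mu> f) + (SUP f\<in>unit_lip. sintegral \<nu> f)"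
  proof (rule cSUP_least)
    fix f :: "'a \<Rightarrow> real" assume f: "f \<in> unit_lip"
    then have "sintegral (\<mu> + \<nu>) f = sintegral \<mu> f + sintegral \<nu> f"
      using assms unit_lip_integrable by (intro sintegral_add_measure) blast+
    also have "\<dots> \<le> (SUP f\<in>unit_lip. sintegral \<mu> f) + (SUP f\<in>unit_lip. sintegral \<nu> f)"
      using assms f by (intro add_mono cSUP_upper bdd_above_sintegral)
    finally show "sintegral (\<mu> + \<nu>) f \<le> \<dots>" .
  qed (rule unit_lip_ne)
  then show ?thesis by (simp add: KRu_norm_def)
qed

lemma sintegral_uminus: "sintegral \<mu> (\<lambda>z. - f z) = - sintegral \<mu> f"
  by (simp add: sintegral_def)

lemma unit_lip_uminus: "f \<in> unit_lip \<Longrightarrow> (\<lambda>z. - f z) \<in> unit_lip"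
  unfolding unit_lip_iff by (auto simp: lipschitz_on_def dist_real_def abs_minus_commute)

lemma KRu_norm_scaleR:
  assumes "\<mu> \<in> moment_measures 1"
  shows "KRu_norm (c *\<^sub>R \<mu>) = \<bar>c\<bar> * KRu_norm \<mu>"
proof -
  have le: "KRu_norm (c *\<^sub>R \<mu>) \<le> \<bar>c\<bar> * KRu_norm \<mu>" if \<mu>: "\<mu> \<in> moment_measures 1"
    for c and \<mu> :: "'a signed_measure"
  proof -
    have "(SUP f\<in>unit_lip. sintegral (c *\<^sub>R \<mu>) f) \<le> \<bar>c\<bar> * (SUP f\<in>unit_lip. sintegral \<mu> f)"
    proof (rule cSUP_least)
      fix f :: "'a \<Rightarrow> real" assume f: "f \<in> unit_lip"
      have eq: "sintegral (c *\<^sub>R \<mu>) f = c * sintegral \<mu> f"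
        using sintegral_scaleR_measure[OF unit_lip_integrable[OF \<mu> f]] .
      obtain g where g: "g \<in> unit_lip" "sintegral (c *\<^sub>R \<mu>) f = \<bar>c\<bar> * sintegral \<mu> g"
      proof (cases "c \<ge> 0")
        case True then show ?thesis using that[OF f] eq by simp
      next
        case False then show ?thesis using that[OF unit_lip_uminus[OF f]] eq by (simp add: sintegral_uminus)
      qed
      have "sintegral \<mu> g \<le> (SUP f\<in>unit_lip. sintegral \<mu> f)"
        using g(1) by (intro cSUP_upper bdd_above_sintegral \<mu>)
      then show "sintegral (c *\<^sub>R \<mu>) f \<le> \<bar>c\<bar> * (SUP f\<in>unit_lip. sintegral \<mu> f)"
        unfolding g(2) by (intro mult_left_mono) auto
    qed (rule unit_lip_ne)
    then show ?thesis unfolding KRu_norm_def smeas_scaleR abs_mult distrib_left by (rule add_left_mono)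
  qed
  show ?thesis
  proof (cases "c = 0")
    case True
    have "sintegral (0::'a signed_measure) f = 0" if "f \<in> unit_lip" for f :: "'a \<Rightarrow> real"
      using sintegral_scaleR_measure[OF unit_lip_integrable[OF moment_measures_zero that], of 0] by simp
    then have "(SUP f\<in>unit_lip. sintegral (0::'a signed_measure) f) = (SUP f\<in>(unit_lip :: ('a \<Rightarrow> real) set). 0)"
      by (intro SUP_cong) auto
    then have "KRu_norm (0 :: 'a signed_measure) = 0"
      using unit_lip_zero by (subst (asm) cSUP_const) (auto simp: KRu_norm_def)
    then show ?thesis using True by simp
  next
    case False
    have "KRu_norm \<mu> = KRu_norm (inverse c *\<^sub>R (c *\<^sub>R \<mu>))" using False by simp
    also have "\<dots> \<le> \<bar>inverse c\<bar> * KRu_norm (c *\<^sub>R \<mu>)"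
      by (intro le moment_measures_scaleR assms)
    finally have "\<bar>c\<bar> * KRu_norm \<mu> \<le> KRu_norm (c *\<^sub>R \<mu>)"
      using False by (simp add: field_simps)
    with le[OF assms, of c] show ?thesis by simp
  qed
qed

lemma sintegral_const: "sintegral \<mu> (\<lambda>_. c) = c * smeas \<mu> UNIV"
proof -
  have "sintegral \<mu> (\<lambda>_. c) = c * (measure (pos_part \<mu>) UNIV - measure (neg_part \<mu>) UNIV)"
    by (simp add: sintegral_def algebra_simps)
  then show ?thesis by (simp only: measure_pos_diff_neg)
qed

lemma signed_measure_eqI:
  assumes "\<And>C. closed C \<Longrightarrow> smeas \<mu> C = 0"
  shows "\<mu> = 0"
proof -
  have fin: "finite_measure (pos_part \<mu>)" "finite_measure (neg_part \<mu>)" by simp_all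
  have "pos_part \<mu> = neg_part \<mu>"
  proof (rule measure_eqI_generator_eq[where E = "Collect closed" and \<Omega> = UNIV and A = "\<lambda>_. UNIV"])
    fix X :: "'a set" assume "X \<in> Collect closed"
    then have "measure (pos_part \<mu>) X = measure (neg_part \<mu>) X"
      using measure_pos_diff_neg[of \<mu> X] assms[of X] by simp
    then show "emeasure (pos_part \<mu>) X = emeasure (neg_part \<mu>) X"
      using fin by (simp add: finite_measure.emeasure_eq_measure)
  next
    have "sets (borel :: 'a measure) = sigma_sets UNIV (Collect closed)"
      unfolding borel_eq_closed by (simp add: sets_measure_of)
    then show "sets (pos_part \<mu>) = sigma_sets UNIV (Collect closed)"
      "sets (neg_part \<mu>) = sigma_sets UNIV (Collect closed)" by simp_all
  qed (use finite_measure.emeasure_finite[OF fin(1)] in \<open>auto simp: Int_stable_def\<close>)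
  then have "smeas \<mu> A = 0" for A
    using measure_pos_diff_neg[of \<mu> A] by simp
  then show ?thesis by (auto simp: smeas_inject[symmetric])
qed

lemma KRu_norm_eq_0D:
  assumes \<mu>: "\<mu> \<in> moment_measures 1" and 0: "KRu_norm \<mu> = 0"
  shows "\<mu> = 0"
proof (rule signed_measure_eqI)
  have sup0: "sintegral \<mu> f \<le> (SUP f\<in>unit_lip. sintegral \<mu> f)" if "f \<in> unit_lip" for f
    using that by (intro cSUP_upper bdd_above_sintegral \<mu>)
  have "sintegral \<mu> (\<lambda>_. 0) \<le> (SUP f\<in>unit_lip. sintegral \<mu> f)" by (rule sup0[OF unit_lip_zero])
  then have "(SUP f\<in>unit_lip. sintegral \<mu> f) = 0" and mass: "smeas \<mu> UNIV = 0"
    using 0 by (auto simp: KRu_norm_def sintegral_const)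
  then have unit0: "sintegral \<mu> f = 0" if "f \<in> unit_lip" for f
    using sup0[OF that] sup0[OF unit_lip_uminus[OF that]] by (simp add: sintegral_uminus)
  have lip0: "sintegral \<mu> f = 0" if f: "K-lipschitz_on UNIV f" and "K > 0" for f K
  proof -
    define g where "g z = (f z - f base_point) / K" for z
    have "g \<in> unit_lip"
      unfolding unit_lip_iff
    proof
      show "1-lipschitz_on UNIV g"
      proof (rule lipschitz_onI)
        fix x y
        have "g x - g y = (f x - f y) / K" by (simp add: g_def diff_divide_distrib)
        then have "dist (g x) (g y) = dist (f x) (f y) / K"
          using \<open>K > 0\<close> by (simp add: dist_real_def abs_divide)
        also have "\<dots> \<le> dist x y"
          using lipschitz_onD[OF f, of x y] \<open>K > 0\<close> by (simp add: divide_le_eq mult.commute)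
        finally show "dist (g x) (g y) \<le> 1 * dist x y" by simp
      qed simp
    qed (simp add: g_def)
    then have g: "sintegral \<mu> g = 0" by (rule unit0)
    have i: "integrable (pos_part \<mu>) f" "integrable (neg_part \<mu>) f"
      using integrable_parts[OF moment_measures_one_integrable[OF \<mu> f]] by simp_all
    have "sintegral \<mu> g = (sintegral \<mu> f - sintegral \<mu> (\<lambda>_. f base_point)) / K"
      using i by (simp add: sintegral_def g_def diff_divide_distrib
          finite_measure.integrable_const)
    then show ?thesis using g mass \<open>K > 0\<close> by (simp add: sintegral_const)
  qed
  fix C :: "'a set" assume C: "closed C"
  show "smeas \<mu> C = 0"
  proof (cases "C = {}")
    case False
    define F where "F n z = max 0 (1 - real n * infdist z C)" for n z
    have lipF: "(real (Suc n))-lipschitz_on UNIV (F n)" for n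
    proof (rule lipschitz_onI)
      fix x y
      have "\<bar>infdist x C - infdist y C\<bar> \<le> dist x y" by (rule infdist_triangle_abs)
      then have "real n * \<bar>infdist x C - infdist y C\<bar> \<le> real n * dist x y"
        by (intro mult_left_mono) auto
      then have "\<bar>real n * infdist x C - real n * infdist y C\<bar> \<le> real n * dist x y"
        by (simp add: abs_mult flip: right_diff_distrib)
      then have "dist (F n x) (F n y) \<le> real n * dist x y"
        by (auto simp: F_def dist_real_def)
      also have "\<dots> \<le> real (Suc n) * dist x y" by (intro mult_right_mono) auto
      finally show "dist (F n x) (F n y) \<le> real (Suc n) * dist x y" .
    qed simp
    have limF: "(\<lambda>n. F n z) \<longlonglongrightarrow> indicator C z" for z
    proof (cases "z \<in> C")
      case True then show ?thesis by (simp add: F_def)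
    next
      case False
      then have d: "infdist z C > 0"
        using C \<open>C \<noteq> {}\<close> by (metis in_closed_iff_infdist_zero infdist_nonneg less_eq_real_def)
      obtain N where N: "real N * infdist z C > 1" using ex_less_of_nat_mult[OF d] by blast
      have "F n z = 0" if "n \<ge> N" for n
      proof -
        have "real N * infdist z C \<le> real n * infdist z C" using that d by (intro mult_right_mono) auto
        then show ?thesis using N by (simp add: F_def)
      qed
      then have "\<forall>\<^sub>F n in sequentially. F n z = indicator C z"
        using False by (auto simp: eventually_sequentially)
      then show ?thesis by (rule tendsto_eventually)
    qed
    have lim: "(\<lambda>n. \<integral>z. F n z \<partial>M) \<longlonglongrightarrow> measure M C"
      if M: "sets M = sets borel" "finite_measure M" for M :: "'a measure"
    proof -
      have meas: "F n \<in> borel_measurable M" for n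
        using borel_measurable_continuous_onI[OF lipschitz_on_continuous_on[OF lipF]]
          measurable_cong_sets[OF M(1) refl] by blast
      have CM: "C \<in> sets M" using C M(1) by simp
      have "(\<lambda>n. \<integral>z. F n z \<partial>M) \<longlonglongrightarrow> (\<integral>z. indicator C z \<partial>M)"
      proof (rule integral_dominated_convergence[where w = "\<lambda>_. 1"])
        show "integrable M (\<lambda>_. 1::real)" using M(2) by (simp add: finite_measure.integrable_const)
        show "AE x in M. norm (F n x) \<le> 1" for n
          by (auto simp: F_def infdist_nonneg intro!: always_eventually mult_nonneg_nonneg)
      qed (use limF CM meas in auto)
      then show ?thesis using CM sets.sets_into_space[OF CM] by (simp add: Int_absorb2)
    qed
    have "(\<lambda>n. sintegral \<mu> (F n)) \<longlonglongrightarrow> measure (pos_part \<mu>) C - measure (neg_part \<mu>) C"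
      unfolding sintegral_def by (intro tendsto_diff lim) simp_all
    moreover have "sintegral \<mu> (F n) = 0" for n using lip0[OF lipF] by simp
    ultimately show ?thesis
      by (simp add: measure_pos_diff_neg LIMSEQ_const_iff)
  qed simp
qed

text \<open>\<open>\<M>\<^sub>1(Z)\<close> with the Kantorovich-Rubinstein norm as a normed space.\<close>

typedef (overloaded) 'a M1 = "moment_measures 1 :: 'a::pointed_metric_space signed_measure set"
  morphisms M1_measure to_M1
  using moment_measures_zero by blast

setup_lifting type_definition_M1

instantiation M1 :: (pointed_metric_space) real_normed_vector
begin

lift_definition zero_M1 :: "'a M1" is 0 by (rule moment_measures_zero)

lift_definition plus_M1 :: "'a M1 \<Rightarrow> 'a M1 \<Rightarrow> 'a M1" is "(+)" by (rule moment_measures_add)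

lift_definition scaleR_M1 :: "real \<Rightarrow> 'a M1 \<Rightarrow> 'a M1" is "(*\<^sub>R)" by (rule moment_measures_scaleR)

lift_definition uminus_M1 :: "'a M1 \<Rightarrow> 'a M1" is uminus
  using moment_measures_scaleR[of _ "-1"] by simp

lift_definition minus_M1 :: "'a M1 \<Rightarrow> 'a M1 \<Rightarrow> 'a M1" is "(-)"
  using moment_measures_add[OF _ moment_measures_scaleR[of _ "-1"]] by simp

lift_definition norm_M1 :: "'a M1 \<Rightarrow> real" is KRu_norm .

definition dist_M1 :: "'a M1 \<Rightarrow> 'a M1 \<Rightarrow> real" where
  "dist_M1 x y = norm (x - y)"

definition sgn_M1 :: "'a M1 \<Rightarrow> 'a M1" where
  "sgn_M1 x = inverse (norm x) *\<^sub>R x"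

definition uniformity_M1 :: "('a M1 \<times> 'a M1) filter" where
  "uniformity_M1 = (INF e\<in>{0<..}. principal {(x, y). dist x y < e})"

definition open_M1 :: "'a M1 set \<Rightarrow> bool" where
  "open_M1 U \<longleftrightarrow> (\<forall>x\<in>U. \<forall>\<^sub>F (x', y) in uniformity. x' = x \<longrightarrow> y \<in> U)"

instance
proof
  fix x y z :: "'a M1" and a b :: real
  show "dist x y = norm (x - y)" by (rule dist_M1_def)
  show "sgn x = inverse (norm x) *\<^sub>R x" by (rule sgn_M1_def)
  show "uniformity = (INF e\<in>{0<..}. principal {(x, y :: 'a M1). dist x y < e})"
    by (rule uniformity_M1_def)
  show "open U \<longleftrightarrow> (\<forall>x\<in>U. \<forall>\<^sub>F (x', y) in uniformity. x' = x \<longrightarrow> y \<in> U)"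
    for U :: "'a M1 set"
    by (rule open_M1_def)
  show "x + y + z = x + (y + z)" "x + y = y + x" "0 + x = x" "- x + x = 0" "x - y = x + - y"
    "a *\<^sub>R (x + y) = a *\<^sub>R x + a *\<^sub>R y" "(a + b) *\<^sub>R x = a *\<^sub>R x + b *\<^sub>R x"
    "a *\<^sub>R b *\<^sub>R x = (a * b) *\<^sub>R x" "1 *\<^sub>R x = x"
    by (transfer; simp add: algebra_simps)+
  show "norm (x + y) \<le> norm x + norm y" by transfer (rule KRu_norm_add_le)
  show "norm (a *\<^sub>R x) = \<bar>a\<bar> * norm x" by transfer (rule KRu_norm_scaleR)
  show "norm x = 0 \<longleftrightarrow> x = 0"
  proof (transfer, rule iffI)
    show "\<mu> = 0" if "\<mu> \<in> moment_measures 1" "KRu_norm \<mu> = 0" for \<mu> :: "'a signed_measure"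
      using that by (rule KRu_norm_eq_0D)
    show "KRu_norm \<mu> = 0" if "\<mu> = 0" for \<mu> :: "'a signed_measure"
      using KRu_norm_scaleR[OF moment_measures_zero, of 0] that by simp
  qed
qed

end

section \<open>Completion of a normed space\<close>

lemma Cauchy_const':
  fixes c :: "'a::real_normed_vector" shows "Cauchy (\<lambda>_. c)"
  by (rule CauchyI) auto

lemma Cauchy_scaleR':
  fixes X :: "nat \<Rightarrow> 'a::real_normed_vector"
  assumes "Cauchy X" shows "Cauchy (\<lambda>n. c *\<^sub>R X n)"
  using bounded_linear.Cauchy[OF bounded_linear_scaleR_right assms] .

lemma Cauchy_uminus':
  fixes X :: "nat \<Rightarrow> 'a::real_normed_vector"
  assumes "Cauchy X" shows "Cauchy (\<lambda>n. - X n)"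
  using Cauchy_scaleR'[OF assms, of "-1"] by simp

lemma Cauchy_add':
  fixes X Y :: "nat \<Rightarrow> 'a::real_normed_vector"
  assumes "Cauchy X" "Cauchy Y" shows "Cauchy (\<lambda>n. X n + Y n)"
proof (rule CauchyI)
  fix \<epsilon> :: real assume "\<epsilon> > 0"
  then obtain M N where M: "\<forall>m\<ge>M. \<forall>n\<ge>M. norm (X m - X n) < \<epsilon> / 2"
    and N: "\<forall>m\<ge>N. \<forall>n\<ge>N. norm (Y m - Y n) < \<epsilon> / 2"
    using assms by (meson CauchyD half_gt_zero)
  have "norm (X m + Y m - (X n + Y n)) < \<epsilon>" if "m \<ge> max M N" "n \<ge> max M N" for m n
  proof -
    have "norm (X m + Y m - (X n + Y n)) \<le> norm (X m - X n) + norm (Y m - Y n)"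
      by (rule norm_diff_triangle_ineq)
    also have "\<dots> < \<epsilon> / 2 + \<epsilon> / 2"
      using M N that by (intro add_strict_mono) auto
    finally show ?thesis by simp
  qed
  then show "\<exists>M. \<forall>m\<ge>M. \<forall>n\<ge>M. norm (X m + Y m - (X n + Y n)) < \<epsilon>" by blast
qed

lemma Cauchy_diff':
  fixes X Y :: "nat \<Rightarrow> 'a::real_normed_vector"
  assumes "Cauchy X" "Cauchy Y" shows "Cauchy (\<lambda>n. X n - Y n)"
  using Cauchy_add'[OF assms(1) Cauchy_uminus'[OF assms(2)]] by simp

lemma Cauchy_norm':
  fixes X :: "nat \<Rightarrow> 'a::real_normed_vector"
  assumes "Cauchy X" shows "convergent (\<lambda>n. norm (X n))"
proof -
  have "Cauchy (\<lambda>n. norm (X n))"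
  proof (rule metric_CauchyI)
    fix \<epsilon> :: real assume "\<epsilon> > 0"
    then obtain M where "\<forall>m\<ge>M. \<forall>n\<ge>M. norm (X m - X n) < \<epsilon>"
      using assms by (meson CauchyD)
    then show "\<exists>M. \<forall>m\<ge>M. \<forall>n\<ge>M. dist (norm (X m)) (norm (X n)) < \<epsilon>"
      by (metis dist_real_def norm_triangle_ineq3 order_le_less_trans)
  qed
  then show ?thesis by (rule Cauchy_convergent)
qed

text \<open>The completion of a normed space: Cauchy sequences modulo null sequences. The space embeds
  isometrically (\<open>norm_to_completion\<close>) and densely (\<open>closure_range_to_completion\<close>) by
  \<open>to_completion\<close>.\<close>

definition completion_rel :: "(nat \<Rightarrow> 'a::real_normed_vector) \<Rightarrow> (nat \<Rightarrow> 'a) \<Rightarrow> bool" where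
  "completion_rel X Y \<longleftrightarrow> Cauchy X \<and> Cauchy Y \<and> (\<lambda>n. X n - Y n) \<longlonglongrightarrow> 0"

lemma completion_rel_trans:
  assumes "completion_rel X Y" "completion_rel Y W" shows "completion_rel X W"
  using assms tendsto_add[of "\<lambda>n. X n - Y n" 0 sequentially "\<lambda>n. Y n - W n" 0]
  by (auto simp: completion_rel_def)

lemma completion_rel_sym: "completion_rel X Y \<Longrightarrow> completion_rel Y X"
  using tendsto_minus[of "\<lambda>n. X n - Y n" 0 sequentially]
  by (auto simp: completion_rel_def)

quotient_type (overloaded) 'a normed_completion =
  "nat \<Rightarrow> 'a::real_normed_vector" / partial: completion_rel
proof (rule part_equivpI)
  show "\<exists>X :: nat \<Rightarrow> 'a. completion_rel X X"
    by (intro exI[of _ "\<lambda>_. 0"]) (simp add: completion_rel_def Cauchy_const')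
  show "symp (completion_rel :: (nat \<Rightarrow> 'a) \<Rightarrow> _)"
    by (rule sympI) (rule completion_rel_sym)
  show "transp (completion_rel :: (nat \<Rightarrow> 'a) \<Rightarrow> _)"
    by (rule transpI) (rule completion_rel_trans)
qed

instantiation normed_completion :: (real_normed_vector) real_normed_vector
begin

lift_definition zero_normed_completion :: "'a normed_completion" is "\<lambda>_. 0"
  by (simp add: completion_rel_def Cauchy_const')

lift_definition plus_normed_completion ::
  "'a normed_completion \<Rightarrow> 'a normed_completion \<Rightarrow> 'a normed_completion" is "\<lambda>X Y n. X n + Y n"
  subgoal for X X' Y Y'
    using tendsto_add[of "\<lambda>n. X n - X' n" 0 sequentially "\<lambda>n. Y n - Y' n" 0]
    by (auto simp: completion_rel_def algebra_simps intro!: Cauchy_add')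
  done

lift_definition uminus_normed_completion ::
  "'a normed_completion \<Rightarrow> 'a normed_completion" is "\<lambda>X n. - X n"
  subgoal for X X'
    using tendsto_minus[of "\<lambda>n. X n - X' n" 0 sequentially]
    by (auto simp: completion_rel_def algebra_simps intro!: Cauchy_uminus')
  done

lift_definition minus_normed_completion ::
  "'a normed_completion \<Rightarrow> 'a normed_completion \<Rightarrow> 'a normed_completion" is "\<lambda>X Y n. X n - Y n"
  subgoal for X X' Y Y'
    using tendsto_diff[of "\<lambda>n. X n - X' n" 0 sequentially "\<lambda>n. Y n - Y' n" 0]
    by (auto simp: completion_rel_def algebra_simps intro!: Cauchy_diff')
  done

lift_definition scaleR_normed_completion ::
  "real \<Rightarrow> 'a normed_completion \<Rightarrow> 'a normed_completion" is "\<lambda>c X n. c *\<^sub>R X n"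
  subgoal for c X X'
    using tendsto_scaleR[OF tendsto_const, of "\<lambda>n. X n - X' n" 0 sequentially c]
    by (auto simp: completion_rel_def scaleR_diff_right intro!: Cauchy_scaleR')
  done

lift_definition norm_normed_completion :: "'a normed_completion \<Rightarrow> real" is
  "\<lambda>X. lim (\<lambda>n. norm (X n))"
  subgoal for X Y
  proof -
    assume *: "completion_rel X Y"
    then have "convergent (\<lambda>n. norm (X n))"
      by (auto simp: completion_rel_def intro: Cauchy_norm')
    then have X: "(\<lambda>n. norm (X n)) \<longlonglongrightarrow> lim (\<lambda>n. norm (X n))"
      by (simp add: convergent_LIMSEQ_iff)
    have "(\<lambda>n. norm (X n) - norm (Y n)) \<longlonglongrightarrow> 0"
    proof (rule Lim_null_comparison)
      show "(\<lambda>n. norm (X n - Y n)) \<longlonglongrightarrow> 0"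
        using * by (simp add: completion_rel_def tendsto_norm_zero_iff)
    qed (simp add: norm_triangle_ineq3)
    from tendsto_diff[OF X this] have "(\<lambda>n. norm (Y n)) \<longlonglongrightarrow> lim (\<lambda>n. norm (X n))"
      by simp
    then show ?thesis by (simp add: limI)
  qed
  done

definition dist_normed_completion :: "'a normed_completion \<Rightarrow> 'a normed_completion \<Rightarrow> real" where
  "dist_normed_completion x y = norm (x - y)"

definition sgn_normed_completion :: "'a normed_completion \<Rightarrow> 'a normed_completion" where
  "sgn_normed_completion x = inverse (norm x) *\<^sub>R x"

definition uniformity_normed_completion :: "('a normed_completion \<times> 'a normed_completion) filter" where
  "uniformity_normed_completion = (INF e\<in>{0<..}. principal {(x, y). dist x y < e})"

definition open_normed_completion :: "'a normed_completion set \<Rightarrow> bool" where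
  "open_normed_completion U \<longleftrightarrow> (\<forall>x\<in>U. \<forall>\<^sub>F (x', y) in uniformity. x' = x \<longrightarrow> y \<in> U)"

lemma norm_normed_completion_tendsto:
  "completion_rel X X \<Longrightarrow> (\<lambda>n. norm (X n)) \<longlonglongrightarrow> norm (abs_normed_completion X)"
  by (simp add: norm_normed_completion.abs_eq completion_rel_def Cauchy_norm'
      flip: convergent_LIMSEQ_iff)

instance
proof
  fix x y z :: "'a normed_completion" and a b :: real
  show "dist x y = norm (x - y)" by (rule dist_normed_completion_def)
  show "sgn x = inverse (norm x) *\<^sub>R x" by (rule sgn_normed_completion_def)
  show "uniformity = (INF e\<in>{0<..}. principal {(x, y :: 'a normed_completion). dist x y < e})"
    by (rule uniformity_normed_completion_def)
  show "open U \<longleftrightarrow> (\<forall>x\<in>U. \<forall>\<^sub>F (x', y) in uniformity. x' = x \<longrightarrow> y \<in> U)"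
    for U :: "'a normed_completion set"
    by (rule open_normed_completion_def)
  show "x + y + z = x + (y + z)" "x + y = y + x" "0 + x = x" "- x + x = 0" "x - y = x + - y"
    "a *\<^sub>R (x + y) = a *\<^sub>R x + a *\<^sub>R y" "(a + b) *\<^sub>R x = a *\<^sub>R x + b *\<^sub>R x"
    "a *\<^sub>R b *\<^sub>R x = (a * b) *\<^sub>R x" "1 *\<^sub>R x = x"
    by (transfer; auto simp: completion_rel_def algebra_simps
        intro!: Cauchy_add' Cauchy_scaleR' Cauchy_uminus' Cauchy_diff' Cauchy_const')+
  show "norm (x + y) \<le> norm x + norm y"
  proof (transfer, goal_cases)
    case (1 X Y)
    then have X: "Cauchy X" and Y: "Cauchy Y" by (auto simp: completion_rel_def)
    show ?case
    proof (rule LIMSEQ_le)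
      show "(\<lambda>n. norm (X n + Y n)) \<longlonglongrightarrow> lim (\<lambda>n. norm (X n + Y n))"
        using Cauchy_norm'[OF Cauchy_add'[OF X Y]] by (simp add: convergent_LIMSEQ_iff)
      show "(\<lambda>n. norm (X n) + norm (Y n)) \<longlonglongrightarrow> lim (\<lambda>n. norm (X n)) + lim (\<lambda>n. norm (Y n))"
        using Cauchy_norm' X Y by (intro tendsto_add) (auto simp flip: convergent_LIMSEQ_iff)
    qed (auto intro: norm_triangle_ineq)
  qed
  show "norm (a *\<^sub>R x) = \<bar>a\<bar> * norm x"
  proof (transfer, goal_cases)
    case (1 a X)
    then have X: "Cauchy X" by (auto simp: completion_rel_def)
    have "(\<lambda>n. norm (a *\<^sub>R X n)) \<longlonglongrightarrow> \<bar>a\<bar> * lim (\<lambda>n. norm (X n))"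
      using Cauchy_norm' X by (auto intro!: tendsto_mult simp flip: convergent_LIMSEQ_iff)
    then show ?case by (rule limI)
  qed
  show "norm x = 0 \<longleftrightarrow> x = 0"
  proof (transfer, goal_cases)
    case (1 X)
    then have X: "Cauchy X" by (auto simp: completion_rel_def)
    have L: "(\<lambda>n. norm (X n)) \<longlonglongrightarrow> lim (\<lambda>n. norm (X n))"
      using Cauchy_norm'[OF X] by (simp add: convergent_LIMSEQ_iff)
    show ?case
    proof
      assume "lim (\<lambda>n. norm (X n)) = 0"
      then have "X \<longlonglongrightarrow> 0" using L by (simp add: tendsto_norm_zero_iff)
      then show "completion_rel X (\<lambda>_. 0)" using X by (simp add: completion_rel_def Cauchy_const')
    next
      assume "completion_rel X (\<lambda>_. 0)"
      then have "(\<lambda>n. norm (X n)) \<longlonglongrightarrow> 0" by (auto simp: completion_rel_def intro!: tendsto_norm_zero)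
      then show "lim (\<lambda>n. norm (X n)) = 0" by (rule limI)
    qed
  qed
qed

end

lift_definition to_completion :: "'a::real_normed_vector \<Rightarrow> 'a normed_completion" is "\<lambda>x _. x"
  by (simp add: completion_rel_def Cauchy_const')

lemma norm_to_completion [simp]: "norm (to_completion x) = norm x"
  by transfer (simp add: limI)

lemma to_completion_add: "to_completion (x + y) = to_completion x + to_completion y"
  by transfer (simp add: completion_rel_def Cauchy_const')

lemma to_completion_diff: "to_completion (x - y) = to_completion x - to_completion y"
  by transfer (simp add: completion_rel_def Cauchy_const')

lemma to_completion_scaleR: "to_completion (c *\<^sub>R x) = c *\<^sub>R to_completion x"
  by transfer (simp add: completion_rel_def Cauchy_const')

lemma bounded_linear_to_completion: "bounded_linear to_completion"
  by (rule bounded_linear_intro[where K = 1]) (auto simp: to_completion_add to_completion_scaleR)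

lemma inj_to_completion: "inj to_completion"
proof (rule injI)
  fix x y :: 'a assume "to_completion x = to_completion y"
  then have "norm (to_completion (x - y)) = 0" by (simp add: to_completion_diff)
  then show "x = y" by simp
qed

lemma to_completion_approx:
  assumes "\<epsilon> > 0" shows "\<exists>x. norm (h - to_completion x) < \<epsilon>"
proof -
  obtain X where X: "completion_rel X X" "h = abs_normed_completion X"
    using Quotient_rep_reflp[OF Quotient_normed_completion] Quotient_abs_rep[OF Quotient_normed_completion]
    by metis
  then have "Cauchy X" by (simp add: completion_rel_def)
  then obtain M where M: "\<forall>m\<ge>M. \<forall>n\<ge>M. norm (X m - X n) < \<epsilon> / 2"
    using assms by (meson CauchyD half_gt_zero)
  have rel: "completion_rel (\<lambda>n. X n - X M) (\<lambda>n. X n - X M)"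
    using \<open>Cauchy X\<close> by (auto simp: completion_rel_def intro!: Cauchy_diff' Cauchy_const')
  have "h - to_completion (X M) = abs_normed_completion (\<lambda>n. X n - X M)"
    unfolding X(2) to_completion_def map_fun_def id_def o_def using X(1)
    by (subst minus_normed_completion.abs_eq) (auto simp: completion_rel_def Cauchy_const')
  then have "(\<lambda>n. norm (X n - X M)) \<longlonglongrightarrow> norm (h - to_completion (X M))"
    using norm_normed_completion_tendsto[OF rel] by simp
  then have "norm (h - to_completion (X M)) \<le> \<epsilon> / 2"
    using M by (intro LIMSEQ_le_const2) (auto intro!: exI[of _ M] less_imp_le)
  then show ?thesis using assms by (intro exI[of _ "X M"]) auto
qed

lemma closure_range_to_completion: "closure (range to_completion) = UNIV"
  using to_completion_approx by (force simp: closure_approachable dist_norm norm_minus_commute)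

instance normed_completion :: (real_normed_vector) banach
proof
  fix H :: "nat \<Rightarrow> 'a normed_completion"
  assume H: "Cauchy H"
  have "\<exists>x. \<forall>n. norm (H n - to_completion (x n)) < inverse (real (Suc n))"
    by (intro choice allI to_completion_approx) simp
  then obtain x where x: "\<And>n. norm (H n - to_completion (x n)) < inverse (real (Suc n))" by auto
  have lim0: "(\<lambda>n. to_completion (x n) - H n) \<longlonglongrightarrow> 0"
    by (rule Lim_null_comparison[OF _ LIMSEQ_inverse_real_of_nat])
      (use x in \<open>auto simp: norm_minus_commute intro!: always_eventually less_imp_le\<close>)
  then have "Cauchy (\<lambda>n. (to_completion (x n) - H n) + H n)"
    by (intro Cauchy_add' H LIMSEQ_imp_Cauchy)
  then have C: "Cauchy (\<lambda>n. to_completion (x n))" by simp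
  have Cx: "Cauchy x"
    using C by (simp add: Cauchy_iff flip: to_completion_diff)
  define h where "h = abs_normed_completion x"
  have relx: "completion_rel x x" using Cx by (simp add: completion_rel_def)
  have "(\<lambda>n. to_completion (x n)) \<longlonglongrightarrow> h"
  proof (rule metric_LIMSEQ_I)
    fix r :: real assume "r > 0"
    then obtain M where M: "\<forall>m\<ge>M. \<forall>n\<ge>M. norm (x m - x n) < r / 2"
      using Cx by (meson CauchyD half_gt_zero)
    have "dist (to_completion (x m)) h < r" if m: "m \<ge> M" for m
    proof -
      have rel: "completion_rel (\<lambda>n. x n - x m) (\<lambda>n. x n - x m)"
        using Cx by (auto simp: completion_rel_def intro!: Cauchy_diff' Cauchy_const')
      have "h - to_completion (x m) = abs_normed_completion (\<lambda>n. x n - x m)"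
        unfolding h_def to_completion_def map_fun_def id_def o_def using relx
        by (subst minus_normed_completion.abs_eq) (auto simp: completion_rel_def Cauchy_const')
      then have "(\<lambda>n. norm (x n - x m)) \<longlonglongrightarrow> norm (h - to_completion (x m))"
        using norm_normed_completion_tendsto[OF rel] by simp
      then have "norm (h - to_completion (x m)) \<le> r / 2"
        using M m by (intro LIMSEQ_le_const2) (auto intro!: exI[of _ M] less_imp_le)
      then show ?thesis using \<open>r > 0\<close> by (simp add: dist_norm norm_minus_commute)
    qed
    then show "\<exists>M. \<forall>m\<ge>M. dist (to_completion (x m)) h < r" by blast
  qed
  from tendsto_diff[OF this lim0] have "H \<longlonglongrightarrow> h" by simp
  then show "convergent H" by (auto simp: convergent_def)
qed

section \<open>The space KRu and the regularizer\<close>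

type_synonym 'a KRu = "'a M1 normed_completion"

text \<open>The inclusion of \<open>\<M>\<^sub>1(Z)\<close> into \<open>KRu(Z)\<close>; it is only meaningful on \<^term>\<open>moment_measures 1\<close>,
  which contains \<^term>\<open>moment_measures p\<close> for \<open>p \<ge> 1\<close>.\<close>

definition KRu_of :: "'a::pointed_metric_space signed_measure \<Rightarrow> 'a KRu" where
  "KRu_of \<mu> = to_completion (to_M1 \<mu>)"

lemma norm_KRu_of: "\<mu> \<in> moment_measures 1 \<Longrightarrow> norm (KRu_of \<mu>) = KRu_norm \<mu>"
  by (simp add: KRu_of_def norm_M1.rep_eq to_M1_inverse)

lemma inj_on_KRu_of: "inj_on KRu_of (moment_measures 1)"
  unfolding KRu_of_def
  by (rule inj_onI) (simp add: inj_eq[OF inj_to_completion] to_M1_inject)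

lemma closure_KRu_of: "closure (KRu_of ` moment_measures 1) = UNIV"
proof -
  have "range to_completion = KRu_of ` (moment_measures 1 :: 'a signed_measure set)"
    unfolding KRu_of_def image_image[symmetric, of to_completion to_M1]
    using type_definition.Abs_image[OF type_definition_M1] by metis
  then show ?thesis using closure_range_to_completion by metis
qed

lemma KRu_of_add:
  assumes "\<mu> \<in> moment_measures 1" "\<nu> \<in> moment_measures 1"
  shows "KRu_of (\<mu> + \<nu>) = KRu_of \<mu> + KRu_of \<nu>"
proof -
  have "to_M1 (\<mu> + \<nu>) = to_M1 \<mu> + to_M1 \<nu>"
    using assms by (simp add: M1_measure_inject[symmetric] plus_M1.rep_eq to_M1_inverse moment_measures_add)
  then show ?thesis by (simp add: KRu_of_def to_completion_add)
qed

lemma KRu_of_scaleR: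
  assumes "\<mu> \<in> moment_measures 1"
  shows "KRu_of (c *\<^sub>R \<mu>) = c *\<^sub>R KRu_of \<mu>"
proof -
  have "to_M1 (c *\<^sub>R \<mu>) = c *\<^sub>R to_M1 \<mu>"
    using assms by (simp add: M1_measure_inject[symmetric] scaleR_M1.rep_eq to_M1_inverse moment_measures_scaleR)
  then show ?thesis by (simp add: KRu_of_def to_completion_scaleR)
qed

lemma moment_measures_subset:
  assumes "p \<ge> 1"
  shows "moment_measures p \<subseteq> (moment_measures 1 :: 'a::pointed_metric_space signed_measure set)"
proof
  fix \<mu> :: "'a signed_measure" assume \<mu>: "\<mu> \<in> moment_measures p"
  have le: "d \<le> 1 + d powr p" if "d \<ge> 0" for d :: real
  proof (cases "d \<le> 1")
    case False
    then have "d powr 1 \<le> d powr p" using assms by (intro powr_mono) auto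
    then show ?thesis using False by simp
  qed (use powr_ge_zero[of d p] in linarith)
  have "(\<integral>\<^sup>+z. ennreal (dist z base_point powr 1) \<partial>total_variation \<mu>)
      \<le> (\<integral>\<^sup>+z. 1 + ennreal (dist z base_point powr p) \<partial>total_variation \<mu>)"
    using le by (intro nn_integral_mono) (simp flip: ennreal_1 ennreal_plus add: ennreal_leI)
  also have "\<dots> = emeasure (total_variation \<mu>) UNIV
      + (\<integral>\<^sup>+z. ennreal (dist z base_point powr p) \<partial>total_variation \<mu>)"
    by (subst nn_integral_add) auto
  also have "\<dots> < \<infinity>"
    using \<mu> finite_measure.emeasure_finite[OF finite_total_variation, of \<mu> UNIV]
    by (simp add: moment_measures_def less_top)
  finally show "\<mu> \<in> moment_measures 1" by (simp add: moment_measures_def)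
qed

definition G_reg :: "real \<Rightarrow> real \<Rightarrow> real \<Rightarrow> 'a::pointed_metric_space KRu \<Rightarrow> ereal" where
  "G_reg p \<alpha> \<beta> h =
     (if h \<in> KRu_of ` moment_measures p
      then let \<mu> = the_inv_into (moment_measures p) KRu_of h in
        ereal (\<alpha> * norm h + \<beta> * (\<integral>z. 1 + dist z base_point powr p \<partial>total_variation \<mu>))
      else \<infinity>)"

lemma G_reg_KRu_of:
  assumes "p \<ge> 1" "\<mu> \<in> moment_measures p"
  shows "G_reg p \<alpha> \<beta> (KRu_of \<mu>) =
    ereal (\<alpha> * KRu_norm \<mu> + \<beta> * (\<integral>z. 1 + dist z base_point powr p \<partial>total_variation \<mu>))"
proof -
  have "inj_on KRu_of (moment_measures p :: 'a signed_measure set)"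
    using inj_on_KRu_of moment_measures_subset[OF assms(1)] by (rule inj_on_subset)
  moreover have "\<mu> \<in> moment_measures 1" using moment_measures_subset[OF assms(1)] assms(2) by blast
  ultimately show ?thesis
    using assms(2) by (simp add: G_reg_def the_inv_into_f_f norm_KRu_of)
qed

definition geodesic_on :: "'a::metric_space set \<Rightarrow> bool" where
  "geodesic_on S \<longleftrightarrow> (\<forall>x\<in>S. \<forall>y\<in>S. \<exists>\<gamma>.
     \<gamma> 0 = x \<and> \<gamma> (dist x y) = y \<and> \<gamma> ` {0..dist x y} \<subseteq> S \<and>
     (\<forall>s\<in>{0..dist x y}. \<forall>t\<in>{0..dist x y}. dist (\<gamma> s) (\<gamma> t) = \<bar>s - t\<bar>))"

definition proper_fun :: "('a \<Rightarrow> ereal) \<Rightarrow> bool" where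
  "proper_fun F \<longleftrightarrow> (\<forall>x. F x \<noteq> -\<infinity>) \<and> (\<exists>x. F x \<noteq> \<infinity>)"

definition convex_fun :: "('a::real_vector \<Rightarrow> ereal) \<Rightarrow> bool" where
  "convex_fun F \<longleftrightarrow> (\<forall>x y. \<forall>t\<in>{0<..<1}.
     F ((1 - t) *\<^sub>R x + t *\<^sub>R y) \<le> ereal (1 - t) * F x + ereal t * F y)"

definition coercive_fun :: "('a::real_normed_vector \<Rightarrow> ereal) \<Rightarrow> bool" where
  "coercive_fun F \<longleftrightarrow> (F \<longlongrightarrow> \<infinity>) at_infinity"

definition lsc_fun :: "('a::topological_space \<Rightarrow> ereal) \<Rightarrow> bool" where
  "lsc_fun F \<longleftrightarrow> (\<forall>x. F x \<le> Liminf (at x) F)"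

end

theory Submission
  imports Defs "HOL-Probability.Giry_Monad"
begin

text \<open>
  Write \<open>w(z) = 1 + d(z, e)\<^sup>p\<close>. For a finitely supported measure the value of the regularizer is
  attained by splitting the measure into the elementary pieces \<open>\<plusminus>\<delta>\<^sub>z\<close>, of cost
  \<open>\<alpha> (1 + d(z, e)) + \<beta> w(z)\<close>, and \<open>\<delta>\<^sub>z - \<delta>\<^sub>w\<close>, of cost \<open>\<alpha> d(z, w) + \<beta> (w(z) + w(w))\<close>: an optimal
  transport plan tells which part of the positive mass is paired with which part of the negative
  mass, and the total mass is transported to \<open>e\<close>. These pieces are the \<open>atoms\<close> below. Since
  \<open>\<delta>\<^sub>z = (\<delta>\<^sub>z - \<delta>\<^sub>e) + \<delta>\<^sub>e\<close>, every combination of \<open>N\<close> atoms has the required form. Only the images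
  of the atoms under \<open>A\<close> matter, and these live in \<open>\<real>\<^sup>N\<close>; so the theorem reduces to the convex hull
  \<open>B\<close> of the vectors \<open>A u / cost(u)\<close>, and three facts about it carry the proof.

  The hull is compact (\<open>compact_atom_image\<close>). Closed balls of \<open>Z\<close> are compact by the Hopf-Rinow
  argument, and \<open>A u / cost(u)\<close> depends continuously on the points of the atom and tends to \<open>0\<close>
  when they go to infinity, because the norm of \<open>u\<close> grows at most linearly with the distance to \<open>e\<close>
  and the cost grows like the power \<open>p > 1\<close>.

  The hull sees every measure (\<open>image_in_energy_times_hull\<close>): \<open>A \<mu> \<in> G(\<mu>) B\<close> for
  \<open>\<mu> \<in> \<M>\<^sub>p(Z)\<close>. Otherwise a hyperplane separates the two and gives, with
  \<open>f(z) = \<langle>\<xi>, A \<delta>\<^sub>z\<rangle>\<close>, a functional that is at most the cost on every atom although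
  \<open>\<langle>\<xi>, A \<mu>\<rangle> = \<integral> f d\<mu>\<close> exceeds \<open>G(\<mu>)\<close>. But the inequalities for the atoms are exactly what a
  McShane extension needs to produce a 1-Lipschitz function \<open>h\<close> with \<open>\<bar>h(e)\<bar> \<le> 1\<close> and
  \<open>\<bar>f - \<alpha> h\<bar> \<le> \<beta> w\<close>, whence \<open>\<integral> f d\<mu> \<le> \<alpha> \<integral> h d\<mu> + \<beta> \<integral> w d\<bar>\<mu>\<bar> \<le> G(\<mu>)\<close>
  (\<open>sintegral_le_energy\<close>). This replaces both the duality theorem of optimal transport and an
  analysis of the extreme points of the unit ball.

  Points of \<open>t B\<close> are reached cheaply (\<open>sparse_measure_over_hull_point\<close>): by a conic version of
  Caratheodory's theorem such a point is the image of a combination of at most \<open>N\<close> atoms of total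
  cost at most \<open>t\<close>.

  Hence minimising \<open>F(A \<mu>) + G(\<mu>)\<close> amounts to minimising \<open>F(t x) + t\<close> over \<open>t \<ge> 0\<close>, \<open>x \<in> B\<close>. This
  function is lower semicontinuous with bounded sublevel sets, as \<open>F\<close> is bounded below, so it
  attains its minimum, and the sparse measure over a minimising pair is the minimizer sought.
\<close>

section \<open>Convex combinations and minimisation in finite dimensions\<close>

text \<open>
  While the vectors are linearly dependent, a multiple of a dependence can be subtracted from the
  coefficients until one of them vanishes. Choosing the sign of the dependence so that its
  coefficients have a nonnegative sum keeps the total weight from growing; it is this control of the
  weight that saves one vector compared with Caratheodory's theorem for convex hulls.
\<close>

lemma conic_caratheodory:
  fixes S :: "'a::real_vector set"
  assumes "finite S" "\<And>x. x \<in> S \<Longrightarrow> 0 \<le> c x"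
  shows "\<exists>T c'. T \<subseteq> S \<and> independent T \<and> (\<forall>x\<in>T. 0 \<le> c' x) \<and>
    (\<Sum>x\<in>T. c' x *\<^sub>R x) = (\<Sum>x\<in>S. c x *\<^sub>R x) \<and> sum c' T \<le> sum c S"
  using assms
proof (induction "card S" arbitrary: S c rule: less_induct)
  case less
  show ?case
  proof (cases "dependent S")
    case False
    then show ?thesis using less.prems by blast
  next
    case True
    obtain l0 v where l0: "v \<in> S" "l0 v \<noteq> 0" "(\<Sum>x\<in>S. l0 x *\<^sub>R x) = 0"
      using True less.prems(1) by (auto simp: dependent_finite)
    \<comment> \<open>Normalise the dependence to have nonnegative sum and a positive coefficient.\<close>
    define s :: real where "s = (if sum l0 S < 0 \<or> sum l0 S = 0 \<and> l0 v < 0 then -1 else 1)"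
    define l where "l x = s * l0 x" for x
    have l_eq: "(\<Sum>x\<in>S. l x *\<^sub>R x) = 0"
      using l0(3) by (simp add: l_def flip: scaleR_scaleR scaleR_sum_right)
    have "sum l S = s * sum l0 S" by (simp add: l_def sum_distrib_left)
    then have l_sum: "sum l S \<ge> 0" "sum l S = 0 \<longrightarrow> l v > 0"
      using l0(2) by (auto simp: s_def l_def)
    define P where "P = {x\<in>S. l x > 0}"
    have "P \<noteq> {}"
    proof
      assume "P = {}"
      then have "l x \<le> 0" if "x \<in> S" for x using that by (auto simp: P_def not_less)
      then have "sum l S \<le> 0" by (simp add: sum_nonpos)
      with l_sum l0(1) \<open>P = {}\<close> show False by (auto simp: P_def)
    qed
    moreover have "finite P" using less.prems(1) by (simp add: P_def)
    ultimately obtain x0 where x0: "x0 \<in> P" "\<And>x. x \<in> P \<Longrightarrow> c x0 / l x0 \<le> c x / l x"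
      using ex_min_if_finite[of "(\<lambda>x. c x / l x) ` P"] by (auto simp: not_less)
    \<comment> \<open>The largest multiple of \<open>l\<close> that can be subtracted without making a coefficient negative.\<close>
    define t where "t = c x0 / l x0"
    have t: "t \<ge> 0" using x0(1) less.prems(2) by (auto simp: t_def P_def)
    define d where "d x = c x - t * l x" for x
    have x0S: "x0 \<in> S" and d0: "d x0 = 0" using x0(1) by (auto simp: P_def d_def t_def)
    have d_nonneg: "d x \<ge> 0" if "x \<in> S" for x
    proof (cases "x \<in> P")
      case True
      then have "t \<le> c x / l x" "l x > 0" using x0(2) by (auto simp: t_def P_def)
      then show ?thesis by (simp add: d_def pos_le_divide_eq)
    next
      case False
      then have "t * l x \<le> 0" using that t by (auto simp: P_def not_less mult_nonneg_nonpos)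
      then show ?thesis using less.prems(2)[OF that] by (simp add: d_def)
    qed
    have "(\<Sum>x\<in>S - {x0}. d x *\<^sub>R x) = (\<Sum>x\<in>S. d x *\<^sub>R x)"
      using less.prems(1) x0S d0 by (simp add: sum.remove)
    also have "\<dots> = (\<Sum>x\<in>S. c x *\<^sub>R x) - t *\<^sub>R (\<Sum>x\<in>S. l x *\<^sub>R x)"
      by (simp add: d_def scaleR_diff_left sum_subtractf scaleR_sum_right)
    finally have d_eq: "(\<Sum>x\<in>S - {x0}. d x *\<^sub>R x) = (\<Sum>x\<in>S. c x *\<^sub>R x)" using l_eq by simp
    have "sum d (S - {x0}) = sum d S" using less.prems(1) x0S d0 by (simp add: sum.remove)
    also have "\<dots> = sum c S - t * sum l S" by (simp add: d_def sum_subtractf sum_distrib_left)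
    also have "\<dots> \<le> sum c S" using t l_sum(1) by simp
    finally have d_sum: "sum d (S - {x0}) \<le> sum c S" .
    have "card (S - {x0}) < card S" using less.prems(1) x0S by (metis card_Diff1_less)
    then obtain T c' where "T \<subseteq> S - {x0}" "independent T" "\<forall>x\<in>T. 0 \<le> c' x"
      "(\<Sum>x\<in>T. c' x *\<^sub>R x) = (\<Sum>x\<in>S - {x0}. d x *\<^sub>R x)" "sum c' T \<le> sum d (S - {x0})"
      using less.hyps[of "S - {x0}" d] less.prems(1) d_nonneg by (meson DiffD1 finite_Diff)
    then show ?thesis using d_eq d_sum by (intro exI[of _ T] exI[of _ c']) auto
  qed
qed

text \<open>
  \<open>lsc_fun\<close> speaks of punctured neighbourhoods; along a net that may take the value \<open>x\<close> itself
  the estimate persists because \<open>F\<close> trivially exceeds every smaller number at \<open>x\<close>.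
\<close>

lemma lsc_fun_le_Liminf:
  assumes "lsc_fun F" "(X \<longlongrightarrow> x) N"
  shows "F x \<le> Liminf N (\<lambda>i. F (X i))"
  unfolding le_Liminf_iff
proof (intro allI impI)
  fix y assume y: "y < F x"
  have "\<forall>\<^sub>F z in at x. y < F z"
    using assms(1) y by (auto simp: lsc_fun_def le_Liminf_iff)
  then have "\<forall>\<^sub>F z in nhds x. y < F z"
    using y by (auto simp: eventually_at_filter elim!: eventually_mono)
  then show "\<forall>\<^sub>F i in N. y < F (X i)"
    using assms(2) unfolding filterlim_iff by blast
qed

text \<open>
  The direct method of the calculus of variations: a minimising sequence eventually stays in one
  sublevel set and so has a convergent subsequence.
\<close>

lemma attains_min_if_bounded_sublevels:
  fixes f :: "'a::heine_borel \<Rightarrow> ereal"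
  assumes "closed C" "C \<noteq> {}"
    and lsc: "\<And>X x. (\<And>n::nat. X n \<in> C) \<Longrightarrow> X \<longlonglongrightarrow> x \<Longrightarrow> f x \<le> liminf (\<lambda>n. f (X n))"
    and bdd: "\<And>r::real. bounded {x\<in>C. f x \<le> ereal r}"
  shows "\<exists>x\<in>C. \<forall>y\<in>C. f x \<le> f y"
proof -
  obtain u where u: "\<And>n::nat. u n \<in> f ` C" "u \<longlonglongrightarrow> Inf (f ` C)"
    using Inf_as_limit[of "f ` C"] assms(2) by auto
  have "\<forall>n. \<exists>x. x \<in> C \<and> u n = f x" using u(1) by blast
  then obtain X where X: "\<And>n. X n \<in> C" "\<And>n. u n = f (X n)"
    by (auto dest!: choice)
  show ?thesis
  proof (cases "Inf (f ` C) = \<infinity>")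
    case True
    then have "f y = \<infinity>" if "y \<in> C" for y using INF_lower[OF that, of f] by simp
    then show ?thesis using assms(2) by auto
  next
    case False
    then obtain r :: real where r: "Inf (f ` C) < ereal r"
      using ereal_dense2[of "Inf (f ` C)" \<infinity>] by auto
    then have "\<forall>\<^sub>F n in sequentially. u n < ereal r"
      using u(2) by (simp add: order_tendstoD(2))
    then obtain M where M: "\<And>n. n \<ge> M \<Longrightarrow> u n < ereal r" by (auto simp: eventually_sequentially)
    define Y where "Y n = X (n + M)" for n
    have "Y n \<in> {x\<in>C. f x \<le> ereal r}" for n
      using X(1) X(2)[of "n + M"] M[of "n + M"] by (simp add: Y_def less_imp_le)
    then have "range Y \<subseteq> {x\<in>C. f x \<le> ereal r}" by (rule image_subsetI)
    with bdd[of r] have "bounded (range Y)" by (rule bounded_subset)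
    then obtain x s where s: "strict_mono (s :: nat \<Rightarrow> nat)" "(Y \<circ> s) \<longlonglongrightarrow> x"
      using bounded_imp_convergent_subsequence by blast
    have Ys: "(Y \<circ> s) n \<in> C" for n using X(1) by (simp add: Y_def)
    have x: "x \<in> C" using closed_sequentially[OF assms(1) _ s(2)] Ys by blast
    have "(\<lambda>n. u (n + M)) \<longlonglongrightarrow> Inf (f ` C)" using u(2) by (rule LIMSEQ_ignore_initial_segment)
    then have "((\<lambda>n. u (n + M)) \<circ> s) \<longlonglongrightarrow> Inf (f ` C)" using s(1) by (rule LIMSEQ_subseq_LIMSEQ)
    then have "(\<lambda>n. f ((Y \<circ> s) n)) \<longlonglongrightarrow> Inf (f ` C)" by (simp add: o_def Y_def X(2))
    then have "liminf (\<lambda>n. f ((Y \<circ> s) n)) = Inf (f ` C)" by (simp add: lim_imp_Liminf)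
    then have "f x \<le> Inf (f ` C)" using lsc[OF Ys s(2)] by simp
    then show ?thesis using x by (meson INF_lower order_trans)
  qed
qed

lemma coercive_lsc_bounded_below:
  fixes F :: "'a::euclidean_space \<Rightarrow> ereal"
  assumes "proper_fun F" "coercive_fun F" "lsc_fun F"
  shows "\<exists>m::real. \<forall>x. ereal m \<le> F x"
proof -
  have "\<exists>x\<in>UNIV. \<forall>y\<in>UNIV. F x \<le> F y"
  proof (rule attains_min_if_bounded_sublevels)
    show "F x \<le> liminf (\<lambda>n. F (X n))" if "X \<longlonglongrightarrow> x" for X :: "nat \<Rightarrow> 'a" and x
      using lsc_fun_le_Liminf[OF assms(3) that] .
    fix r :: real
    have "\<forall>\<^sub>F x in at_infinity. ereal r < F x"
      using assms(2) by (simp add: coercive_fun_def order_tendstoD(1))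
    then obtain b where b: "\<And>x. b \<le> norm x \<Longrightarrow> ereal r < F x"
      by (auto simp: eventually_at_infinity)
    show "bounded {x \<in> UNIV. F x \<le> ereal r}"
    proof (rule boundedI[of _ b])
      fix x assume "x \<in> {x \<in> UNIV. F x \<le> ereal r}"
      then have "\<not> b \<le> norm x" using b[of x] by (auto simp: not_less)
      then show "norm x \<le> b" by simp
    qed
  qed auto
  then obtain x where x: "\<And>y. F x \<le> F y" by blast
  moreover have "F x \<noteq> -\<infinity>" using assms(1) by (simp add: proper_fun_def)
  moreover have "F x \<noteq> -\<infinity> \<Longrightarrow> \<exists>m. ereal m \<le> F x" by (cases "F x") auto
  ultimately show ?thesis by (meson order_trans)
qed

text \<open>
  A continuous function that vanishes at infinity extends by \<open>0\<close> to the one-point compactification;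
  the set below is the image of that compact space.
\<close>

lemma compact_vanishing_image:
  fixes f :: "'a::topological_space \<Rightarrow> 'b::real_normed_vector"
  assumes f: "continuous_on UNIV f"
    and van: "\<And>\<epsilon>. \<epsilon> > 0 \<Longrightarrow> \<exists>K. compact K \<and> (\<forall>x. x \<notin> K \<longrightarrow> norm (f x) < \<epsilon>)"
  shows "compact (insert 0 (range f))"
proof (rule compactI)
  fix \<U> :: "'b set set"
  assume op: "\<forall>U\<in>\<U>. open U" and cov: "insert 0 (range f) \<subseteq> \<Union>\<U>"
  obtain U0 where U0: "U0 \<in> \<U>" "0 \<in> U0" using cov by auto
  then obtain \<epsilon> where \<epsilon>: "\<epsilon> > 0" "ball 0 \<epsilon> \<subseteq> U0" using op by (meson openE)
  obtain K where K: "compact K" "\<And>x. x \<notin> K \<Longrightarrow> norm (f x) < \<epsilon>" using van[OF \<epsilon>(1)] by blast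
  have "compact (f ` K)" using K(1) f by (intro compact_continuous_image) (auto intro: continuous_on_subset)
  moreover have "f ` K \<subseteq> \<Union>\<U>" using cov by auto
  ultimately obtain \<V> where V: "\<V> \<subseteq> \<U>" "finite \<V>" "f ` K \<subseteq> \<Union>\<V>"
    using compactE[of "f ` K" \<U>] op by metis
  have "f x \<in> \<Union>(insert U0 \<V>)" for x
  proof (cases "x \<in> K")
    case False
    then have "f x \<in> ball 0 \<epsilon>" using K(2) by simp
    then show ?thesis using \<epsilon>(2) by auto
  qed (use V in auto)
  then have "insert 0 (range f) \<subseteq> \<Union>(insert U0 \<V>)" using U0 by auto
  then show "\<exists>\<V>\<subseteq>\<U>. finite \<V> \<and> insert 0 (range f) \<subseteq> \<Union>\<V>"
    using V U0 by (intro exI[of _ "insert U0 \<V>"]) auto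
qed

section \<open>Properness of locally compact geodesic spaces\<close>

text \<open>
  The Hopf-Rinow theorem. Let \<open>R\<close> be the supremum of the radii with compact ball, supposed finite.
  Geodesics reach every point of a ball from a slightly smaller concentric ball. Therefore the ball
  of radius \<open>R\<close> is totally bounded, hence compact, and covering it by finitely many compact balls
  shows that a slightly larger ball is compact too.
\<close>

lemma compact_cball_geodesic:
  fixes e :: "'z::complete_space"
  assumes lc: "locally_compact_space (euclidean :: 'z topology)"
    and geo: "geodesic_on (UNIV :: 'z set)"
  shows "compact (cball e r)"
proof (rule ccontr)
  have between: "\<exists>x. dist e x \<le> s \<and> dist x y \<le> \<epsilon>"
    if "dist e y \<le> s + \<epsilon>" "0 \<le> s" "0 \<le> \<epsilon>" for y s \<epsilon>
  proof (cases "dist e y \<le> s")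
    case True
    then show ?thesis using that by (intro exI[of _ y]) simp
  next
    case False
    obtain \<gamma> where \<gamma>: "\<gamma> 0 = e" "\<gamma> (dist e y) = y"
      "\<And>a b. a \<in> {0..dist e y} \<Longrightarrow> b \<in> {0..dist e y} \<Longrightarrow> dist (\<gamma> a) (\<gamma> b) = \<bar>a - b\<bar>"
      using geo by (fastforce simp: geodesic_on_def)
    have "dist e (\<gamma> s) \<le> s" "dist (\<gamma> s) y \<le> \<epsilon>"
      using \<gamma>(3)[of 0 s] \<gamma>(3)[of s "dist e y"] \<gamma>(1,2) False that by auto
    then show ?thesis by blast
  qed
  have compact_sub: "compact (cball x s)" if "compact T" "cball x s \<subseteq> T" for x :: 'z and s T
    using compact_Int_closed[OF that(1), of "cball x s"] that(2) by (simp add: Int_absorb1)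
  have loc: "\<exists>\<delta>>0. compact (cball x \<delta>)" for x :: 'z
  proof -
    have "\<exists>U K. open U \<and> compact K \<and> x \<in> U \<and> U \<subseteq> K"
      using lc by (simp add: locally_compact_space_def)
    then obtain U K where "open U" "compact K" "x \<in> U" "U \<subseteq> K" by blast
    then obtain \<delta> where "\<delta> > 0" "cball x \<delta> \<subseteq> K"
      by (meson open_contains_cball order_trans)
    then show ?thesis using \<open>compact K\<close> compact_sub by blast
  qed
  assume ncr: "\<not> compact (cball e r)"
  define I where "I = {s. 0 \<le> s \<and> compact (cball e s)}"
  have down: "compact (cball e s)" if "compact (cball e t)" "s \<le> t" for s t
    using compact_sub[OF that(1)] that(2) by (simp add: subset_cball)
  have I0: "0 \<in> I" by (simp add: I_def)
  have Ir: "s \<le> r" if "s \<in> I" for s using that ncr down[of s r] by (cases "s \<le> r") (auto simp: I_def)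
  then have bdd: "bdd_above I" by (auto simp: bdd_above_def)
  define R where "R = Sup I"
  have R0: "0 \<le> R" unfolding R_def using I0 bdd by (rule cSup_upper)
  have below: "compact (cball e s)" if sR: "s < R" for s
  proof -
    obtain t where "t \<in> I" "s < t" using less_cSupE[OF sR[unfolded R_def]] I0 by blast
    then show ?thesis using down by (auto simp: I_def)
  qed
  have cR: "compact (cball e R)"
    unfolding compact_eq_totally_bounded
  proof (intro conjI allI impI)
    show "complete (cball e R)" by (simp add: complete_eq_closed)
    fix \<epsilon> :: real assume "\<epsilon> > 0"
    show "\<exists>k. finite k \<and> cball e R \<subseteq> (\<Union>x\<in>k. ball x \<epsilon>)"
    proof (cases "R \<le> \<epsilon> / 2")
      case True
      then have "cball e R \<subseteq> ball e \<epsilon>" using \<open>\<epsilon> > 0\<close> by auto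
      then show ?thesis by (intro exI[of _ "{e}"]) auto
    next
      case False
      have "compact (cball e (R - \<epsilon> / 2))" using \<open>\<epsilon> > 0\<close> by (intro below) simp
      then obtain k where k: "finite k" "cball e (R - \<epsilon> / 2) \<subseteq> (\<Union>x\<in>k. ball x (\<epsilon> / 2))"
        using \<open>\<epsilon> > 0\<close> unfolding compact_eq_totally_bounded by (meson half_gt_zero)
      have "y \<in> (\<Union>x\<in>k. ball x \<epsilon>)" if y: "y \<in> cball e R" for y
      proof -
        obtain x where x: "dist e x \<le> R - \<epsilon> / 2" "dist x y \<le> \<epsilon> / 2"
          using between[of y "R - \<epsilon> / 2" "\<epsilon> / 2"] y False \<open>\<epsilon> > 0\<close> by auto
        then obtain a where "a \<in> k" "dist a x < \<epsilon> / 2" using k(2) by auto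
        then show ?thesis using x(2) dist_triangle[of a y x] by (intro UN_I[of a]) auto
      qed
      then show ?thesis using k(1) by blast
    qed
  qed
  obtain \<delta> :: "'z \<Rightarrow> real" where \<delta>: "\<And>x. \<delta> x > 0" "\<And>x. compact (cball x (\<delta> x))"
    using loc by metis
  have cov: "cball e R \<subseteq> (\<Union>x\<in>cball e R. ball x (\<delta> x / 2))"
    using \<delta>(1) by (auto intro!: bexI)
  obtain D where D: "D \<subseteq> cball e R" "finite D" "cball e R \<subseteq> (\<Union>x\<in>D. ball x (\<delta> x / 2))"
    by (rule compactE_image[OF cR _ cov]) auto
  have "D \<noteq> {}" using D(3) R0 by auto
  define \<eta> where "\<eta> = Min (\<delta> ` D) / 2"
  have \<eta>: "\<eta> > 0" "\<And>x. x \<in> D \<Longrightarrow> \<eta> \<le> \<delta> x / 2"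
    using D(2) \<open>D \<noteq> {}\<close> \<delta> by (auto simp: \<eta>_def)
  have "cball e (R + \<eta>) \<subseteq> (\<Union>x\<in>D. cball x (\<delta> x))"
  proof
    fix y assume "y \<in> cball e (R + \<eta>)"
    then obtain x where x: "dist e x \<le> R" "dist x y \<le> \<eta>"
      using between[of y R \<eta>] R0 \<eta>(1) by auto
    then obtain a where a: "a \<in> D" "dist a x < \<delta> a / 2" using D(3) by auto
    then show "y \<in> (\<Union>x\<in>D. cball x (\<delta> x))"
      using x(2) \<eta>(2)[OF a(1)] dist_triangle[of a y x] by (intro UN_I[OF a(1)]) auto
  qed
  moreover have "compact (\<Union>x\<in>D. cball x (\<delta> x))" using D(2) \<delta> by (intro compact_UN) auto
  ultimately have "compact (cball e (R + \<eta>))"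
    using compact_sub by blast
  then have "R + \<eta> \<in> I" using R0 \<eta>(1) by (simp add: I_def)
  then have "R + \<eta> \<le> R" unfolding R_def using bdd by (rule cSup_upper)
  then show False using \<eta>(1) by simp
qed

section \<open>Integration with respect to signed measures\<close>

lemma borel_measurable_total_variation:
  "(f :: 'a::topological_space \<Rightarrow> 'b::topological_space) \<in> borel_measurable borel \<Longrightarrow> f \<in> borel_measurable (total_variation \<mu>)"
  using measurable_cong_sets[OF sets_total_variation refl] by blast

lemma sintegral_add:
  assumes "integrable (total_variation \<mu>) f" "integrable (total_variation \<mu>) g"
  shows "sintegral \<mu> (\<lambda>z. f z + g z) = sintegral \<mu> f + sintegral \<mu> g"
  using integrable_parts[OF assms(1)] integrable_parts[OF assms(2)] by (simp add: sintegral_def)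

lemma sintegral_diff:
  assumes "integrable (total_variation \<mu>) f" "integrable (total_variation \<mu>) g"
  shows "sintegral \<mu> (\<lambda>z. f z - g z) = sintegral \<mu> f - sintegral \<mu> g"
  using integrable_parts[OF assms(1)] integrable_parts[OF assms(2)] by (simp add: sintegral_def)

lemma sintegral_cmult: "sintegral \<mu> (\<lambda>z. c * f z) = c * sintegral \<mu> f"
  by (simp add: sintegral_def right_diff_distrib)

lemma sintegral_sum:
  assumes "\<And>i. i \<in> I \<Longrightarrow> integrable (total_variation \<mu>) (f i)"
  shows "sintegral \<mu> (\<lambda>z. \<Sum>i\<in>I. f i z) = (\<Sum>i\<in>I. sintegral \<mu> (f i))"
  using integrable_parts[OF assms] by (simp add: sintegral_def sum_subtractf)

lemma sintegral_indicator:
  assumes "A \<in> sets borel"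
  shows "sintegral \<mu> (indicator A) = smeas \<mu> A"
  using assms measure_pos_diff_neg[of \<mu> A] by (simp add: sintegral_def)

lemma abs_sintegral_le:
  assumes g: "integrable (total_variation \<mu>) g" and b: "integrable (total_variation \<mu>) b"
    and le: "\<And>z. \<bar>g z\<bar> \<le> b z"
  shows "\<bar>sintegral \<mu> g\<bar> \<le> (\<integral>z. b z \<partial>total_variation \<mu>)"
proof -
  note ig = integrable_parts[OF g] and ib = integrable_parts[OF b]
  have b0: "0 \<le> b z" for z using le[of z] by linarith
  have m: "b \<in> borel_measurable borel" using b by (rule borel_measurable_integrable_tv)
  have "ennreal (\<integral>z. b z \<partial>total_variation \<mu>) = (\<integral>\<^sup>+z. ennreal (b z) \<partial>total_variation \<mu>)"
    using b b0 by (simp add: nn_integral_eq_integral)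
  also have "\<dots> = (\<integral>\<^sup>+z. ennreal (b z) \<partial>pos_part \<mu>) + (\<integral>\<^sup>+z. ennreal (b z) \<partial>neg_part \<mu>)"
    using m by (intro nn_integral_total_variation) simp
  also have "\<dots> = ennreal ((\<integral>z. b z \<partial>pos_part \<mu>) + (\<integral>z. b z \<partial>neg_part \<mu>))"
    using ib b0 by (simp add: nn_integral_eq_integral)
  finally have eq: "(\<integral>z. b z \<partial>total_variation \<mu>) = (\<integral>z. b z \<partial>pos_part \<mu>) + (\<integral>z. b z \<partial>neg_part \<mu>)"
    using b0 by (subst (asm) ennreal_inj) (auto intro!: add_nonneg_nonneg)
  have bound: "\<bar>\<integral>z. g z \<partial>M\<bar> \<le> (\<integral>z. b z \<partial>M)" if "integrable M g" "integrable M b" for M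
  proof -
    have "\<bar>\<integral>z. g z \<partial>M\<bar> \<le> (\<integral>z. \<bar>g z\<bar> \<partial>M)" by (rule integral_abs_bound)
    also have "\<dots> \<le> (\<integral>z. b z \<partial>M)" using that le by (intro integral_mono) auto
    finally show ?thesis .
  qed
  show ?thesis
    using bound[OF ig(1) ib(1)] bound[OF ig(2) ib(2)] by (simp add: sintegral_def eq)
qed

text \<open>
  At most one member of a partition contains \<open>z\<close>, so the variation of the Dirac measure is at most
  \<open>1\<close> on the sets that contain \<open>z\<close> and vanishes on the others.
\<close>

lemma nn_integral_total_variation_dirac_le:
  assumes "f \<in> borel_measurable borel"
  shows "(\<integral>\<^sup>+x. f x \<partial>total_variation (dirac z)) \<le> f z"
proof -
  have "emeasure (total_variation (dirac z)) A \<le> emeasure (return borel z) A" if A: "A \<in> sets borel" for A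
  proof (cases "z \<in> A")
    case True
    have "(\<Sum>B\<in>P. ennreal \<bar>smeas (dirac z) B\<bar>) \<le> 1"
      if P: "finite P" "P \<subseteq> sets borel" "disjoint P" for P
    proof -
      have "(\<Sum>B\<in>P. ennreal \<bar>smeas (dirac z) B\<bar>) = (\<Sum>B\<in>P. if z \<in> B then 1 else 0)"
        using P by (intro sum.cong) (auto simp: smeas_dirac)
      also have "\<dots> = of_nat (card {B\<in>P. z \<in> B})"
        using P(1) by (simp add: sum.If_cases Int_def)
      also have "\<dots> \<le> of_nat 1"
      proof -
        have "\<forall>B\<in>{B\<in>P. z \<in> B}. \<forall>B'\<in>{B\<in>P. z \<in> B}. B = B'"
          using P(3) by (auto simp: disjoint_def)
        then have "card {B\<in>P. z \<in> B} \<le> 1"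
          using P(1) card_le_Suc0_iff_eq[of "{B\<in>P. z \<in> B}"] by simp
        then show ?thesis by (rule of_nat_mono)
      qed
      finally show ?thesis by simp
    qed
    then have "variation (dirac z) A \<le> 1" unfolding variation_def by (intro SUP_least) auto
    then show ?thesis using True A by (simp add: emeasure_total_variation)
  next
    case False
    have "(\<Sum>B\<in>P. ennreal \<bar>smeas (dirac z) B\<bar>) \<le> 0" if "\<Union>P = A" for P
      using that False by (intro sum_nonpos) (auto simp: smeas_dirac)
    then have "variation (dirac z) A \<le> 0" unfolding variation_def by (intro SUP_least) auto
    then show ?thesis using False A by (simp add: emeasure_total_variation)
  qed
  then have "(\<Sum>i\<in>{()}. ennreal 1 * (\<integral>\<^sup>+x. f x \<partial>total_variation (dirac z)))
      \<le> (\<Sum>i\<in>{()}. ennreal 1 * (\<integral>\<^sup>+x. f x \<partial>return borel z))"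
    using assms by (intro nn_integral_combination_le) auto
  then show ?thesis using assms by (simp add: nn_integral_return)
qed

lemma integrable_total_variation_dirac:
  fixes f :: "'a::topological_space \<Rightarrow> real"
  assumes f: "f \<in> borel_measurable borel"
  shows "integrable (total_variation (dirac z)) f"
proof -
  have "(\<integral>\<^sup>+x. ennreal (norm (f x)) \<partial>total_variation (dirac z)) \<le> ennreal (norm (f z))"
    using f by (intro nn_integral_total_variation_dirac_le) simp
  also have "\<dots> < \<infinity>" by simp
  finally show ?thesis using f by (simp add: integrable_total_variation_iff)
qed

lemma sintegral_dirac:
  fixes f :: "'a::topological_space \<Rightarrow> real"
  assumes f: "f \<in> borel_measurable borel"
  shows "sintegral (dirac z) f = f z"
proof -
  define M where "M i = (if i = (0::nat) then pos_part (dirac z) else if i = 1 then neg_part (dirac z) else return borel z)" for i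
  define c :: "nat \<Rightarrow> real" where "c i = (if i = 0 then 1 else -1)" for i
  have "(\<Sum>i\<in>{0,1,2}. c i * (\<integral>x. f x \<partial>M i)) = 0"
  proof (rule integral_combination_eq_0)
    show "sets (M i) = sets borel" "finite_measure (M i)" for i
      by (auto simp: M_def intro: finite_measureI)
    show "(\<Sum>i\<in>{0, 1, 2}. c i * measure (M i) A) = 0" if "A \<in> sets borel" for A
      using that measure_pos_diff_neg[of "dirac z" A]
      by (simp add: M_def c_def smeas_dirac measure_return indicator_def algebra_simps split: if_splits)
    show "integrable (M i) f" for i
      using integrable_parts[OF integrable_total_variation_dirac[OF f]] f
      by (simp add: M_def integrable_iff_bounded nn_integral_return)
  qed (use f in auto)
  then show ?thesis using f by (simp add: M_def c_def sintegral_def integral_return)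
qed

definition weight :: "real \<Rightarrow> 'a::pointed_metric_space \<Rightarrow> real" where
  "weight p z = 1 + dist z base_point powr p"

lemma weight_ge_1: "1 \<le> weight p z"
  by (simp add: weight_def)

lemma weight_measurable [measurable]: "weight p \<in> borel_measurable borel"
  unfolding weight_def by measurable

lemma moment_measures_iff_weight:
  fixes \<mu> :: "'a::pointed_metric_space signed_measure"
  shows "\<mu> \<in> moment_measures p \<longleftrightarrow> integrable (total_variation \<mu>) (weight p)"
proof -
  interpret finite_measure "total_variation \<mu>" by simp
  have "(\<lambda>z::'a. dist z base_point powr p) \<in> borel_measurable borel" by measurable
  then have "\<mu> \<in> moment_measures p \<longleftrightarrow> integrable (total_variation \<mu>) (\<lambda>z. dist z base_point powr p)"
    by (simp add: moment_measures_def integrable_total_variation_iff)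
  also have "\<dots> \<longleftrightarrow> integrable (total_variation \<mu>) (\<lambda>z. 1 + dist z base_point powr p)"
  proof
    assume "integrable (total_variation \<mu>) (\<lambda>z. 1 + dist z base_point powr p)"
    then have "integrable (total_variation \<mu>) (\<lambda>z. (1 + dist z base_point powr p) - 1)"
      by (rule Bochner_Integration.integrable_diff) simp
    then show "integrable (total_variation \<mu>) (\<lambda>z. dist z base_point powr p)" by simp
  qed simp
  finally show ?thesis by (simp add: weight_def[abs_def])
qed

lemma dirac_in_moment_measures: "dirac z \<in> moment_measures p"
  unfolding moment_measures_iff_weight by (rule integrable_total_variation_dirac) measurable

lemma add_in_moment_measures:
  "\<mu> \<in> moment_measures p \<Longrightarrow> \<nu> \<in> moment_measures p \<Longrightarrow> \<mu> + \<nu> \<in> moment_measures p"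
  by (simp add: moment_measures_iff_weight integrable_total_variation_add)

lemma scaleR_in_moment_measures: "\<mu> \<in> moment_measures p \<Longrightarrow> c *\<^sub>R \<mu> \<in> moment_measures p"
  by (simp add: moment_measures_iff_weight integrable_total_variation_scaleR)

lemma subspace_moment_measures: "subspace (moment_measures p :: 'a::pointed_metric_space signed_measure set)"
proof (rule subspaceI)
  show "0 \<in> (moment_measures p :: 'a signed_measure set)"
    using scaleR_in_moment_measures[OF dirac_in_moment_measures, of 0] by simp
qed (auto intro: add_in_moment_measures scaleR_in_moment_measures)

lemma KRu_of_sum_scaleR:
  assumes "finite I" "\<And>i. i \<in> I \<Longrightarrow> \<mu> i \<in> moment_measures 1"
  shows "KRu_of (\<Sum>i\<in>I. c i *\<^sub>R \<mu> i) = (\<Sum>i\<in>I. c i *\<^sub>R KRu_of (\<mu> i))"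
  using assms
proof (induction I rule: finite_induct)
  case empty
  show ?case using KRu_of_scaleR[OF moment_measures_zero, of 0] by simp
next
  case (insert j I)
  have "(\<Sum>i\<in>I. c i *\<^sub>R \<mu> i) \<in> moment_measures 1"
    using insert.prems by (intro subspace_sum[OF subspace_moment_measures] subspace_scale[OF subspace_moment_measures]) auto
  moreover have "c j *\<^sub>R \<mu> j \<in> moment_measures 1" using insert.prems by (auto intro: moment_measures_scaleR)
  ultimately show ?case using insert by (simp add: KRu_of_add KRu_of_scaleR)
qed

lemma sintegral_sum_dirac:
  fixes f :: "'a::topological_space \<Rightarrow> real"
  assumes "finite I" and f: "f \<in> borel_measurable borel"
  shows "integrable (total_variation (\<Sum>i\<in>I. c i *\<^sub>R dirac (z i))) f"
    and "sintegral (\<Sum>i\<in>I. c i *\<^sub>R dirac (z i)) f = (\<Sum>i\<in>I. c i * f (z i))"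
proof -
  have "integrable (total_variation (\<Sum>i\<in>I. c i *\<^sub>R dirac (z i))) f \<and>
    sintegral (\<Sum>i\<in>I. c i *\<^sub>R dirac (z i)) f = (\<Sum>i\<in>I. c i * f (z i))"
    using assms(1)
  proof (induction I rule: finite_induct)
    case empty
    have "0 = (0::real) *\<^sub>R dirac (z undefined)" by simp
    then show ?case
      using integrable_total_variation_scaleR[OF integrable_total_variation_dirac[OF f, of "z undefined"], of 0]
        sintegral_scaleR_measure[OF integrable_total_variation_dirac[OF f, of "z undefined"], of 0] by simp
  next
    case (insert j I)
    note d = integrable_total_variation_dirac[OF f, of "z j"]
    note dj = integrable_total_variation_scaleR[OF d, of "c j"]
    show ?case
      using insert integrable_total_variation_add[OF dj] sintegral_add_measure[OF dj]
        sintegral_scaleR_measure[OF d] sintegral_dirac[OF f] by simp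
  qed
  then show "integrable (total_variation (\<Sum>i\<in>I. c i *\<^sub>R dirac (z i))) f"
    "sintegral (\<Sum>i\<in>I. c i *\<^sub>R dirac (z i)) f = (\<Sum>i\<in>I. c i * f (z i))" by auto
qed

section \<open>Continuous functionals on KRu\<close>

lemma KRu_norm_le:
  assumes "\<And>h. h \<in> unit_lip \<Longrightarrow> sintegral \<mu> h \<le> C"
  shows "KRu_norm \<mu> \<le> \<bar>smeas \<mu> UNIV\<bar> + C"
  unfolding KRu_norm_def by (intro add_left_mono cSUP_least unit_lip_ne assms)

lemma unit_lip_bounds:
  assumes "h \<in> unit_lip"
  shows "\<bar>h x - h y\<bar> \<le> dist x y" "\<bar>h x\<bar> \<le> dist x base_point" "h \<in> borel_measurable borel"
proof -
  have h: "h base_point = 0" "1-lipschitz_on UNIV h" using assms unfolding unit_lip_iff by simp_all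
  show xy: "\<bar>h x - h y\<bar> \<le> dist x y" for x y
    using lipschitz_onD[OF h(2), of x y] by (simp add: dist_real_def)
  show "\<bar>h x\<bar> \<le> dist x base_point" using xy[of x base_point] h(1) by simp
  show "h \<in> borel_measurable borel"
    using lipschitz_on_continuous_on[OF h(2)] by (rule borel_measurable_continuous_onI)
qed

lemma KRu_of_diff:
  assumes "\<mu> \<in> moment_measures 1" "\<nu> \<in> moment_measures 1"
  shows "KRu_of (\<mu> - \<nu>) = KRu_of \<mu> - KRu_of \<nu>"
  using KRu_of_add[OF assms(1) moment_measures_scaleR[OF assms(2), of "-1"]]
    KRu_of_scaleR[OF assms(2), of "-1"] by simp

lemma dipole_in_moment_measures: "dirac z - dirac w \<in> moment_measures p"
  by (intro subspace_diff[OF subspace_moment_measures] dirac_in_moment_measures)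

lemma sintegral_dipole:
  assumes "f \<in> borel_measurable borel"
  shows "sintegral (dirac z - dirac w) f = f z - f w"
proof -
  note d = integrable_total_variation_dirac[OF assms]
  have "sintegral (dirac z + (-1) *\<^sub>R dirac w) f = f z + (-1) * f w"
    using sintegral_add_measure[OF d integrable_total_variation_scaleR[OF d]]
      sintegral_scaleR_measure[OF d] sintegral_dirac[OF assms] by metis
  then show ?thesis by simp
qed

lemma KRu_norm_dipole_le: "KRu_norm (dirac z - dirac w) \<le> dist z w"
proof -
  have "KRu_norm (dirac z - dirac w) \<le> \<bar>smeas (dirac z - dirac w) UNIV\<bar> + dist z w"
  proof (rule KRu_norm_le)
    fix h :: "'a \<Rightarrow> real" assume h: "h \<in> unit_lip"
    show "sintegral (dirac z - dirac w) h \<le> dist z w"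
      using unit_lip_bounds(1)[OF h, of z w] unit_lip_bounds(3)[OF h] by (simp add: sintegral_dipole)
  qed
  then show ?thesis by (simp add: smeas_dirac)
qed

lemma KRu_norm_dirac_le: "KRu_norm (dirac z) \<le> 1 + dist z base_point"
proof -
  have "KRu_norm (dirac z) \<le> \<bar>smeas (dirac z) UNIV\<bar> + dist z base_point"
  proof (rule KRu_norm_le)
    fix h :: "'a \<Rightarrow> real" assume h: "h \<in> unit_lip"
    show "sintegral (dirac z) h \<le> dist z base_point"
      using unit_lip_bounds(2)[OF h, of z] unit_lip_bounds(3)[OF h] by (simp add: sintegral_dirac)
  qed
  then show ?thesis by (simp add: smeas_dirac)
qed

lemma norm_KRu_of_dirac_diff_le: "norm (KRu_of (dirac z) - KRu_of (dirac w)) \<le> dist z w"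
  using KRu_norm_dipole_le[of z w] norm_KRu_of[OF dipole_in_moment_measures, of z w]
  by (simp add: KRu_of_diff dirac_in_moment_measures)

lemma norm_KRu_of_dirac_le: "norm (KRu_of (dirac z)) \<le> 1 + dist z base_point"
  using KRu_norm_dirac_le[of z] by (simp add: norm_KRu_of dirac_in_moment_measures)

lemma lipschitz_KRu_of_dirac: "1-lipschitz_on UNIV (\<lambda>z. KRu_of (dirac z))"
  by (rule lipschitz_onI) (simp_all add: dist_norm norm_KRu_of_dirac_diff_le)

lemma lipschitz_bounded_linear_dirac:
  assumes "bounded_linear L"
  shows "\<exists>K. K-lipschitz_on UNIV (\<lambda>z. L (KRu_of (dirac z)))"
proof -
  obtain K where K: "K-lipschitz_on (range (\<lambda>z. KRu_of (dirac z))) L"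
    by (rule bounded_linear.lipschitz_boundE[OF assms])
  have "(K * 1)-lipschitz_on UNIV (\<lambda>z. L (KRu_of (dirac z)))"
    using lipschitz_on_compose2[OF lipschitz_KRu_of_dirac K] .
  then show ?thesis by blast
qed

text \<open>
  Both sides are continuous along approximations of \<open>\<mu>\<close> by finitely supported measures, for which
  they agree by linearity. The approximations are the images of \<open>\<mu>\<close> under simple maps \<open>T i\<close> that
  converge pointwise to the identity: moving mass along \<open>T i\<close> costs at most
  \<open>\<integral> d(z, T i z) d\<bar>\<mu>\<bar>\<close>, which tends to \<open>0\<close> by dominated convergence.
\<close>

lemma bounded_linear_KRu_eq_sintegral:
  fixes L :: "'z::{pointed_metric_space, second_countable_topology} KRu \<Rightarrow> real"
  assumes L: "bounded_linear L" and \<mu>: "\<mu> \<in> moment_measures 1"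
  shows "L (KRu_of \<mu>) = sintegral \<mu> (\<lambda>z. L (KRu_of (dirac z)))"
proof -
  define f where "f z = L (KRu_of (dirac z))" for z
  obtain K where fl: "K-lipschitz_on UNIV f"
    unfolding f_def using lipschitz_bounded_linear_dirac[OF L] by blast
  have flip: "\<bar>f x - f y\<bar> \<le> K * dist x y" for x y
    using lipschitz_onD[OF fl, of x y] by (simp add: dist_real_def)
  have fm: "f \<in> borel_measurable borel"
    using lipschitz_on_continuous_on[OF fl] by (rule borel_measurable_continuous_onI)
  have "\<exists>T. (\<forall>i. simple_function borel (T i)) \<and> (\<forall>x\<in>space borel. (\<lambda>i. T i x) \<longlonglongrightarrow> x) \<and>
    (\<forall>i. \<forall>x\<in>space borel. dist (T i x) (base_point::'z) \<le> 2 * dist x base_point)"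
    by (rule borel_measurable_implies_sequence_metric) simp
  then obtain T where T: "\<And>i. simple_function borel (T i)" "\<And>x. (\<lambda>i. T i x) \<longlonglongrightarrow> x"
    "\<And>i x. dist (T i x) (base_point::'z) \<le> 2 * dist x base_point"
    by auto
  have Tm: "T i \<in> borel_measurable borel" for i
    using T(1) by (rule borel_measurable_simple_function)
  have fin: "finite (range (T i))" for i using T(1)[of i] by (simp add: simple_function_def)
  have Tset: "T i -` {x} \<in> sets borel" for i x
    using measurable_sets[OF Tm, of "{x}" i] by simp
  \<comment> \<open>The image of \<open>\<mu>\<close> under \<open>T i\<close>.\<close>
  define \<nu> where "\<nu> i = (\<Sum>x\<in>range (T i). smeas \<mu> (T i -` {x}) *\<^sub>R dirac x)" for i
  have \<nu>1: "\<nu> i \<in> moment_measures 1" for i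
    unfolding \<nu>_def
    by (intro subspace_sum[OF subspace_moment_measures] subspace_scale[OF subspace_moment_measures] dirac_in_moment_measures)
  have \<nu>: "integrable (total_variation (\<nu> i)) h" "integrable (total_variation \<mu>) (\<lambda>z. h (T i z))"
    "sintegral (\<nu> i) h = sintegral \<mu> (\<lambda>z. h (T i z))"
    if h: "h \<in> borel_measurable borel" for i and h :: "'z \<Rightarrow> real"
  proof -
    interpret finite_measure "total_variation \<mu>" by simp
    have eq: "(\<lambda>z. h (T i z)) = (\<lambda>z. \<Sum>x\<in>range (T i). h x * indicator (T i -` {x}) z)"
    proof
      fix z
      have "(\<Sum>x\<in>range (T i). h x * indicator (T i -` {x}) z) = (\<Sum>x\<in>range (T i). if x = T i z then h x else 0)"
        by (intro sum.cong) (auto simp: indicator_def)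
      then show "h (T i z) = (\<Sum>x\<in>range (T i). h x * indicator (T i -` {x}) z)" using fin by simp
    qed
    have int: "integrable (total_variation \<mu>) (\<lambda>z. h x * indicator (T i -` {x}) z)" for x
      using Tset by (intro integrable_mult_right integrable_real_indicator) (simp_all add: less_top[symmetric])
    show "integrable (total_variation (\<nu> i)) h"
      unfolding \<nu>_def by (intro sintegral_sum_dirac fin h)
    show "integrable (total_variation \<mu>) (\<lambda>z. h (T i z))"
      unfolding eq using int by (intro Bochner_Integration.integrable_sum)
    show "sintegral (\<nu> i) h = sintegral \<mu> (\<lambda>z. h (T i z))"
      unfolding eq \<nu>_def using sintegral_sum_dirac(2)[OF fin h]
      by (simp add: sintegral_sum[OF int] sintegral_cmult sintegral_indicator[OF Tset] mult.commute)
  qed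
  define D where "D i = (\<integral>z. dist z (T i z) \<partial>total_variation \<mu>)" for i
  have dm: "(\<lambda>z. dist z (T i z)) \<in> borel_measurable borel" for i
    using Tm[of i] by measurable
  have di: "integrable (total_variation \<mu>) (\<lambda>z. 3 * dist z base_point)"
    using \<mu> by (simp add: moment_measures_one_iff)
  have dle: "dist z (T i z) \<le> 3 * dist z base_point" for i z
    using dist_triangle[of z "T i z" base_point] T(3)[of i z] by (simp add: dist_commute)
  have dint: "integrable (total_variation \<mu>) (\<lambda>z. dist z (T i z))" for i
    by (rule Bochner_Integration.integrable_bound[OF di]) (use dm borel_measurable_total_variation dle in auto)
  have D0: "D \<longlonglongrightarrow> 0"
  proof -
    have "D \<longlonglongrightarrow> (\<integral>z. 0 \<partial>total_variation \<mu>)"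
      unfolding D_def
    proof (rule integral_dominated_convergence[OF _ _ di])
      have "(\<lambda>i. dist z (T i z)) \<longlonglongrightarrow> dist z z" for z by (intro tendsto_intros T)
      then show "AE z in total_variation \<mu>. (\<lambda>i. dist z (T i z)) \<longlonglongrightarrow> 0" by simp
    qed (use dm borel_measurable_total_variation dle in auto)
    then show ?thesis by simp
  qed
  have close: "\<bar>sintegral (\<nu> i) h - sintegral \<mu> h\<bar> \<le> C * D i"
    if h: "h \<in> borel_measurable borel" "integrable (total_variation \<mu>) h"
      and C: "\<And>x y. \<bar>h x - h y\<bar> \<le> C * dist x y" for h C i
  proof -
    have "sintegral (\<nu> i) h - sintegral \<mu> h = sintegral \<mu> (\<lambda>z. h (T i z) - h z)"
      using \<nu>[OF h(1)] h(2) by (simp add: sintegral_diff)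
    also have "\<bar>\<dots>\<bar> \<le> (\<integral>z. C * dist z (T i z) \<partial>total_variation \<mu>)"
    proof (rule abs_sintegral_le)
      show "\<bar>h (T i z) - h z\<bar> \<le> C * dist z (T i z)" for z
        using C[of "T i z" z] by (simp add: dist_commute)
    qed (use \<nu>(2)[OF h(1)] h(2) dint in auto)
    finally show ?thesis by (simp add: D_def)
  qed
  have mass: "smeas (\<nu> i) UNIV = smeas \<mu> UNIV" for i
    using \<nu>(3)[of "\<lambda>_. 1" i] sintegral_const[of "\<nu> i" 1] sintegral_const[of \<mu> 1] by simp
  have "norm (KRu_of (\<nu> i) - KRu_of \<mu>) \<le> D i" for i
  proof -
    have m: "\<nu> i - \<mu> \<in> moment_measures 1" using \<nu>1 \<mu> by (rule subspace_diff[OF subspace_moment_measures])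
    have "KRu_norm (\<nu> i - \<mu>) \<le> \<bar>smeas (\<nu> i - \<mu>) UNIV\<bar> + D i"
    proof (rule KRu_norm_le)
      fix h :: "'z \<Rightarrow> real" assume h: "h \<in> unit_lip"
      note hi = unit_lip_integrable[OF \<mu> h] and hn = unit_lip_integrable[OF \<nu>1 h]
      have "sintegral (\<nu> i + (-1) *\<^sub>R \<mu>) h = sintegral (\<nu> i) h - sintegral \<mu> h"
        using sintegral_add_measure[OF hn[of i] integrable_total_variation_scaleR[OF hi, of "-1"]]
          sintegral_scaleR_measure[OF hi, of "-1"] by simp
      also have "\<dots> \<le> D i"
        using close[OF unit_lip_bounds(3)[OF h] hi, of 1 i] unit_lip_bounds(1)[OF h] by simp
      finally show "sintegral (\<nu> i - \<mu>) h \<le> D i" by simp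
    qed
    then show ?thesis using m \<nu>1 \<mu> mass by (simp add: norm_KRu_of flip: KRu_of_diff)
  qed
  then have "(\<lambda>i. KRu_of (\<nu> i) - KRu_of \<mu>) \<longlonglongrightarrow> 0"
    by (intro Lim_null_comparison[OF _ D0] always_eventually) auto
  then have "(\<lambda>i. KRu_of (\<nu> i)) \<longlonglongrightarrow> KRu_of \<mu>" by (simp add: LIM_zero_iff)
  then have "(\<lambda>i. L (KRu_of (\<nu> i))) \<longlonglongrightarrow> L (KRu_of \<mu>)" by (rule bounded_linear.tendsto[OF L])
  moreover have "L (KRu_of (\<nu> i)) = sintegral (\<nu> i) f" for i
    using L fin sintegral_sum_dirac(2)[OF fin fm]
    by (simp add: \<nu>_def KRu_of_sum_scaleR dirac_in_moment_measures linear_sum linear_scale bounded_linear.linear f_def)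
  moreover have "(\<lambda>i. sintegral (\<nu> i) f) \<longlonglongrightarrow> sintegral \<mu> f"
  proof -
    have "(\<lambda>i. sintegral (\<nu> i) f - sintegral \<mu> f) \<longlonglongrightarrow> 0"
    proof (rule Lim_null_comparison)
      show "(\<lambda>i. K * D i) \<longlonglongrightarrow> 0" using tendsto_mult[OF tendsto_const D0, of K] by simp
      show "\<forall>\<^sub>F i in sequentially. norm (sintegral (\<nu> i) f - sintegral \<mu> f) \<le> K * D i"
        using close[OF fm moment_measures_one_integrable[OF \<mu> fl] flip] by simp
    qed
    then show ?thesis by (simp add: LIM_zero_iff)
  qed
  ultimately show ?thesis using LIMSEQ_unique unfolding f_def by simp blast
qed

section \<open>The regularizer and its dual constraints\<close>

definition energy :: "real \<Rightarrow> real \<Rightarrow> real \<Rightarrow> 'a::pointed_metric_space signed_measure \<Rightarrow> real" where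
  "energy p \<alpha> \<beta> \<mu> = \<alpha> * KRu_norm \<mu> + \<beta> * (\<integral>z. weight p z \<partial>total_variation \<mu>)"

lemma integral_weight_le:
  assumes "integrable (total_variation \<mu>) (weight p)"
    "(\<integral>\<^sup>+z. ennreal (weight p z) \<partial>total_variation \<mu>) \<le> ennreal C" "0 \<le> C"
  shows "(\<integral>z. weight p z \<partial>total_variation \<mu>) \<le> C"
proof -
  have "0 \<le> weight p z" for z :: 'a using weight_ge_1[of p z] by linarith
  then show ?thesis using assms by (simp add: nn_integral_eq_integral)
qed

lemma nn_integral_weight:
  assumes "\<mu> \<in> moment_measures p"
  shows "(\<integral>\<^sup>+z. ennreal (weight p z) \<partial>total_variation \<mu>) = ennreal (\<integral>z. weight p z \<partial>total_variation \<mu>)"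
    and "0 \<le> (\<integral>z. weight p z \<partial>total_variation \<mu>)"
proof -
  have "0 \<le> weight p z" for z :: 'a using weight_ge_1[of p z] by linarith
  then show "(\<integral>\<^sup>+z. ennreal (weight p z) \<partial>total_variation \<mu>) = ennreal (\<integral>z. weight p z \<partial>total_variation \<mu>)"
    "0 \<le> (\<integral>z. weight p z \<partial>total_variation \<mu>)"
    using assms by (simp_all add: nn_integral_eq_integral moment_measures_iff_weight)
qed

lemma KRu_norm_nonneg: "\<mu> \<in> moment_measures 1 \<Longrightarrow> 0 \<le> KRu_norm \<mu>"
  by (metis norm_KRu_of norm_ge_zero)

lemma moment_measures_1I: "1 \<le> p \<Longrightarrow> \<mu> \<in> moment_measures p \<Longrightarrow> \<mu> \<in> moment_measures 1"
  using moment_measures_subset by blast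

lemma energy_add_le:
  assumes "p \<ge> 1" "\<alpha> \<ge> 0" "\<beta> \<ge> 0" and \<mu>: "\<mu> \<in> moment_measures p" "\<nu> \<in> moment_measures p"
  shows "energy p \<alpha> \<beta> (\<mu> + \<nu>) \<le> energy p \<alpha> \<beta> \<mu> + energy p \<alpha> \<beta> \<nu>"
proof -
  have "(\<integral>\<^sup>+z. ennreal (weight p z) \<partial>total_variation (\<mu> + \<nu>))
      \<le> (\<integral>\<^sup>+z. ennreal (weight p z) \<partial>total_variation \<mu>) + (\<integral>\<^sup>+z. ennreal (weight p z) \<partial>total_variation \<nu>)"
    by (intro nn_integral_total_variation_add_le) simp
  then have "(\<integral>z. weight p z \<partial>total_variation (\<mu> + \<nu>))
      \<le> (\<integral>z. weight p z \<partial>total_variation \<mu>) + (\<integral>z. weight p z \<partial>total_variation \<nu>)"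
    using add_in_moment_measures[OF \<mu>] nn_integral_weight[OF \<mu>(1)] nn_integral_weight[OF \<mu>(2)]
    by (intro integral_weight_le) (simp_all add: moment_measures_iff_weight)
  moreover have "KRu_norm (\<mu> + \<nu>) \<le> KRu_norm \<mu> + KRu_norm \<nu>"
    using assms by (intro KRu_norm_add_le moment_measures_1I)
  ultimately have "\<alpha> * KRu_norm (\<mu> + \<nu>) \<le> \<alpha> * (KRu_norm \<mu> + KRu_norm \<nu>)"
    "\<beta> * (\<integral>z. weight p z \<partial>total_variation (\<mu> + \<nu>))
      \<le> \<beta> * ((\<integral>z. weight p z \<partial>total_variation \<mu>) + (\<integral>z. weight p z \<partial>total_variation \<nu>))"
    using assms by (auto intro: mult_left_mono)
  then show ?thesis by (simp add: energy_def algebra_simps)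
qed

lemma energy_scaleR_le:
  assumes "p \<ge> 1" "\<alpha> \<ge> 0" "\<beta> \<ge> 0" and \<mu>: "\<mu> \<in> moment_measures p"
  shows "energy p \<alpha> \<beta> (c *\<^sub>R \<mu>) \<le> \<bar>c\<bar> * energy p \<alpha> \<beta> \<mu>"
proof -
  have "(\<integral>\<^sup>+z. ennreal (weight p z) \<partial>total_variation (c *\<^sub>R \<mu>))
      \<le> ennreal \<bar>c\<bar> * (\<integral>\<^sup>+z. ennreal (weight p z) \<partial>total_variation \<mu>)"
    by (intro nn_integral_total_variation_scaleR_le) simp
  then have "(\<integral>z. weight p z \<partial>total_variation (c *\<^sub>R \<mu>)) \<le> \<bar>c\<bar> * (\<integral>z. weight p z \<partial>total_variation \<mu>)"
    using scaleR_in_moment_measures[OF \<mu>, of c] nn_integral_weight[OF \<mu>]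
    by (intro integral_weight_le) (simp_all add: moment_measures_iff_weight ennreal_mult)
  then have "\<beta> * (\<integral>z. weight p z \<partial>total_variation (c *\<^sub>R \<mu>))
      \<le> \<beta> * (\<bar>c\<bar> * (\<integral>z. weight p z \<partial>total_variation \<mu>))"
    using assms by (intro mult_left_mono) auto
  moreover have "KRu_norm (c *\<^sub>R \<mu>) = \<bar>c\<bar> * KRu_norm \<mu>"
    using assms by (intro KRu_norm_scaleR moment_measures_1I)
  ultimately show ?thesis by (simp add: energy_def algebra_simps)
qed

lemma energy_sum_le:
  assumes "p \<ge> 1" "\<alpha> \<ge> 0" "\<beta> \<ge> 0" "finite I"
    and "\<And>i. i \<in> I \<Longrightarrow> \<mu> i \<in> moment_measures p" "\<And>i. i \<in> I \<Longrightarrow> 0 \<le> c i"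
  shows "energy p \<alpha> \<beta> (\<Sum>i\<in>I. c i *\<^sub>R \<mu> i) \<le> (\<Sum>i\<in>I. c i * energy p \<alpha> \<beta> (\<mu> i))"
  using assms(4-)
proof (induction I rule: finite_induct)
  case empty
  show ?case using energy_scaleR_le[OF assms(1-3) dirac_in_moment_measures, of 0] by simp
next
  case (insert j I)
  have "(\<Sum>i\<in>I. c i *\<^sub>R \<mu> i) \<in> moment_measures p"
    using insert.prems by (intro subspace_sum[OF subspace_moment_measures] subspace_scale[OF subspace_moment_measures]) auto
  then have "energy p \<alpha> \<beta> (c j *\<^sub>R \<mu> j + (\<Sum>i\<in>I. c i *\<^sub>R \<mu> i))
      \<le> energy p \<alpha> \<beta> (c j *\<^sub>R \<mu> j) + energy p \<alpha> \<beta> (\<Sum>i\<in>I. c i *\<^sub>R \<mu> i)"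
    using insert.prems assms(1-3) by (intro energy_add_le scaleR_in_moment_measures) auto
  also have "\<dots> \<le> c j * energy p \<alpha> \<beta> (\<mu> j) + (\<Sum>i\<in>I. c i * energy p \<alpha> \<beta> (\<mu> i))"
    using insert energy_scaleR_le[OF assms(1-3), of "\<mu> j" "c j"] by (intro add_mono) auto
  finally show ?case using insert by simp
qed

lemma integral_weight_dirac_le: "(\<integral>x. weight p x \<partial>total_variation (dirac z)) \<le> weight p z"
  using weight_ge_1[of p z] dirac_in_moment_measures[of z p]
  by (intro integral_weight_le nn_integral_total_variation_dirac_le)
     (simp_all add: moment_measures_iff_weight)

lemma energy_dirac_le:
  assumes "\<alpha> \<ge> 0" "\<beta> \<ge> 0"
  shows "energy p \<alpha> \<beta> (dirac z) \<le> \<alpha> * (1 + dist z base_point) + \<beta> * weight p z"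
  unfolding energy_def
  using assms by (intro add_mono mult_left_mono KRu_norm_dirac_le integral_weight_dirac_le)

lemma energy_dipole_le:
  assumes "\<alpha> \<ge> 0" "\<beta> \<ge> 0"
  shows "energy p \<alpha> \<beta> (dirac z - dirac w) \<le> \<alpha> * dist z w + \<beta> * (weight p z + weight p w)"
proof -
  have "(\<integral>\<^sup>+x. ennreal (weight p x) \<partial>total_variation (dirac z + (-1) *\<^sub>R dirac w))
      \<le> (\<integral>\<^sup>+x. ennreal (weight p x) \<partial>total_variation (dirac z)) + (\<integral>\<^sup>+x. ennreal (weight p x) \<partial>total_variation ((-1) *\<^sub>R dirac w))"
    by (intro nn_integral_total_variation_add_le) simp
  also have "\<dots> \<le> (\<integral>\<^sup>+x. ennreal (weight p x) \<partial>total_variation (dirac z)) + ennreal \<bar>-1\<bar> * (\<integral>\<^sup>+x. ennreal (weight p x) \<partial>total_variation (dirac w))"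
    by (intro add_left_mono nn_integral_total_variation_scaleR_le) simp
  also have "\<dots> \<le> ennreal (weight p z) + ennreal \<bar>-1\<bar> * ennreal (weight p w)"
    by (intro add_mono mult_left_mono nn_integral_total_variation_dirac_le) simp_all
  also have "\<dots> = ennreal (weight p z + weight p w)"
    using weight_ge_1[of p z] weight_ge_1[of p w] by simp
  finally have "(\<integral>x. weight p x \<partial>total_variation (dirac z - dirac w)) \<le> weight p z + weight p w"
    using weight_ge_1[of p z] weight_ge_1[of p w] dipole_in_moment_measures[of z w p]
    by (intro integral_weight_le) (simp_all add: moment_measures_iff_weight)
  then show ?thesis
    unfolding energy_def using assms by (intro add_mono mult_left_mono KRu_norm_dipole_le)
qed

text \<open>
  The term \<open>\<bar>\<mu>(Z)\<bar>\<close> of the norm pays for the constant \<open>h(e)\<close>. The norm is thus the supremum of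
  \<open>\<integral> h d\<mu>\<close> over 1-Lipschitz functions with \<open>\<bar>h(e)\<bar> \<le> 1\<close>: it behaves as if the surplus mass were
  transported to an additional point at distance \<open>1\<close> from \<open>e\<close>.
\<close>

lemma sintegral_lipschitz_le_KRu_norm:
  assumes \<mu>: "\<mu> \<in> moment_measures 1" and h: "1-lipschitz_on UNIV h" "\<bar>h base_point\<bar> \<le> 1"
  shows "sintegral \<mu> h \<le> KRu_norm \<mu>"
proof -
  interpret finite_measure "total_variation \<mu>" by simp
  define k where "k z = h z - h base_point" for z
  have "1-lipschitz_on UNIV k"
    using h(1) by (auto simp: lipschitz_on_def k_def dist_real_def)
  then have k: "k \<in> unit_lip" unfolding unit_lip_iff by (simp add: k_def)
  have "sintegral \<mu> h = sintegral \<mu> (\<lambda>z. k z + h base_point)" by (simp add: k_def)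
  also have "\<dots> = sintegral \<mu> k + h base_point * smeas \<mu> UNIV"
    using unit_lip_integrable[OF \<mu> k] by (subst sintegral_add) (simp_all add: sintegral_const)
  also have "h base_point * smeas \<mu> UNIV \<le> \<bar>h base_point\<bar> * \<bar>smeas \<mu> UNIV\<bar>"
    by (metis abs_ge_self abs_mult)
  also have "\<dots> \<le> 1 * \<bar>smeas \<mu> UNIV\<bar>" using h(2) by (intro mult_right_mono) auto
  also have "sintegral \<mu> k \<le> (SUP f\<in>unit_lip. sintegral \<mu> f)"
    using k \<mu> by (intro cSUP_upper bdd_above_sintegral)
  finally show ?thesis by (simp add: KRu_norm_def)
qed

text \<open>
  The largest 1-Lipschitz function below \<open>u\<close> is the infimum of \<open>u(w) + d(\<cdot>, w)\<close>. Cutting it off by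
  \<open>1 + d(\<cdot>, e)\<close> bounds its value at \<open>e\<close> from above; the hypotheses are exactly the conditions under
  which the result stays above \<open>l\<close> and above \<open>-1\<close> at \<open>e\<close>.
\<close>

lemma lipschitz_between:
  fixes l u :: "'a::metric_space \<Rightarrow> real"
  assumes lu: "\<And>z w. l z \<le> u w + dist z w"
    and l: "\<And>z. l z \<le> 1 + dist z e" and u: "\<And>z. - (1 + dist z e) \<le> u z"
  shows "\<exists>h. 1-lipschitz_on UNIV h \<and> \<bar>h e\<bar> \<le> 1 \<and> (\<forall>z. l z \<le> h z \<and> h z \<le> u z)"
proof -
  define m where "m z = (INF w. u w + dist z w)" for z
  have bdd: "bdd_below (range (\<lambda>w. u w + dist z w))" for z
    using lu by (intro bdd_belowI2)
  have m_le: "m z \<le> u w + dist z w" for z w unfolding m_def by (intro cINF_lower bdd) simp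
  have m_ge: "c \<le> m z" if "\<And>w. c \<le> u w + dist z w" for c z
    unfolding m_def using that by (intro cINF_greatest) auto
  have m_tri: "m z \<le> m z' + dist z z'" for z z'
  proof -
    have "m z - dist z z' \<le> m z'"
    proof (rule m_ge)
      show "m z - dist z z' \<le> u w + dist z' w" for w
        using m_le[of z w] dist_triangle[of z w z'] by linarith
    qed
    then show ?thesis by simp
  qed
  define h where "h z = min (1 + dist z e) (m z)" for z
  have h_tri: "h z \<le> h z' + dist z z'" for z z'
    using m_tri[of z z'] dist_triangle[of z e z'] by (auto simp: h_def)
  have "1-lipschitz_on UNIV h"
  proof (rule lipschitz_onI)
    show "dist (h z) (h z') \<le> 1 * dist z z'" for z z'
      using h_tri[of z z'] h_tri[of z' z] by (auto simp: dist_real_def dist_commute abs_le_iff)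
  qed simp
  moreover have "\<bar>h e\<bar> \<le> 1"
  proof -
    have "-1 \<le> m e"
    proof (rule m_ge)
      show "- 1 \<le> u w + dist e w" for w using u[of w] by (simp add: dist_commute)
    qed
    then show ?thesis by (auto simp: h_def)
  qed
  moreover have "l z \<le> h z" for z unfolding h_def using l lu by (auto intro: m_ge)
  moreover have "h z \<le> u z" for z using m_le[of z z] by (simp add: h_def)
  ultimately show ?thesis by blast
qed

text \<open>
  The bound is immediate once \<open>f\<close> is written as \<open>\<alpha> h\<close> plus a function bounded by \<open>\<beta>\<close> times the
  weight, with \<open>h\<close> admissible for the norm. Such an \<open>h\<close> lies between \<open>(f - \<beta> w) / \<alpha>\<close> and
  \<open>(f + \<beta> w) / \<alpha>\<close>, and the hypotheses on \<open>f\<close>, which only involve one or two points at a time,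
  guarantee that it exists.
\<close>

lemma sintegral_le_energy:
  assumes p: "p \<ge> 1" "\<alpha> > 0" "\<beta> \<ge> 0" and \<mu>: "\<mu> \<in> moment_measures p"
    and fl: "K-lipschitz_on UNIV f"
    and f1: "\<And>z. \<bar>f z\<bar> \<le> \<alpha> * (1 + dist z base_point) + \<beta> * weight p z"
    and f2: "\<And>z w. f z - f w \<le> \<alpha> * dist z w + \<beta> * (weight p z + weight p w)"
  shows "sintegral \<mu> f \<le> energy p \<alpha> \<beta> \<mu>"
proof -
  have \<mu>1: "\<mu> \<in> moment_measures 1" using p(1) \<mu> by (rule moment_measures_1I)
  define l u where "l z = (f z - \<beta> * weight p z) / \<alpha>" and "u z = (f z + \<beta> * weight p z) / \<alpha>" for z
  have "\<exists>h. 1-lipschitz_on UNIV h \<and> \<bar>h base_point\<bar> \<le> 1 \<and> (\<forall>z. l z \<le> h z \<and> h z \<le> u z)"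
  proof (rule lipschitz_between)
    fix z w
    have "f z - \<beta> * weight p z \<le> f w + \<beta> * weight p w + \<alpha> * dist z w"
      using f2[of z w] by (simp add: algebra_simps)
    then have "l z \<le> (f w + \<beta> * weight p w + \<alpha> * dist z w) / \<alpha>"
      unfolding l_def using p(2) by (intro divide_right_mono) auto
    then show "l z \<le> u w + dist z w" using p(2) by (simp add: u_def add_divide_distrib)
    have "f z - \<beta> * weight p z \<le> \<alpha> * (1 + dist z base_point)" using f1[of z] by linarith
    then show "l z \<le> 1 + dist z base_point" using p(2) by (simp add: l_def divide_le_eq mult.commute)
    have "\<alpha> * (- (1 + dist z base_point)) \<le> f z + \<beta> * weight p z"
      using f1[of z] unfolding mult_minus_right by linarith
    then show "- (1 + dist z base_point) \<le> u z" using p(2) by (simp add: u_def le_divide_eq mult.commute)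
  qed
  then obtain h where h: "1-lipschitz_on UNIV h" "\<bar>h base_point\<bar> \<le> 1" "\<And>z. l z \<le> h z" "\<And>z. h z \<le> u z"
    by blast
  note fi = moment_measures_one_integrable[OF \<mu>1 fl] and hi = moment_measures_one_integrable[OF \<mu>1 h(1)]
  have hi': "integrable (total_variation \<mu>) (\<lambda>z. \<alpha> * h z)" using hi by simp
  have "\<bar>f z - \<alpha> * h z\<bar> \<le> \<beta> * weight p z" for z
    using h(3)[of z] h(4)[of z] p(2) by (simp add: l_def u_def field_simps abs_le_iff)
  then have "\<bar>sintegral \<mu> (\<lambda>z. f z - \<alpha> * h z)\<bar> \<le> (\<integral>z. \<beta> * weight p z \<partial>total_variation \<mu>)"
    using fi hi' \<mu> by (intro abs_sintegral_le) (simp_all add: moment_measures_iff_weight)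
  then have "sintegral \<mu> f - \<alpha> * sintegral \<mu> h \<le> \<beta> * (\<integral>z. weight p z \<partial>total_variation \<mu>)"
    by (simp add: sintegral_diff[OF fi hi'] sintegral_cmult)
  moreover have "\<alpha> * sintegral \<mu> h \<le> \<alpha> * KRu_norm \<mu>"
    using sintegral_lipschitz_le_KRu_norm[OF \<mu>1 h(1,2)] p(2) by (intro mult_left_mono) auto
  ultimately show ?thesis by (simp add: energy_def)
qed

section \<open>Atoms of the regularizer\<close>

text \<open>
  Each atom is paired with an explicit upper bound for its energy, rather than with the energy
  itself, because the bound depends continuously on the points while the energy of
  \<open>\<delta>\<^sub>z - \<delta>\<^sub>w\<close> jumps to \<open>0\<close> at \<open>z = w\<close>.
\<close>

definition atoms :: "real \<Rightarrow> real \<Rightarrow> real \<Rightarrow> ('a::pointed_metric_space signed_measure \<times> real) set" where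
  "atoms p \<alpha> \<beta> =
     range (\<lambda>z. (dirac z, \<alpha> * (1 + dist z base_point) + \<beta> * weight p z))
   \<union> range (\<lambda>z. (- dirac z, \<alpha> * (1 + dist z base_point) + \<beta> * weight p z))
   \<union> range (\<lambda>(z, w). (dirac z - dirac w, \<alpha> * dist z w + \<beta> * (weight p z + weight p w)))"

text \<open>
  The point \<open>0\<close> supplies the limit along atoms that escape to infinity, without which the set need
  not be closed.
\<close>

definition atom_image ::
  "real \<Rightarrow> real \<Rightarrow> real \<Rightarrow> ('a::pointed_metric_space KRu \<Rightarrow> 'b::real_normed_vector) \<Rightarrow> 'b set" where
  "atom_image p \<alpha> \<beta> A = insert 0 ((\<lambda>(u, g). A (KRu_of u) /\<^sub>R g) ` atoms p \<alpha> \<beta>)"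

lemma atoms_cases:
  assumes "(u, g) \<in> atoms p \<alpha> \<beta>"
  obtains (pos) z where "u = dirac z" "g = \<alpha> * (1 + dist z base_point) + \<beta> * weight p z"
  | (neg) z where "u = - dirac z" "g = \<alpha> * (1 + dist z base_point) + \<beta> * weight p z"
  | (dipole) z w where "u = dirac z - dirac w" "g = \<alpha> * dist z w + \<beta> * (weight p z + weight p w)"
  using assms unfolding atoms_def by auto

lemma atom_in_moment_measures: "(u, g) \<in> atoms p \<alpha> \<beta> \<Longrightarrow> u \<in> moment_measures q"
  by (erule atoms_cases)
     (auto intro: dirac_in_moment_measures dipole_in_moment_measures subspace_neg[OF subspace_moment_measures])

lemma atom_energy_le:
  assumes "p \<ge> 1" "\<alpha> \<ge> 0" "\<beta> \<ge> 0" "(u, g) \<in> atoms p \<alpha> \<beta>"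
  shows "energy p \<alpha> \<beta> u \<le> g"
  using assms(4)
proof (cases rule: atoms_cases)
  case (neg z)
  have "energy p \<alpha> \<beta> (- dirac z) \<le> energy p \<alpha> \<beta> (dirac z)"
    using energy_scaleR_le[OF assms(1-3) dirac_in_moment_measures[of z], of "-1"] by simp
  then show ?thesis using neg energy_dirac_le[OF assms(2,3), of p z] by simp
qed (use assms energy_dirac_le energy_dipole_le in auto)

lemma atom_cost_pos:
  assumes "\<alpha> \<ge> 0" "\<beta> > 0" "(u, g) \<in> atoms p \<alpha> \<beta>"
  shows "0 < g"
proof -
  have w: "0 < \<beta> * weight p z" for z :: 'a using weight_ge_1[of p z] assms(2) by simp
  have d: "0 \<le> \<alpha> * dist z w" "0 \<le> \<alpha> * (1 + dist z w)" for z w :: 'a using assms(1) by simp_all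
  show ?thesis
    using assms(3)
  proof (cases rule: atoms_cases)
    case (dipole z w)
    then show ?thesis using d(1)[of z w] w[of z] w[of w] by (simp add: distrib_left)
  qed (use d(2) w in \<open>auto intro: add_nonneg_pos\<close>)
qed

lemma atom_dipole_form:
  assumes "(u, g) \<in> atoms p \<alpha> \<beta>"
  shows "\<exists>c z w. u = c *\<^sub>R (dirac z - dirac w) + smeas u UNIV *\<^sub>R dirac base_point"
  using assms
proof (cases rule: atoms_cases)
  case (pos z)
  then show ?thesis by (intro exI[of _ 1] exI[of _ z] exI[of _ base_point]) (simp add: smeas_dirac)
next
  case (neg z)
  then show ?thesis by (intro exI[of _ "-1"] exI[of _ z] exI[of _ base_point]) (simp add: smeas_dirac)
next
  case (dipole z w)
  then show ?thesis by (intro exI[of _ 1] exI[of _ z] exI[of _ w]) (simp add: smeas_dirac)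
qed

text \<open>
  This is where \<open>p > 1\<close> enters: the penalty on the moments dominates the linear growth of the norm
  of an atom.
\<close>

lemma linear_less_powr_beyond:
  fixes p \<eta> :: real
  assumes "p > 1" "\<eta> > 0"
  shows "\<exists>R. \<forall>r>R. 0 \<le> r \<and> 1 + r < \<eta> * (1 + r powr p)"
proof (intro exI allI impI)
  fix r :: real assume r: "r > max 1 ((2 / \<eta>) powr (1 / (p - 1)))"
  have "((2 / \<eta>) powr (1 / (p - 1))) powr (p - 1) < r powr (p - 1)"
    using r assms by (intro powr_less_mono2) auto
  then have "2 / \<eta> < r powr (p - 1)" using assms by (simp add: powr_powr)
  then have "2 < \<eta> * r powr (p - 1)" using assms by (simp add: divide_less_eq mult.commute)
  then have "2 * r < \<eta> * r powr (p - 1) * r" using r by (intro mult_strict_right_mono) auto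
  also have "r powr (p - 1) * r = r powr p" using r by (simp add: powr_diff)
  then have "\<eta> * r powr (p - 1) * r = \<eta> * r powr p" by simp
  finally have "2 * r < \<eta> * r powr p" .
  moreover have "\<eta> * (1 + r powr p) = \<eta> + \<eta> * r powr p" by (simp add: distrib_left)
  ultimately show "0 \<le> r \<and> 1 + r < \<eta> * (1 + r powr p)" using r assms(2) by simp
qed

lemma compact_atom_image:
  fixes A :: "'z::{polish_space, pointed_metric_space} KRu \<Rightarrow> 'b::real_normed_vector"
  assumes lc: "locally_compact_space (euclidean :: 'z topology)"
    and geo: "geodesic_on (UNIV :: 'z set)"
    and p: "p > 1" "\<alpha> \<ge> 0" "\<beta> > 0" and A: "bounded_linear A"
  shows "compact (atom_image p \<alpha> \<beta> A)"
proof -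
  obtain B where B: "B \<ge> 0" "\<And>h. norm (A h) \<le> norm h * B"
    using bounded_linear.nonneg_bounded[OF A] by auto
  define \<phi> where "\<phi> z = A (KRu_of (dirac z))" for z
  define g1 where "g1 z = \<alpha> * (1 + dist z base_point) + \<beta> * weight p z" for z :: 'z
  define g2 where "g2 x = \<alpha> * dist (fst x) (snd x) + \<beta> * (weight p (fst x) + weight p (snd x))" for x :: "'z \<times> 'z"
  have w0: "1 \<le> weight p z" for z :: 'z by (rule weight_ge_1)
  have g1: "\<beta> * (1 + dist z base_point powr p) \<le> g1 z" for z
    using p by (simp add: g1_def weight_def)
  have g2: "\<beta> * (1 + dist (fst x) base_point powr p) \<le> g2 x" "\<beta> * (1 + dist (snd x) base_point powr p) \<le> g2 x" for x
    using p by (auto simp: g2_def weight_def algebra_simps add_increasing add_increasing2)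
  have g_pos: "g1 z \<noteq> 0" "g2 x \<noteq> 0" for z x
  proof -
    have "0 < \<beta> * (1 + dist y base_point powr p)" for y :: 'z
      using p by (intro mult_pos_pos add_pos_nonneg) auto
    then show "g1 z \<noteq> 0" "g2 x \<noteq> 0" using g1[of z] g2(1)[of x] by (metis not_le)+
  qed
  have c\<phi>: "continuous_on UNIV \<phi>"
    unfolding \<phi>_def
    by (intro bounded_linear.continuous_on[OF A] lipschitz_on_continuous_on[OF lipschitz_KRu_of_dirac])
  have cw: "continuous_on UNIV (weight p :: 'z \<Rightarrow> real)"
    unfolding weight_def using p by (intro continuous_intros continuous_on_powr') auto
  have c\<phi>': "continuous_on UNIV (\<lambda>x. \<phi> (f x))" and cw': "continuous_on UNIV (\<lambda>x. weight p (f x))"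
    if "continuous_on UNIV f" for f :: "'z \<times> 'z \<Rightarrow> 'z"
    using continuous_on_compose2[OF c\<phi> that] continuous_on_compose2[OF cw that] by auto
  have cg1: "continuous_on UNIV g1" unfolding g1_def by (intro continuous_intros cw)
  have cg2: "continuous_on UNIV g2" unfolding g2_def by (intro continuous_intros cw')
  have \<phi>_le: "norm (\<phi> z) \<le> B * (1 + dist z base_point)" for z
  proof -
    have "norm (\<phi> z) \<le> norm (KRu_of (dirac z)) * B" unfolding \<phi>_def by (rule B)
    also have "\<dots> \<le> (1 + dist z base_point) * B" by (intro mult_right_mono norm_KRu_of_dirac_le B)
    finally show ?thesis by (simp add: mult.commute)
  qed
  \<comment> \<open>The factor \<open>2\<close> accommodates the two points of a dipole.\<close>
  have small: "\<exists>R. \<forall>r>R. 0 \<le> r \<and> 2 * B * (1 + r) < \<epsilon> * (\<beta> * (1 + r powr p))" if \<epsilon>: "\<epsilon> > 0" for \<epsilon>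
  proof -
    have "0 < \<epsilon> * \<beta> / (2 * B + 1)" using \<epsilon> p B by auto
    then obtain R where R: "\<And>r. r > R \<Longrightarrow> 0 \<le> r \<and> 1 + r < \<epsilon> * \<beta> / (2 * B + 1) * (1 + r powr p)"
      using linear_less_powr_beyond[OF p(1)] by blast
    have "0 \<le> r \<and> 2 * B * (1 + r) < \<epsilon> * (\<beta> * (1 + r powr p))" if "r > R" for r
    proof -
      have "(2 * B + 1) * (1 + r) < \<epsilon> * (\<beta> * (1 + r powr p))"
        using R[OF that] B(1) by (simp add: less_divide_eq mult_ac)
      moreover have "2 * B * (1 + r) \<le> (2 * B + 1) * (1 + r)" using R[OF that] by (intro mult_right_mono) auto
      ultimately show ?thesis using R[OF that] by linarith
    qed
    then show ?thesis by blast
  qed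
  have scaled: "norm (x /\<^sub>R g) < \<epsilon>" if "norm x < \<epsilon> * g" "\<epsilon> > 0" for x :: 'b and g \<epsilon> :: real
  proof -
    have "0 < g" using that norm_ge_zero[of x] by (metis le_less_trans zero_less_mult_pos)
    then show ?thesis using that by (simp add: pos_divide_less_eq field_simps)
  qed
  have ball: "compact (cball (base_point::'z) R)" for R by (rule compact_cball_geodesic[OF lc geo])
  have 1: "compact (insert 0 (range (\<lambda>z. \<phi> z /\<^sub>R g1 z)))"
  proof (rule compact_vanishing_image)
    show "continuous_on UNIV (\<lambda>z. \<phi> z /\<^sub>R g1 z)"
      using g_pos by (intro continuous_intros c\<phi> cg1) auto
    fix \<epsilon> :: real assume \<epsilon>: "\<epsilon> > 0"
    obtain R where R: "\<And>r. r > R \<Longrightarrow> 0 \<le> r \<and> 2 * B * (1 + r) < \<epsilon> * (\<beta> * (1 + r powr p))"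
      using small[OF \<epsilon>] by blast
    have "norm (\<phi> z /\<^sub>R g1 z) < \<epsilon>" if z: "z \<notin> cball base_point R" for z
    proof (rule scaled[OF _ \<epsilon>])
      have "dist z base_point > R" using z by (simp add: dist_commute)
      note r = R[OF this]
      have "norm (\<phi> z) \<le> B * (1 + dist z base_point)" by (rule \<phi>_le)
      also have "\<dots> \<le> 2 * B * (1 + dist z base_point)" using B(1) by (intro mult_right_mono) auto
      also have "\<dots> < \<epsilon> * (\<beta> * (1 + dist z base_point powr p))" using r by simp
      also have "\<dots> \<le> \<epsilon> * g1 z" using g1 \<epsilon> by (intro mult_left_mono) auto
      finally show "norm (\<phi> z) < \<epsilon> * g1 z" .
    qed
    then show "\<exists>K. compact K \<and> (\<forall>z. z \<notin> K \<longrightarrow> norm (\<phi> z /\<^sub>R g1 z) < \<epsilon>)" using ball by blast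
  qed
  have 2: "compact (insert 0 (range (\<lambda>x. (\<phi> (fst x) - \<phi> (snd x)) /\<^sub>R g2 x)))"
  proof (rule compact_vanishing_image)
    show "continuous_on UNIV (\<lambda>x. (\<phi> (fst x) - \<phi> (snd x)) /\<^sub>R g2 x)"
      using g_pos by (intro continuous_intros c\<phi>' cg2) auto
    fix \<epsilon> :: real assume \<epsilon>: "\<epsilon> > 0"
    obtain R where R: "\<And>r. r > R \<Longrightarrow> 0 \<le> r \<and> 2 * B * (1 + r) < \<epsilon> * (\<beta> * (1 + r powr p))"
      using small[OF \<epsilon>] by blast
    have "norm ((\<phi> (fst x) - \<phi> (snd x)) /\<^sub>R g2 x) < \<epsilon>"
      if x: "x \<notin> cball base_point R \<times> cball base_point R" for x
    proof (rule scaled[OF _ \<epsilon>])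
      define r where "r = max (dist (fst x) base_point) (dist (snd x) base_point)"
      have "r > R" using x by (cases x) (auto simp: r_def dist_commute less_max_iff_disj)
      note r = R[OF this]
      have "norm (\<phi> (fst x) - \<phi> (snd x)) \<le> norm (\<phi> (fst x)) + norm (\<phi> (snd x))"
        by (rule norm_triangle_ineq4)
      also have "\<dots> \<le> B * (1 + dist (fst x) base_point) + B * (1 + dist (snd x) base_point)"
        by (intro add_mono \<phi>_le)
      also have "\<dots> \<le> B * (1 + r) + B * (1 + r)"
        using B(1) by (intro add_mono mult_left_mono) (auto simp: r_def)
      also have "\<dots> = 2 * B * (1 + r)" by simp
      also have "\<dots> < \<epsilon> * (\<beta> * (1 + r powr p))" using r by simp
      also have "\<dots> \<le> \<epsilon> * g2 x" using g2[of x] \<epsilon> by (intro mult_left_mono) (auto simp: r_def max_def)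
      finally show "norm (\<phi> (fst x) - \<phi> (snd x)) < \<epsilon> * g2 x" .
    qed
    then show "\<exists>K. compact K \<and> (\<forall>x. x \<notin> K \<longrightarrow> norm ((\<phi> (fst x) - \<phi> (snd x)) /\<^sub>R g2 x) < \<epsilon>)"
      using compact_Times[OF ball ball] by blast
  qed
  have lin: "linear A" using A by (rule bounded_linear.linear)
  have neg: "A (KRu_of (- dirac z)) = - \<phi> z" for z
    using KRu_of_scaleR[OF dirac_in_moment_measures, of "-1" z] lin by (simp add: \<phi>_def linear_neg)
  have dip: "A (KRu_of (dirac z - dirac w)) = \<phi> z - \<phi> w" for z w
    using lin by (simp add: \<phi>_def linear_diff KRu_of_diff dirac_in_moment_measures)
  have "atom_image p \<alpha> \<beta> A = insert 0 (range (\<lambda>z. \<phi> z /\<^sub>R g1 z)) \<union>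
      uminus ` insert 0 (range (\<lambda>z. \<phi> z /\<^sub>R g1 z)) \<union> insert 0 (range (\<lambda>x. (\<phi> (fst x) - \<phi> (snd x)) /\<^sub>R g2 x))"
    unfolding atom_image_def atoms_def image_Un image_image image_insert
    by (simp add: neg dip g1_def[symmetric] g2_def \<phi>_def[symmetric] split_beta)
  then show ?thesis using 1 2 compact_negations[OF 1] by (simp only:) (intro compact_Un; assumption)
qed

text \<open>
  If \<open>A \<mu> / energy(\<mu>)\<close> were outside the hull, a separating functional, normalised to be at most
  \<open>1\<close> on the hull, would satisfy the hypotheses of \<open>sintegral_le_energy\<close> and contradict its
  conclusion.
\<close>

lemma image_in_energy_times_hull:
  fixes A :: "'z::{polish_space, pointed_metric_space} KRu \<Rightarrow> 'b::euclidean_space"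
  assumes p: "p > 1" "\<alpha> > 0" "\<beta> > 0" and A: "bounded_linear A"
    and cpt: "compact (atom_image p \<alpha> \<beta> A)" and \<mu>: "\<mu> \<in> moment_measures p"
  shows "\<exists>x\<in>convex hull (atom_image p \<alpha> \<beta> A). A (KRu_of \<mu>) = energy p \<alpha> \<beta> \<mu> *\<^sub>R x"
proof -
  let ?B = "convex hull (atom_image p \<alpha> \<beta> A)" and ?E = "energy p \<alpha> \<beta> \<mu>"
  have \<mu>1: "\<mu> \<in> moment_measures 1" using p \<mu> by (intro moment_measures_1I[of p]) auto
  have zero: "0 \<in> ?B" by (rule hull_inc) (simp add: atom_image_def)
  have lin: "linear A" using A by (rule bounded_linear.linear)
  have E0: "?E \<ge> 0" "?E = 0 \<Longrightarrow> KRu_norm \<mu> = 0"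
  proof -
    have "0 \<le> \<beta> * (\<integral>z. weight p z \<partial>total_variation \<mu>)" "0 \<le> \<alpha> * KRu_norm \<mu>"
      using p nn_integral_weight(2)[OF \<mu>] KRu_norm_nonneg[OF \<mu>1] by auto
    then show "?E \<ge> 0" "?E = 0 \<Longrightarrow> KRu_norm \<mu> = 0" using p by (auto simp: energy_def add_nonneg_eq_0_iff)
  qed
  show ?thesis
  proof (cases "?E = 0")
    case True
    then have "KRu_of \<mu> = 0" using E0(2) norm_KRu_of[OF \<mu>1] by simp
    then show ?thesis using zero True lin by (auto simp: linear_0)
  next
    case False
    then have E: "?E > 0" using E0 by simp
    have "A (KRu_of \<mu>) /\<^sub>R ?E \<in> ?B"
    proof (rule ccontr)
      assume "A (KRu_of \<mu>) /\<^sub>R ?E \<notin> ?B"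
      then obtain a b where ab: "inner a (A (KRu_of \<mu>) /\<^sub>R ?E) < b" "\<And>x. x \<in> ?B \<Longrightarrow> b < inner a x"
        using separating_hyperplane_closed_point[OF convex_convex_hull
            compact_imp_closed[OF compact_convex_hull[OF cpt]]] by blast
      have b: "b < 0" using ab(2)[OF zero] by simp
      \<comment> \<open>As \<open>b < 0\<close>, dividing by \<open>b\<close> turns the lower bound on the hull into the upper bound \<open>1\<close>.\<close>
      define L where "L = (\<lambda>h. inner (a /\<^sub>R b) (A h))"
      have L: "bounded_linear L"
        unfolding L_def by (rule bounded_linear_compose[OF bounded_linear_inner_right A])
      define f where "f = (\<lambda>z. L (KRu_of (dirac z)))"
      have atom: "L (KRu_of u) \<le> g" if ug: "(u, g) \<in> atoms p \<alpha> \<beta>" for u g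
      proof -
        have g: "g > 0" using p by (intro atom_cost_pos[OF _ _ ug]) auto
        have "A (KRu_of u) /\<^sub>R g \<in> ?B"
          unfolding atom_image_def using ug by (intro hull_inc insertI2 image_eqI[of _ _ "(u, g)"]) auto
        from ab(2)[OF this] have "b < inner a (A (KRu_of u)) / g" by (simp add: divide_inverse mult.commute)
        then have "b * g < inner a (A (KRu_of u))" using g by (simp add: pos_less_divide_eq)
        then have "inner a (A (KRu_of u)) / b < g" using b by (simp add: neg_divide_less_eq mult.commute)
        then show ?thesis by (simp add: L_def divide_inverse mult.commute)
      qed
      have Llin: "linear L" using L by (rule bounded_linear.linear)
      have "L (KRu_of (- dirac z)) = - f z" for z
        using KRu_of_scaleR[OF dirac_in_moment_measures, of "-1" z] Llin by (simp add: f_def linear_neg)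
      then have f1: "\<bar>f z\<bar> \<le> \<alpha> * (1 + dist z base_point) + \<beta> * weight p z" for z
        using atom[of "dirac z"] atom[of "- dirac z"] by (auto simp: atoms_def f_def abs_le_iff)
      have f2: "f z - f w \<le> \<alpha> * dist z w + \<beta> * (weight p z + weight p w)" for z w
      proof -
        have "(dirac z - dirac w, \<alpha> * dist z w + \<beta> * (weight p z + weight p w)) \<in> atoms p \<alpha> \<beta>"
          unfolding atoms_def by (intro UnI2 image_eqI[of _ _ "(z, w)"]) auto
        from atom[OF this] show ?thesis
          using Llin by (simp add: f_def KRu_of_diff dirac_in_moment_measures linear_diff)
      qed
      obtain K where "K-lipschitz_on UNIV f"
        unfolding f_def using lipschitz_bounded_linear_dirac[OF L] by blast
      then have "sintegral \<mu> f \<le> ?E"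
        using p by (intro sintegral_le_energy[OF _ _ _ \<mu> _ f1 f2]) auto
      then have "inner a (A (KRu_of \<mu>)) / b \<le> ?E"
        using bounded_linear_KRu_eq_sintegral[OF L \<mu>1, folded f_def]
        by (simp add: L_def divide_inverse mult.commute)
      then have "b * ?E \<le> inner a (A (KRu_of \<mu>))" using b by (simp add: neg_divide_le_eq mult.commute)
      moreover have "inner a (A (KRu_of \<mu>)) < b * ?E"
        using ab(1) E by (simp add: divide_less_eq divide_inverse[symmetric] mult.commute)
      ultimately show False by simp
    qed
    then show ?thesis using False by (intro bexI[of _ "A (KRu_of \<mu>) /\<^sub>R ?E"]) auto
  qed
qed

lemma smeas_sum: "smeas (\<Sum>i\<in>I. \<mu> i) S = (\<Sum>i\<in>I. smeas (\<mu> i) S)"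
  by (induction I rule: infinite_finite_induct) auto

text \<open>
  The vectors \<open>A u / cost(u)\<close> come from atoms scaled to cost \<open>1\<close>, so the total weight of a conic
  combination of them is its total cost. \<open>conic_caratheodory\<close> makes the vectors independent without
  raising that cost, and the dimension of the target bounds the number of independent vectors.
\<close>

lemma sparse_measure_over_hull_point:
  fixes A :: "'z::pointed_metric_space KRu \<Rightarrow> real ^ 'n"
  assumes p: "p \<ge> 1" "\<alpha> \<ge> 0" "\<beta> > 0" and A: "bounded_linear A"
    and x: "x \<in> convex hull (atom_image p \<alpha> \<beta> A)" and t: "t \<ge> 0"
  shows "\<exists>\<mu>\<in>moment_measures p. A (KRu_of \<mu>) = t *\<^sub>R x \<and> energy p \<alpha> \<beta> \<mu> \<le> t \<and>
    (\<exists>(c :: 'n \<Rightarrow> real) (z :: 'n \<Rightarrow> 'z) (w :: 'n \<Rightarrow> 'z).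
       \<mu> = (\<Sum>i\<in>UNIV. c i *\<^sub>R (dirac (z i) - dirac (w i))) + smeas \<mu> UNIV *\<^sub>R dirac base_point)"
proof -
  obtain S v where S: "finite S" "S \<subseteq> atom_image p \<alpha> \<beta> A" "\<And>y. y \<in> S \<Longrightarrow> 0 \<le> v y"
    "sum v S = 1" "(\<Sum>y\<in>S. v y *\<^sub>R y) = x"
    using x unfolding convex_hull_explicit by blast
  have "\<exists>T c. T \<subseteq> S \<and> independent T \<and> (\<forall>y\<in>T. 0 \<le> c y) \<and>
    (\<Sum>y\<in>T. c y *\<^sub>R y) = (\<Sum>y\<in>S. (t * v y) *\<^sub>R y) \<and> sum c T \<le> sum (\<lambda>y. t * v y) S"
    using S t by (intro conic_caratheodory) auto
  then obtain T c where T: "T \<subseteq> S" "independent T" "\<And>y. y \<in> T \<Longrightarrow> 0 \<le> c y"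
    and T_eq: "(\<Sum>y\<in>T. c y *\<^sub>R y) = (\<Sum>y\<in>S. (t * v y) *\<^sub>R y)" "sum c T \<le> sum (\<lambda>y. t * v y) S"
    by blast
  have "(\<Sum>y\<in>S. (t * v y) *\<^sub>R y) = t *\<^sub>R (\<Sum>y\<in>S. v y *\<^sub>R y)" by (simp add: scaleR_sum_right)
  moreover have "sum (\<lambda>y. t * v y) S = t * sum v S" by (simp add: sum_distrib_left)
  ultimately have sum_T: "(\<Sum>y\<in>T. c y *\<^sub>R y) = t *\<^sub>R x" "sum c T \<le> t"
    using T_eq S(4,5) by simp_all
  \<comment> \<open>Independence excludes the additional point \<open>0\<close>: what remains comes from atoms.\<close>
  have "0 \<notin> T" using T(2) dependent_zero by blast
  then have "\<exists>u g. (u, g) \<in> atoms p \<alpha> \<beta> \<and> y = A (KRu_of u) /\<^sub>R g" if "y \<in> T" for y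
  proof -
    have "y \<in> (\<lambda>(u, g). A (KRu_of u) /\<^sub>R g) ` atoms p \<alpha> \<beta>"
      using that T(1) S(2) \<open>0 \<notin> T\<close> unfolding atom_image_def by (cases "y = 0") blast+
    then show ?thesis by auto
  qed
  then obtain u g where ug: "\<And>y. y \<in> T \<Longrightarrow> (u y, g y) \<in> atoms p \<alpha> \<beta>"
    "\<And>y. y \<in> T \<Longrightarrow> y = A (KRu_of (u y)) /\<^sub>R g y"
    by metis
  have g: "g y > 0" if "y \<in> T" for y using atom_cost_pos[OF p(2,3) ug(1)[OF that]] .
  have finT: "finite T" using S(1) T(1) finite_subset by blast
  define q where "q y = c y / g y" for y
  have q: "0 \<le> q y" if "y \<in> T" for y using T(3)[OF that] g[OF that] by (simp add: q_def)
  define \<mu> where "\<mu> = (\<Sum>y\<in>T. q y *\<^sub>R u y)"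
  have "\<mu> \<in> moment_measures p"
    unfolding \<mu>_def using atom_in_moment_measures[OF ug(1)]
    by (intro subspace_sum[OF subspace_moment_measures] subspace_scale[OF subspace_moment_measures])
  moreover have "A (KRu_of \<mu>) = t *\<^sub>R x"
  proof -
    have "A (KRu_of \<mu>) = A (\<Sum>y\<in>T. q y *\<^sub>R KRu_of (u y))"
      unfolding \<mu>_def using atom_in_moment_measures[OF ug(1)] finT by (subst KRu_of_sum_scaleR) auto
    also have "\<dots> = (\<Sum>y\<in>T. q y *\<^sub>R A (KRu_of (u y)))"
      using A by (simp add: bounded_linear.linear linear_sum linear_scale)
    also have "\<dots> = (\<Sum>y\<in>T. c y *\<^sub>R y)"
    proof (rule sum.cong[OF refl])
      fix y assume y: "y \<in> T"
      have "q y *\<^sub>R A (KRu_of (u y)) = c y *\<^sub>R (A (KRu_of (u y)) /\<^sub>R g y)"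
        by (simp add: q_def divide_inverse)
      then show "q y *\<^sub>R A (KRu_of (u y)) = c y *\<^sub>R y" using ug(2)[OF y] by simp
    qed
    finally show ?thesis by (simp add: sum_T)
  qed
  moreover have "energy p \<alpha> \<beta> \<mu> \<le> t"
  proof -
    have "energy p \<alpha> \<beta> \<mu> \<le> (\<Sum>y\<in>T. q y * energy p \<alpha> \<beta> (u y))"
      unfolding \<mu>_def using p finT q atom_in_moment_measures[OF ug(1)] by (intro energy_sum_le) auto
    also have "\<dots> \<le> (\<Sum>y\<in>T. q y * g y)"
      using p q atom_energy_le[OF _ _ _ ug(1)] by (intro sum_mono mult_left_mono) auto
    also have "\<dots> = sum c T" using less_imp_neq[OF g] by (intro sum.cong) (auto simp: q_def)
    finally show ?thesis using sum_T(2) by simp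
  qed
  moreover have "\<exists>(c :: 'n \<Rightarrow> real) (z :: 'n \<Rightarrow> 'z) (w :: 'n \<Rightarrow> 'z).
       \<mu> = (\<Sum>i\<in>UNIV. c i *\<^sub>R (dirac (z i) - dirac (w i))) + smeas \<mu> UNIV *\<^sub>R dirac base_point"
  proof -
    have "\<exists>c z w. u y = c *\<^sub>R (dirac z - dirac w) + smeas (u y) UNIV *\<^sub>R dirac base_point" if "y \<in> T" for y
      using atom_dipole_form[OF ug(1)[OF that]] .
    then obtain k z w where form:
      "\<And>y. y \<in> T \<Longrightarrow> u y = k y *\<^sub>R (dirac (z y) - dirac (w y)) + smeas (u y) UNIV *\<^sub>R dirac base_point"
      by metis
    have "card T \<le> card (UNIV :: 'n set)" using independent_bound[OF T(2)] by simp
    then obtain j :: "real ^ 'n \<Rightarrow> 'n" where j: "inj_on j T"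
      using card_le_inj[OF finT, of "UNIV :: 'n set"] by auto
    define r where "r = the_inv_into T j"
    have r: "r (j y) = y" if "y \<in> T" for y using j that by (simp add: r_def the_inv_into_f_f)
    define d where "d i = (if i \<in> j ` T then q (r i) * k (r i) else 0)" for i
    have "(\<Sum>i\<in>UNIV. d i *\<^sub>R (dirac (z (r i)) - dirac (w (r i))))
        = (\<Sum>i\<in>j ` T. d i *\<^sub>R (dirac (z (r i)) - dirac (w (r i))))"
      by (rule sum.mono_neutral_right) (auto simp: d_def)
    also have "\<dots> = (\<Sum>y\<in>T. (q y * k y) *\<^sub>R (dirac (z y) - dirac (w y)))"
      using j r by (subst sum.reindex) (auto simp: d_def intro!: sum.cong)
    finally have dipoles: "(\<Sum>i\<in>UNIV. d i *\<^sub>R (dirac (z (r i)) - dirac (w (r i))))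
        = (\<Sum>y\<in>T. (q y * k y) *\<^sub>R (dirac (z y) - dirac (w y)))" .
    have mass: "smeas \<mu> UNIV *\<^sub>R dirac base_point = (\<Sum>y\<in>T. (q y * smeas (u y) UNIV) *\<^sub>R dirac base_point)"
      by (simp add: \<mu>_def smeas_sum scaleR_sum_left)
    have "\<mu> = (\<Sum>y\<in>T. (q y * k y) *\<^sub>R (dirac (z y) - dirac (w y)) + (q y * smeas (u y) UNIV) *\<^sub>R dirac base_point)"
      unfolding \<mu>_def
    proof (rule sum.cong[OF refl])
      fix y assume "y \<in> T"
      have "q y *\<^sub>R u y = q y *\<^sub>R (k y *\<^sub>R (dirac (z y) - dirac (w y)) + smeas (u y) UNIV *\<^sub>R dirac base_point)"
        using form[OF \<open>y \<in> T\<close>] by simp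
      then show "q y *\<^sub>R u y = (q y * k y) *\<^sub>R (dirac (z y) - dirac (w y)) + (q y * smeas (u y) UNIV) *\<^sub>R dirac base_point"
        by (simp add: scaleR_add_right)
    qed
    then have "\<mu> = (\<Sum>i\<in>UNIV. d i *\<^sub>R (dirac (z (r i)) - dirac (w (r i)))) + smeas \<mu> UNIV *\<^sub>R dirac base_point"
      unfolding dipoles mass by (simp add: sum.distrib)
    then show ?thesis
      by (intro exI[of _ d] exI[of _ "\<lambda>i. z (r i)"] exI[of _ "\<lambda>i. w (r i)"])
  qed
  ultimately show ?thesis by blast
qed

theorem theorem6p4:
  fixes p \<alpha> \<beta> :: real
    and A :: "'z::{polish_space, pointed_metric_space} KRu \<Rightarrow> real ^ 'n"
    and F :: "real ^ 'n \<Rightarrow> ereal"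
  assumes "locally_compact_space (euclidean :: 'z topology)"
    and "geodesic_on (UNIV :: 'z set)"
    and "p > 1" and "\<alpha> > 0" and "\<beta> > 0"
    and "bounded_linear A"
    and "proper_fun F" and "convex_fun F" and "coercive_fun F" and "lsc_fun F"
  shows "\<exists>\<mu>\<in>moment_measures p.
    (\<forall>h. F (A (KRu_of \<mu>)) + G_reg p \<alpha> \<beta> (KRu_of \<mu>) \<le> F (A h) + G_reg p \<alpha> \<beta> h) \<and>
    (\<exists>(c :: 'n \<Rightarrow> real) (z :: 'n \<Rightarrow> 'z) (w :: 'n \<Rightarrow> 'z).
       \<mu> = (\<Sum>i\<in>UNIV. c i *\<^sub>R (dirac (z i) - dirac (w i))) + smeas \<mu> UNIV *\<^sub>R dirac base_point)"
proof -
  have G: "G_reg p \<alpha> \<beta> (KRu_of \<nu>) = ereal (energy p \<alpha> \<beta> \<nu>)" if "\<nu> \<in> moment_measures p" for \<nu> :: "'z signed_measure"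
    using G_reg_KRu_of[of p \<nu> \<alpha> \<beta>] that assms(3) by (simp add: energy_def weight_def)
  define B where "B = convex hull (atom_image p \<alpha> \<beta> A)"
  have cpt: "compact (atom_image p \<alpha> \<beta> A)"
    using assms(1-6) by (intro compact_atom_image) auto
  then have B: "compact B" unfolding B_def by (rule compact_convex_hull)
  have B0: "0 \<in> B" unfolding B_def by (rule hull_inc) (simp add: atom_image_def)
  obtain m where m: "\<And>y. ereal m \<le> F y"
    using coercive_lsc_bounded_below[OF assms(7,9,10)] by blast
  \<comment> \<open>A pair \<open>(t, x)\<close> stands for the measures \<open>\<nu>\<close> with image \<open>t x\<close> and energy at most \<open>t\<close>.\<close>
  define \<Phi> where "\<Phi> s = ereal (fst s) + F (fst s *\<^sub>R snd s)" for s
  have "\<exists>s\<in>{0::real..} \<times> B. \<forall>s'\<in>{0::real..} \<times> B. \<Phi> s \<le> \<Phi> s'"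
  proof (rule attains_min_if_bounded_sublevels)
    show "closed ({0::real..} \<times> B)" using B by (intro closed_Times) (auto intro: compact_imp_closed)
    show "{0::real..} \<times> B \<noteq> {}" using B0 by auto
    show "\<Phi> s \<le> liminf (\<lambda>n. \<Phi> (X n))" if X: "X \<longlonglongrightarrow> s" for X s
    proof -
      have "(\<lambda>n. fst (X n) *\<^sub>R snd (X n)) \<longlonglongrightarrow> fst s *\<^sub>R snd s"
        using X by (intro tendsto_scaleR tendsto_fst tendsto_snd)
      then have le: "F (fst s *\<^sub>R snd s) \<le> liminf (\<lambda>n. F (fst (X n) *\<^sub>R snd (X n)))"
        by (rule lsc_fun_le_Liminf[OF assms(10)])
      have "(\<lambda>n. ereal (fst (X n))) \<longlonglongrightarrow> ereal (fst s)" using X by (intro tendsto_ereal tendsto_fst)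
      then have "liminf (\<lambda>n. \<Phi> (X n)) = ereal (fst s) + liminf (\<lambda>n. F (fst (X n) *\<^sub>R snd (X n)))"
        unfolding \<Phi>_def by (rule ereal_liminf_lim_add) simp
      then show ?thesis unfolding \<Phi>_def using le by (simp add: add_left_mono)
    qed
    fix r :: real
    have "{s \<in> {0::real..} \<times> B. \<Phi> s \<le> ereal r} \<subseteq> {0..r - m} \<times> B"
    proof
      fix s assume s: "s \<in> {s \<in> {0::real..} \<times> B. \<Phi> s \<le> ereal r}"
      have "ereal (fst s) + ereal m \<le> \<Phi> s" unfolding \<Phi>_def by (intro add_left_mono m)
      also have "\<dots> \<le> ereal r" using s by simp
      finally show "s \<in> {0..r - m} \<times> B" using s by (cases s) auto
    qed
    moreover have "bounded ({0..r - m} \<times> B)" using B by (intro bounded_Times compact_imp_bounded) auto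
    ultimately show "bounded {s \<in> {0::real..} \<times> B. \<Phi> s \<le> ereal r}" by (rule bounded_subset[rotated])
  qed
  then obtain t x where tx: "t \<ge> 0" "x \<in> B" "\<And>t' x'. t' \<ge> 0 \<Longrightarrow> x' \<in> B \<Longrightarrow> \<Phi> (t, x) \<le> \<Phi> (t', x')"
    by auto
  obtain \<mu> where \<mu>: "\<mu> \<in> moment_measures p" "A (KRu_of \<mu>) = t *\<^sub>R x" "energy p \<alpha> \<beta> \<mu> \<le> t"
    "\<exists>(c :: 'n \<Rightarrow> real) (z :: 'n \<Rightarrow> 'z) (w :: 'n \<Rightarrow> 'z).
       \<mu> = (\<Sum>i\<in>UNIV. c i *\<^sub>R (dirac (z i) - dirac (w i))) + smeas \<mu> UNIV *\<^sub>R dirac base_point"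
    using sparse_measure_over_hull_point[of p \<alpha> \<beta> A x t] assms(3-6) tx(1,2) unfolding B_def by auto
  have "F (A (KRu_of \<mu>)) + G_reg p \<alpha> \<beta> (KRu_of \<mu>) \<le> F (A h) + G_reg p \<alpha> \<beta> h" for h
  proof (cases "h \<in> KRu_of ` moment_measures p")
    case False
    then have "G_reg p \<alpha> \<beta> h = \<infinity>" by (simp add: G_reg_def)
    moreover have "F (A h) \<noteq> -\<infinity>" using assms(7) by (simp add: proper_fun_def)
    ultimately show ?thesis by simp
  next
    case True
    then obtain \<nu> where \<nu>: "\<nu> \<in> moment_measures p" "h = KRu_of \<nu>" by blast
    obtain y where y: "y \<in> B" "A h = energy p \<alpha> \<beta> \<nu> *\<^sub>R y"
      using image_in_energy_times_hull[OF assms(3-6) cpt \<nu>(1)] \<nu>(2) unfolding B_def by blast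
    have \<nu>1: "\<nu> \<in> moment_measures 1" using assms(3) \<nu>(1) by (intro moment_measures_1I[of p]) auto
    have "0 \<le> energy p \<alpha> \<beta> \<nu>"
      using assms(4,5) nn_integral_weight(2)[OF \<nu>(1)] KRu_norm_nonneg[OF \<nu>1] by (simp add: energy_def)
    then have "\<Phi> (t, x) \<le> F (A h) + G_reg p \<alpha> \<beta> h"
      using tx(3)[OF _ y(1)] G[OF \<nu>(1)] \<nu>(2) y(2) by (simp add: \<Phi>_def add.commute)
    moreover have "F (A (KRu_of \<mu>)) + G_reg p \<alpha> \<beta> (KRu_of \<mu>) \<le> \<Phi> (t, x)"
      using \<mu>(3) add_left_mono[of "ereal (energy p \<alpha> \<beta> \<mu>)" "ereal t" "F (t *\<^sub>R x)"]
      by (simp add: \<Phi>_def G[OF \<mu>(1)] \<mu>(2) add.commute)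
    ultimately show ?thesis by (rule order_trans[rotated])
  qed
  then show ?thesis using \<mu>(1,4) by blast
qed

end
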